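(* Consider the system of two quadratically semi-linear second-order ODEs $$y''+B^2_{22}y'^2+2B^2_{23}y'z'+B^2_{33}z'^2=0,$$ $$z''+B^3_{22}y'^2+2B^3_{23}y'z'+B^3_{33}z'^2=0,$$ where the coefficients $B^a_{bc}$ are functions of $y$ and $z$ and $'$ denotes the total derivative with respect to $x$. This system is linearizable by point transformations to the simplest system of two equations if and only if the $B^a_{bc}$ satisfy the four conditions $$-B^3_{22}B^3_{33}+B^3_{23y}-B^3_{22z}+B^3_{22}B^2_{23}+B^3_{23}B^3_{23}-B^3_{23}B^2_{22}=0,$$ $$\tfrac43B^3_{33y}-\tfrac43B^3_{23z}+2B^3_{22}B^2_{33}-2B^3_{23}B^2_{23}-\tfrac23B^2_{23y}+\tfrac23B^2_{22z}=0,$$ $$-\tfrac13B^3_{23z}+B^2_{33}B^3_{22}-B^2_{23}B^3_{23}-\tfrac23B^2_{23y}+\tfrac13B^3_{33y}+\tfrac23B^2_{22z}=0,$$ $$-B^2_{33y}+B^2_{23z}-B^2_{22}B^2_{33}+B^2_{23}B^2_{23}-B^2_{23}B^3_{33}+B^2_{33}B^3_{23}=0.$$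
   Context: The superscripts and subscripts $2,3$ on $B$ are index labels ($2$ refers to $y$, $3$ to $z$), not powers; powers occur only on $y'$ and $z'$. A trailing subscript $y$ or $z$ denotes the partial derivative with respect to that variable, e.g. $B^3_{23y}=\partial B^3_{23}/\partial y$. All functions are smooth and all statements are local. A point transformation is a locally invertible change of the independent and dependent variables $u=u(x,y,z)$, $v=v(x,y,z)$, $w=w(x,y,z)$, with $u$ the new independent variable and $v,w$ the new dependent variables. The simplest system of two second-order ODEs is the free particle system $d^2v/du^2=0$, $d^2w/du^2=0$ (whose Lie point symmetry algebra is $sl(4,\mathbb{R})$). A system is linearizable by point transformations to the simplest system if some point transformation maps it to the free particle system. *)

theory Defs
  imports "HOL-Analysis.Analysis"
begin

text \<open>Smoothness on open sets. At step \<open>n + 1\<close>, all directional derivatives of a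
  Frechet differentiable function are required to be of class \<open>n\<close>.\<close>

fun C_on :: "nat \<Rightarrow> 'a::real_normed_vector set \<Rightarrow> ('a \<Rightarrow> 'b::real_normed_vector) \<Rightarrow> bool" where
  "C_on 0 S f \<longleftrightarrow> continuous_on S f"
| "C_on (Suc n) S f \<longleftrightarrow> (\<forall>x\<in>S. f differentiable (at x)) \<and>
     (\<forall>d. C_on n S (\<lambda>x. frechet_derivative f (at x) d))"

definition smooth_on :: "'a::real_normed_vector set \<Rightarrow> ('a \<Rightarrow> 'b::real_normed_vector) \<Rightarrow> bool" where
  "smooth_on S f \<longleftrightarrow> (\<forall>n. C_on n S f)"

definition partial1 :: "(real \<Rightarrow> real \<Rightarrow> real) \<Rightarrow> real \<Rightarrow> real \<Rightarrow> real" where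
  "partial1 f y z = deriv (\<lambda>t. f t z) y"

definition partial2 :: "(real \<Rightarrow> real \<Rightarrow> real) \<Rightarrow> real \<Rightarrow> real \<Rightarrow> real" where
  "partial2 f y z = deriv (\<lambda>t. f y t) z"

text \<open>A system \<open>S\<close> of two second-order equations for \<open>y(x), z(x)\<close> is given by its two
  left-hand sides, \<open>S x y z y' z' y'' z'' = (0, 0)\<close>.\<close>

type_synonym ode_system =
  "real \<Rightarrow> real \<Rightarrow> real \<Rightarrow> real \<Rightarrow> real \<Rightarrow> real \<Rightarrow> real \<Rightarrow> real \<times> real"

definition quadratic_system ::
  "(real \<Rightarrow> real \<Rightarrow> real) \<Rightarrow> (real \<Rightarrow> real \<Rightarrow> real) \<Rightarrow> (real \<Rightarrow> real \<Rightarrow> real) \<Rightarrow>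
   (real \<Rightarrow> real \<Rightarrow> real) \<Rightarrow> (real \<Rightarrow> real \<Rightarrow> real) \<Rightarrow> (real \<Rightarrow> real \<Rightarrow> real) \<Rightarrow> ode_system" where
  "quadratic_system B222 B223 B233 B322 B323 B333 = (\<lambda>x y z p q r s.
     (r + B222 y z * p^2 + 2 * B223 y z * p * q + B233 y z * q^2,
      s + B322 y z * p^2 + 2 * B323 y z * p * q + B333 y z * q^2))"

definition free_particle :: ode_system where
  "free_particle = (\<lambda>x y z p q r s. (r, s))"

definition curve_on :: "real set \<Rightarrow> (real \<Rightarrow> real) \<Rightarrow> (real \<Rightarrow> real) \<Rightarrow> bool" where
  "curve_on I y z \<longleftrightarrow> open I \<and> connected I \<and> smooth_on I y \<and> smooth_on I z"

definition graph_on :: "real set \<Rightarrow> (real \<Rightarrow> real) \<Rightarrow> (real \<Rightarrow> real) \<Rightarrow> (real \<times> real \<times> real) set" where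
  "graph_on I y z = (\<lambda>x. (x, y x, z x)) ` I"

definition solves :: "ode_system \<Rightarrow> real set \<Rightarrow> (real \<Rightarrow> real) \<Rightarrow> (real \<Rightarrow> real) \<Rightarrow> bool" where
  "solves S I y z \<longleftrightarrow>
     (\<forall>x\<in>I. S x (y x) (z x) (deriv y x) (deriv z x) (deriv (deriv y) x) (deriv (deriv z) x) = (0, 0))"

definition point_transformation ::
  "(real \<times> real \<times> real) set \<Rightarrow> (real \<times> real \<times> real \<Rightarrow> real \<times> real \<times> real) \<Rightarrow> bool" where
  "point_transformation V \<phi> \<longleftrightarrow> open V \<and> smooth_on V \<phi> \<and> inj_on \<phi> V \<and>
     open (\<phi> ` V) \<and> smooth_on (\<phi> ` V) (inv_into V \<phi>)"

text \<open>With \<open>\<phi> = (u, v, w)\<close>, the functions \<open>v(u), w(u)\<close> on \<open>J\<close> are the transforms of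
  \<open>y(x), z(x)\<close> on \<open>I\<close> iff \<open>\<phi>\<close> carries the graph of \<open>(y, z)\<close> onto the graph of \<open>(v, w)\<close>. 
  The pairs considered are thus exactly those for which \<open>u\<close> can serve as the independent
  variable along the transformed curve, i.e. where the total derivative of \<open>u\<close> does not vanish.\<close>

definition transforms_system ::
  "(real \<times> real \<times> real) set \<Rightarrow> (real \<times> real \<times> real \<Rightarrow> real \<times> real \<times> real) \<Rightarrow>
   ode_system \<Rightarrow> ode_system \<Rightarrow> bool" where
  "transforms_system V \<phi> S T \<longleftrightarrow>
     (\<forall>I y z J v w. curve_on I y z \<and> curve_on J v w \<and> graph_on I y z \<subseteq> V \<and>
        \<phi> ` graph_on I y z = graph_on J v w \<longrightarrow>
        (solves S I y z \<longleftrightarrow> solves T J v w))"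

text \<open>Local linearizability on a domain \<open>\<Omega>\<close> of \<open>(x, y, z)\<close>-space: near every point of \<open>\<Omega>\<close>
  some point transformation takes the system to the free particle system.\<close>

definition linearizable_on :: "(real \<times> real \<times> real) set \<Rightarrow> ode_system \<Rightarrow> bool" where
  "linearizable_on \<Omega> S \<longleftrightarrow>
     (\<forall>P\<in>\<Omega>. \<exists>V \<phi>. P \<in> V \<and> V \<subseteq> \<Omega> \<and> point_transformation V \<phi> \<and>
        transforms_system V \<phi> S free_particle)"

end

theory Submission
  imports Defs
begin

text \<open>The coefficients are the Christoffel symbols of a torsion-free connection on the \<open>(y, z)\<close>-plane,
  the solutions of the system are its affinely parametrised geodesics, and the four conditions say
  that its curvature vanishes (the second and third are independent combinations of the two
  diagonal curvature components).

  If the curvature vanishes, Frobenius' theorem yields local affine coordinates \<open>v, w\<close>, and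
  \<open>(x, v, w)\<close> linearizes the system. Conversely, the inverse \<open>(X, Y, Z)\<close> of a linearizing
  transformation carries straight lines to solutions, which gives for every direction \<open>d\<close> an identity
  \<open>X\<^sub>d (Y\<^sub>d\<^sub>d + B(d, d)) = Y\<^sub>d X\<^sub>d\<^sub>d\<close>, and similarly for \<open>Z\<close>. Composing with a linear map, the
  first derivative at the given point is the identity; the coefficients of these identities and of
  their first derivatives, as cubic polynomials in \<open>d\<close>, together with the symmetry of the third
  derivatives, force the curvature to vanish.\<close>

section \<open>Calculus of smooth functions\<close>

text \<open>A point transformation may mix \<open>x\<close> with \<open>y\<close> and
  \<open>z\<close>, so a linearization directly gives only projective flatness: the graphs of
  solutions are unparametrised geodesics of the product of a flat line with the plane connection,
  and they are straightened in three dimensions. This still forces flatness. In dimension three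
  projective flatness expresses the curvature \<open>R^i_jkl\<close> through Kronecker deltas and a
  single tensor \<open>P_jk\<close>; in a product all components with an index \<open>x\<close>
  vanish, which leaves \<open>P = 0\<close>. The jet computation is this argument by hand: the
  second derivatives of \<open>X\<close> at the point reflect the freedom of reparametrisation, and
  they cancel in the end. Regularity is the other obstacle. The inverse function theorem and the
  contraction argument yield maps that are only differentiable, whereas smoothness of every order is
  required. In both cases the derivative is a smooth expression in the unknown map, so
  \<open>C_on_bootstrap\<close> gains one order at a time.\<close>

definition dir_deriv :: "'a::real_normed_vector \<Rightarrow> ('a \<Rightarrow> 'b::real_normed_vector) \<Rightarrow> 'a \<Rightarrow> 'b" where
  "dir_deriv d f x = frechet_derivative f (at x) d"

lemma dir_deriv_eq: "(f has_derivative f') (at x) \<Longrightarrow> dir_deriv d f x = f' d"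
  unfolding dir_deriv_def using frechet_derivative_at by metis

text \<open>Since \<open>dir_deriv d\<close> sends functions to functions, it can be iterated; the
  recursion of \<open>C_on\<close> is used only in this form, and its defining equation is therefore
  taken out of the simplifier.\<close>

lemma C_on_Suc_iff:
  "C_on (Suc n) S f \<longleftrightarrow> (\<forall>x\<in>S. f differentiable (at x)) \<and> (\<forall>d. C_on n S (dir_deriv d f))"
  by (simp add: dir_deriv_def[abs_def])

declare C_on.simps(2) [simp del]

lemma C_on_cong:
  assumes "open S" "\<And>x. x \<in> S \<Longrightarrow> f x = g x" "C_on n S f"
  shows "C_on n S g"
  using assms(2,3)
proof (induction n arbitrary: f g)
  case 0
  then show ?case by (auto cong: continuous_on_cong)
next
  case (Suc n)
  have der: "(g has_derivative frechet_derivative f (at x)) (at x)" if "x \<in> S" for x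
    using Suc.prems that assms(1)
    by (metis C_on_Suc_iff frechet_derivative_works has_derivative_transform_within_open)
  have "C_on n S (dir_deriv d g)" for d
  proof (rule Suc.IH)
    show "C_on n S (dir_deriv d f)" using Suc.prems by (simp add: C_on_Suc_iff)
    show "dir_deriv d f x = dir_deriv d g x" if "x \<in> S" for x
      using der[OF that] by (simp add: dir_deriv_eq) (simp add: dir_deriv_def)
  qed
  then show ?case using der by (auto simp: C_on_Suc_iff differentiable_def)
qed

lemma C_on_subset: "C_on n S f \<Longrightarrow> T \<subseteq> S \<Longrightarrow> C_on n T f"
proof (induction n arbitrary: f)
  case 0
  then show ?case by (auto intro: continuous_on_subset)
next
  case (Suc n)
  then show ?case by (auto simp: C_on_Suc_iff)
qed

lemma C_on_continuous_on: "C_on n S f \<Longrightarrow> continuous_on S f"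
proof (cases n)
  case (Suc m)
  moreover assume "C_on n S f"
  ultimately show ?thesis
    by (auto simp: C_on_Suc_iff differentiable_imp_continuous_within intro!: continuous_at_imp_continuous_on)
qed auto

lemma C_on_SucD: "C_on (Suc n) S f \<Longrightarrow> C_on n S f"
proof (induction n arbitrary: f)
  case 0
  then show ?case using C_on_continuous_on by auto
next
  case (Suc n)
  then show ?case using C_on_Suc_iff by blast
qed

text \<open>The closure properties below are inductions through this rule: once a derivative is
  exhibited, only its values in fixed directions have to be of class \<open>n\<close>, and these are
  built from functions to which the induction hypothesis applies.\<close>

lemma C_on_SucI:
  assumes "open S" "\<And>x. x \<in> S \<Longrightarrow> (f has_derivative f' x) (at x)" "\<And>d. C_on n S (\<lambda>x. f' x d)"
  shows "C_on (Suc n) S f"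
proof -
  have "C_on n S (dir_deriv d f)" for d
    by (rule C_on_cong[OF assms(1) _ assms(3)[of d]]) (simp add: dir_deriv_eq[OF assms(2)])
  then show ?thesis using assms(2) by (auto simp: C_on_Suc_iff differentiable_def)
qed

lemma C_on_has_derivative:
  "C_on (Suc n) S f \<Longrightarrow> x \<in> S \<Longrightarrow> (f has_derivative (\<lambda>d. dir_deriv d f x)) (at x)"
  by (simp add: C_on_Suc_iff dir_deriv_def frechet_derivative_works)

lemma C_on_dir_deriv: "C_on (Suc n) S f \<Longrightarrow> C_on n S (dir_deriv d f)"
  by (simp add: C_on_Suc_iff)

lemma C_on_const: "open S \<Longrightarrow> C_on n S (\<lambda>x. c)"
proof (induction n arbitrary: c)
  case (Suc n)
  then show ?case by (intro C_on_SucI[where f' = "\<lambda>_ _. 0"]) (auto)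
qed auto

lemma C_on_bounded_linear:
  assumes "open S" "bounded_linear h" "C_on n S f"
  shows "C_on n S (\<lambda>x. h (f x))"
  using assms(3)
proof (induction n arbitrary: f)
  case 0
  then show ?case using assms bounded_linear.continuous_on by (auto)
next
  case (Suc n)
  show ?case
  proof (rule C_on_SucI[OF assms(1)])
    show "((\<lambda>x. h (f x)) has_derivative (\<lambda>d. h (dir_deriv d f x))) (at x)" if "x \<in> S" for x
      using bounded_linear.has_derivative[OF assms(2) C_on_has_derivative[OF Suc.prems that]] .
    show "C_on n S (\<lambda>x. h (dir_deriv d f x))" for d
      using Suc.IH[OF C_on_dir_deriv[OF Suc.prems]] by simp
  qed
qed

lemma C_on_id: "open S \<Longrightarrow> C_on n S (\<lambda>x. x)"
proof (cases n)
  case (Suc m)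
  moreover assume "open S"
  ultimately show ?thesis by (auto intro!: C_on_SucI[where f' = "\<lambda>_ d. d"] C_on_const)
qed auto

lemma C_on_add:
  assumes "open S" "C_on n S f" "C_on n S g"
  shows "C_on n S (\<lambda>x. f x + g x)"
  using assms(2,3)
proof (induction n arbitrary: f g)
  case 0
  then show ?case by (auto intro: continuous_intros)
next
  case (Suc n)
  show ?case
  proof (rule C_on_SucI[OF assms(1)])
    show "((\<lambda>x. f x + g x) has_derivative (\<lambda>d. dir_deriv d f x + dir_deriv d g x)) (at x)" if "x \<in> S" for x
      by (rule has_derivative_add[OF C_on_has_derivative[OF Suc.prems(1) that] C_on_has_derivative[OF Suc.prems(2) that]])
    show "C_on n S (\<lambda>x. dir_deriv d f x + dir_deriv d g x)" for d
      by (intro Suc.IH C_on_dir_deriv Suc.prems)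
  qed
qed

lemma C_on_bilinear:
  assumes "open S" "bounded_bilinear pr" "C_on n S f" "C_on n S g"
  shows "C_on n S (\<lambda>x. pr (f x) (g x))"
  using assms(3,4)
proof (induction n arbitrary: f g)
  case 0
  then show ?case using bounded_bilinear.continuous_on[OF assms(2)] by auto
next
  case (Suc n)
  show ?case
  proof (rule C_on_SucI[OF assms(1)])
    show "((\<lambda>x. pr (f x) (g x)) has_derivative
        (\<lambda>d. pr (f x) (dir_deriv d g x) + pr (dir_deriv d f x) (g x))) (at x)" if "x \<in> S" for x
      by (rule bounded_bilinear.FDERIV[OF assms(2) C_on_has_derivative[OF Suc.prems(1) that]
          C_on_has_derivative[OF Suc.prems(2) that]])
    show "C_on n S (\<lambda>x. pr (f x) (dir_deriv d g x) + pr (dir_deriv d f x) (g x))" for d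
      by (intro C_on_add assms(1) Suc.IH C_on_dir_deriv Suc.prems C_on_SucD[OF Suc.prems(1)]
          C_on_SucD[OF Suc.prems(2)])
  qed
qed

lemma C_on_sum:
  assumes "open S" "\<And>i. i \<in> A \<Longrightarrow> C_on n S (f i)"
  shows "C_on n S (\<lambda>x. \<Sum>i\<in>A. f i x)"
  using assms(2)
  by (induction A rule: infinite_finite_induct) (auto intro!: C_on_const C_on_add assms(1))

lemma linear_eq_sum_Basis:
  fixes f :: "'a::euclidean_space \<Rightarrow> 'b::real_normed_vector"
  assumes "linear f"
  shows "f x = (\<Sum>b\<in>Basis. (x \<bullet> b) *\<^sub>R f b)"
proof -
  have "f (\<Sum>b\<in>Basis. (x \<bullet> b) *\<^sub>R b) = (\<Sum>b\<in>Basis. f ((x \<bullet> b) *\<^sub>R b))"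
    by (rule linear_sum[OF assms])
  also have "\<dots> = (\<Sum>b\<in>Basis. (x \<bullet> b) *\<^sub>R f b)"
    by (intro sum.cong refl linear_scale[OF assms])
  finally show ?thesis by (simp only: euclidean_representation)
qed

text \<open>The chain rule produces a derivative of \<open>g\<close> in the direction
  \<open>dir_deriv d f x\<close>, which varies with \<open>x\<close>, while \<open>C_on\<close>
  speaks of fixed directions. Expanding the direction in the basis of the Euclidean middle space
  reduces it to products of scalar coefficients and derivatives of \<open>g\<close> in basis
  directions.\<close>

lemma C_on_compose:
  fixes f :: "'a::real_normed_vector \<Rightarrow> 'b::euclidean_space" and g :: "'b \<Rightarrow> 'c::real_normed_vector"
  assumes "open S" "C_on n S f" "C_on n T g" "\<And>x. x \<in> S \<Longrightarrow> f x \<in> T"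
  shows "C_on n S (\<lambda>x. g (f x))"
  using assms(2,3)
proof (induction n arbitrary: g)
  case 0
  then show ?case using assms(4) by (auto intro: continuous_on_compose2)
next
  case (Suc n)
  show ?case
  proof (rule C_on_SucI[OF assms(1)])
    fix x assume x: "x \<in> S"
    have g: "(g has_derivative (\<lambda>d. dir_deriv d g (f x))) (at (f x))"
      using Suc.prems(2) assms(4)[OF x] by (rule C_on_has_derivative)
    have *: "dir_deriv e g (f x) = (\<Sum>b\<in>Basis. (e \<bullet> b) *\<^sub>R dir_deriv b g (f x))" for e
      by (rule linear_eq_sum_Basis[OF has_derivative_linear[OF g]])
    have "((\<lambda>x. g (f x)) has_derivative (\<lambda>d. dir_deriv (dir_deriv d f x) g (f x))) (at x)"
      by (rule has_derivative_compose[OF C_on_has_derivative[OF Suc.prems(1) x] g])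
    then show "((\<lambda>x. g (f x)) has_derivative
        (\<lambda>d. \<Sum>b\<in>Basis. (dir_deriv d f x \<bullet> b) *\<^sub>R dir_deriv b g (f x))) (at x)"
      by (simp only: *[symmetric])
  next
    show "C_on n S (\<lambda>x. \<Sum>b\<in>Basis. (dir_deriv d f x \<bullet> b) *\<^sub>R dir_deriv b g (f x))" for d
      by (intro C_on_sum C_on_bilinear[OF _ bounded_bilinear_scaleR] assms(1) Suc.IH
          C_on_bounded_linear[OF _ bounded_linear_inner_left] C_on_dir_deriv[OF Suc.prems(1)]
          C_on_SucD[OF Suc.prems(1)] C_on_dir_deriv[OF Suc.prems(2)])
  qed
qed

lemma C_on_inverse:
  fixes f :: "'a::real_normed_vector \<Rightarrow> real"
  assumes "open S" "C_on n S f" "\<And>x. x \<in> S \<Longrightarrow> f x \<noteq> 0"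
  shows "C_on n S (\<lambda>x. inverse (f x))"
  using assms(2)
proof (induction n)
  case 0
  then show ?case using assms(3) by (auto intro: continuous_intros)
next
  case (Suc n)
  show ?case
  proof (rule C_on_SucI[OF assms(1)])
    show "((\<lambda>x. inverse (f x)) has_derivative
        (\<lambda>d. (- 1) * (inverse (f x) * dir_deriv d f x * inverse (f x)))) (at x)" if "x \<in> S" for x
      using has_derivative_compose[OF C_on_has_derivative[OF Suc.prems that]
          has_derivative_inverse'[OF assms(3)[OF that]]] by simp
    show "C_on n S (\<lambda>x. (- 1) * (inverse (f x) * dir_deriv d f x * inverse (f x)))" for d
      by (intro C_on_bilinear[OF _ bounded_bilinear_mult] assms(1) Suc.IH C_on_SucD[OF Suc.prems]
          C_on_dir_deriv[OF Suc.prems] C_on_const)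
  qed
qed

lemma C_on_Pair:
  assumes "open S" "C_on n S f" "C_on n S g"
  shows "C_on n S (\<lambda>x. (f x, g x))"
  using assms(2,3)
proof (induction n arbitrary: f g)
  case 0
  then show ?case by (auto intro: continuous_intros)
next
  case (Suc n)
  show ?case
  proof (rule C_on_SucI[OF assms(1)])
    show "((\<lambda>x. (f x, g x)) has_derivative (\<lambda>d. (dir_deriv d f x, dir_deriv d g x))) (at x)" if "x \<in> S" for x
      by (rule has_derivative_Pair[OF C_on_has_derivative[OF Suc.prems(1) that] C_on_has_derivative[OF Suc.prems(2) that]])
    show "C_on n S (\<lambda>x. (dir_deriv d f x, dir_deriv d g x))" for d
      by (intro Suc.IH C_on_dir_deriv Suc.prems)
  qed
qed

text \<open>Meant for maps whose derivative is expressible through the map itself, such as local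
  inverses and solutions of differential equations: class \<open>m\<close> of \<open>g\<close>
  passes to \<open>g'\<close>, hence class \<open>Suc m\<close> to \<open>g\<close>.\<close>

lemma C_on_bootstrap:
  fixes g :: "'a::real_normed_vector \<Rightarrow> 'b::euclidean_space"
  assumes "open T"
    and "\<And>x. x \<in> T \<Longrightarrow> (g has_derivative g' x) (at x)"
    and "\<And>m d. C_on m T g \<Longrightarrow> C_on m T (\<lambda>x. g' x d)"
  shows "C_on n T g"
proof (induction n)
  case 0
  show ?case using has_derivative_continuous[OF assms(2)]
    by (auto intro!: continuous_at_imp_continuous_on)
next
  case (Suc n)
  show ?case by (rule C_on_SucI[OF assms(1,2) assms(3)[OF Suc]])
qed

section \<open>Smooth functions: closure properties at all orders\<close>

named_theorems smooth_intros

lemma smooth_on_cong: "open S \<Longrightarrow> (\<And>x. x \<in> S \<Longrightarrow> f x = g x) \<Longrightarrow> smooth_on S f \<Longrightarrow> smooth_on S g"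
  unfolding smooth_on_def using C_on_cong by blast

lemma smooth_on_subset: "smooth_on S f \<Longrightarrow> T \<subseteq> S \<Longrightarrow> smooth_on T f"
  unfolding smooth_on_def using C_on_subset by blast

lemma smooth_on_continuous_on: "smooth_on S f \<Longrightarrow> continuous_on S f"
  unfolding smooth_on_def using C_on_continuous_on by blast

lemma smooth_on_has_derivative:
  "smooth_on S f \<Longrightarrow> x \<in> S \<Longrightarrow> (f has_derivative (\<lambda>d. dir_deriv d f x)) (at x)"
  unfolding smooth_on_def using C_on_has_derivative by blast

lemma smooth_on_dir_deriv [smooth_intros]: "smooth_on S f \<Longrightarrow> smooth_on S (dir_deriv d f)"
  unfolding smooth_on_def using C_on_dir_deriv by blast

lemma smooth_on_const [smooth_intros]: "open S \<Longrightarrow> smooth_on S (\<lambda>x. c)"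
  unfolding smooth_on_def using C_on_const by blast

lemma smooth_on_id [smooth_intros]: "open S \<Longrightarrow> smooth_on S (\<lambda>x. x)"
  unfolding smooth_on_def using C_on_id by blast

lemma smooth_on_bounded_linear:
  "open S \<Longrightarrow> bounded_linear h \<Longrightarrow> smooth_on S f \<Longrightarrow> smooth_on S (\<lambda>x. h (f x))"
  unfolding smooth_on_def using C_on_bounded_linear by blast

lemma smooth_on_fst [smooth_intros]: "open S \<Longrightarrow> smooth_on S f \<Longrightarrow> smooth_on S (\<lambda>x. fst (f x))"
  by (rule smooth_on_bounded_linear[OF _ bounded_linear_fst])

lemma smooth_on_snd [smooth_intros]: "open S \<Longrightarrow> smooth_on S f \<Longrightarrow> smooth_on S (\<lambda>x. snd (f x))"
  by (rule smooth_on_bounded_linear[OF _ bounded_linear_snd])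

lemma smooth_on_Pair [smooth_intros]:
  "open S \<Longrightarrow> smooth_on S f \<Longrightarrow> smooth_on S g \<Longrightarrow> smooth_on S (\<lambda>x. (f x, g x))"
  unfolding smooth_on_def using C_on_Pair by blast

lemma smooth_on_add [smooth_intros]:
  "open S \<Longrightarrow> smooth_on S f \<Longrightarrow> smooth_on S g \<Longrightarrow> smooth_on S (\<lambda>x. f x + g x)"
  unfolding smooth_on_def using C_on_add by blast

lemma smooth_on_minus [smooth_intros]:
  "open S \<Longrightarrow> smooth_on S f \<Longrightarrow> smooth_on S (\<lambda>x. - f x)"
  by (rule smooth_on_bounded_linear[OF _ bounded_linear_minus[OF bounded_linear_ident]])

lemma smooth_on_diff [smooth_intros]:
  "open S \<Longrightarrow> smooth_on S f \<Longrightarrow> smooth_on S g \<Longrightarrow> smooth_on S (\<lambda>x. f x - g x)"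
  using smooth_on_add[OF _ _ smooth_on_minus, of S f g] by simp

lemma smooth_on_scaleR [smooth_intros]:
  "open S \<Longrightarrow> smooth_on S f \<Longrightarrow> smooth_on S g \<Longrightarrow> smooth_on S (\<lambda>x. f x *\<^sub>R g x)"
  unfolding smooth_on_def using C_on_bilinear[OF _ bounded_bilinear_scaleR] by blast

lemma smooth_on_mult [smooth_intros]:
  fixes f :: "'a::real_normed_vector \<Rightarrow> 'b::real_normed_algebra"
  shows "open S \<Longrightarrow> smooth_on S f \<Longrightarrow> smooth_on S g \<Longrightarrow> smooth_on S (\<lambda>x. f x * g x)"
  unfolding smooth_on_def using C_on_bilinear[OF _ bounded_bilinear_mult] by blast

lemma smooth_on_divide [smooth_intros]:
  fixes f :: "'a::real_normed_vector \<Rightarrow> real"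
  shows "open S \<Longrightarrow> smooth_on S f \<Longrightarrow> smooth_on S g \<Longrightarrow> (\<And>x. x \<in> S \<Longrightarrow> g x \<noteq> 0) \<Longrightarrow>
    smooth_on S (\<lambda>x. f x / g x)"
  unfolding divide_inverse
  by (intro smooth_on_mult) (auto simp: smooth_on_def C_on_inverse)

lemma smooth_on_compose:
  fixes f :: "'a::real_normed_vector \<Rightarrow> 'b::euclidean_space"
  assumes "open S" "smooth_on S f" "smooth_on T g" "\<And>x. x \<in> S \<Longrightarrow> f x \<in> T"
  shows "smooth_on S (\<lambda>x. g (f x))"
  unfolding smooth_on_def
  by (rule allI, rule C_on_compose[OF assms(1) _ _ assms(4)]) (use assms in \<open>simp_all add: smooth_on_def\<close>)

text \<open>The derivative of the inverse is a smooth function of the inverse itself, so its regularity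
  improves one order at a time.\<close>

lemma smooth_on_inverse_map:
  fixes g :: "'a::real_normed_vector \<Rightarrow> 'b::euclidean_space"
  assumes "open T" "\<And>x. x \<in> T \<Longrightarrow> g x \<in> S"
    and "\<And>x. x \<in> T \<Longrightarrow> (g has_derivative (\<lambda>d. H d (g x))) (at x)"
    and "\<And>d. smooth_on S (H d)"
  shows "smooth_on T g"
  unfolding smooth_on_def
proof
  fix n show "C_on n T g"
  proof (rule C_on_bootstrap[OF assms(1,3)])
    show "C_on m T (\<lambda>x. H d (g x))" if "C_on m T g" for m d
      by (rule C_on_compose[OF assms(1) that _ assms(2)]) (use assms(4) in \<open>simp_all add: smooth_on_def\<close>)
  qed
qed

section \<open>Directional derivatives: linearity, restriction to lines, symmetry\<close>

lemma smooth_on_dir_deriv_lincomb: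
  assumes "smooth_on S f" "x \<in> S"
  shows "dir_deriv (d + e) f x = dir_deriv d f x + dir_deriv e f x"
    and "dir_deriv (r *\<^sub>R d) f x = r *\<^sub>R dir_deriv d f x"
  by (rule linear_add[OF has_derivative_linear[OF smooth_on_has_derivative[OF assms]]])
    (rule linear_scale[OF has_derivative_linear[OF smooth_on_has_derivative[OF assms]]])

lemma dir_deriv_cong:
  assumes "open S" "x \<in> S" "\<And>y. y \<in> S \<Longrightarrow> f y = g y" "smooth_on S f"
  shows "dir_deriv d f x = dir_deriv d g x"
  using has_derivative_transform_within_open[OF smooth_on_has_derivative[OF assms(4,2)] assms(1,2,3)]
  by (simp add: dir_deriv_eq)

lemma smooth_on_line_has_derivative:
  assumes "smooth_on S f" "x + t *\<^sub>R d \<in> S"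
  shows "((\<lambda>t. f (x + t *\<^sub>R d)) has_vector_derivative dir_deriv d f (x + t *\<^sub>R d)) (at t)"
proof -
  have "((\<lambda>t. x + t *\<^sub>R d) has_derivative (\<lambda>s. s *\<^sub>R d)) (at t)"
    by (auto intro!: derivative_eq_intros)
  from diff_chain_at[OF this smooth_on_has_derivative[OF assms]] show ?thesis
    by (simp add: o_def has_vector_derivative_def smooth_on_dir_deriv_lincomb[OF assms])
qed

text \<open>Both mixed derivatives are limits of the same second difference, by the mean value theorem.\<close>

lemma second_difference_mvt:
  fixes f :: "'a::real_normed_vector \<Rightarrow> real"
  assumes "smooth_on S f" "0 < h"
    and "\<And>s t. 0 \<le> s \<Longrightarrow> s \<le> h \<Longrightarrow> 0 \<le> t \<Longrightarrow> t \<le> h \<Longrightarrow> x + s *\<^sub>R d + t *\<^sub>R e \<in> S"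
  obtains s t where "0 < s" "s < h" "0 < t" "t < h"
    "f (x + h *\<^sub>R d + h *\<^sub>R e) - f (x + h *\<^sub>R d) - f (x + h *\<^sub>R e) + f x
      = h * (h * dir_deriv e (dir_deriv d f) (x + s *\<^sub>R d + t *\<^sub>R e))"
proof -
  \<comment> \<open>The mean value theorem in the direction \<open>d\<close> is applied to the
    increment of \<open>f\<close> over an edge parallel to \<open>e\<close>; the second application,
    in the direction \<open>e\<close>, acts on \<open>dir_deriv d f\<close> at the \<open>s\<close>
    found here.\<close>
  have "\<exists>s. 0 < s \<and> s < h \<and> (f ((x + h *\<^sub>R e) + h *\<^sub>R d) - f (x + h *\<^sub>R d)) -
      (f ((x + h *\<^sub>R e) + 0 *\<^sub>R d) - f (x + 0 *\<^sub>R d)) =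
      (h - 0) * (dir_deriv d f ((x + h *\<^sub>R e) + s *\<^sub>R d) - dir_deriv d f (x + s *\<^sub>R d))"
  proof (rule MVT2[OF assms(2)])
    fix s assume s: "0 \<le> s" "s \<le> h"
    have "x + h *\<^sub>R e + s *\<^sub>R d \<in> S" "x + s *\<^sub>R d \<in> S"
      using assms(3)[OF s, of h] assms(3)[OF s, of 0] assms(2) by (simp_all add: ac_simps)
    then show "((\<lambda>s. f (x + h *\<^sub>R e + s *\<^sub>R d) - f (x + s *\<^sub>R d)) has_real_derivative
        dir_deriv d f (x + h *\<^sub>R e + s *\<^sub>R d) - dir_deriv d f (x + s *\<^sub>R d)) (at s)"
      by (intro DERIV_diff) (simp_all add: has_real_derivative_iff_has_vector_derivative
          smooth_on_line_has_derivative[OF assms(1)])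
  qed
  then obtain s where s: "0 < s" "s < h" and *: "(f ((x + h *\<^sub>R e) + h *\<^sub>R d) - f (x + h *\<^sub>R d)) -
      (f (x + h *\<^sub>R e) - f x) =
      h * (dir_deriv d f ((x + h *\<^sub>R e) + s *\<^sub>R d) - dir_deriv d f (x + s *\<^sub>R d))" by auto
  have "\<exists>t. 0 < t \<and> t < h \<and> dir_deriv d f (x + s *\<^sub>R d + h *\<^sub>R e) - dir_deriv d f (x + s *\<^sub>R d + 0 *\<^sub>R e)
      = (h - 0) * dir_deriv e (dir_deriv d f) (x + s *\<^sub>R d + t *\<^sub>R e)"
    by (rule MVT2[OF assms(2)]) (use s assms(1,3) in
      \<open>auto simp: has_real_derivative_iff_has_vector_derivative
         intro!: smooth_on_line_has_derivative[where S = S] smooth_on_dir_deriv\<close>)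
  then obtain t where "0 < t" "t < h" "dir_deriv d f (x + s *\<^sub>R d + h *\<^sub>R e) - dir_deriv d f (x + s *\<^sub>R d)
      = h * dir_deriv e (dir_deriv d f) (x + s *\<^sub>R d + t *\<^sub>R e)" by auto
  with s * show ?thesis by (intro that[of s t]) (auto simp: ac_simps)
qed

lemma dir_deriv_commute:
  fixes f :: "'a::real_normed_vector \<Rightarrow> real"
  assumes "open S" "smooth_on S f" "x \<in> S"
  shows "dir_deriv e (dir_deriv d f) x = dir_deriv d (dir_deriv e f) x"
proof -
  \<comment> \<open>A parallelogram with sides \<open>h\<close> times \<open>d\<close> and
    \<open>e\<close> stays within distance \<open>h * K\<close> of its corner; the summand 1 makes
    \<open>K\<close> positive and the estimate strict.\<close>
  define K where "K = norm d + norm e + 1"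
  have K: "K > 0" unfolding K_def using norm_ge_zero[of d] norm_ge_zero[of e] by linarith
  have small: "norm (s *\<^sub>R d + t *\<^sub>R e) < h * K" if "0 \<le> s" "s \<le> h" "0 \<le> t" "t \<le> h" "0 < h" for s t h
  proof -
    have "norm (s *\<^sub>R d + t *\<^sub>R e) \<le> s * norm d + t * norm e"
      using norm_triangle_ineq[of "s *\<^sub>R d" "t *\<^sub>R e"] that by simp
    also have "\<dots> \<le> h * norm d + h * norm e" using that by (intro add_mono mult_right_mono) auto
    also have "\<dots> < h * K" using that by (simp add: K_def algebra_simps)
    finally show ?thesis .
  qed
  have "\<bar>dir_deriv e (dir_deriv d f) x - dir_deriv d (dir_deriv e f) x\<bar> \<le> \<epsilon>" if "0 < \<epsilon>" for \<epsilon>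
  proof -
    have "isCont (dir_deriv e (dir_deriv d f)) x" "isCont (dir_deriv d (dir_deriv e f)) x"
      using assms by (auto simp: continuous_on_eq_continuous_at
          dest!: smooth_on_dir_deriv[THEN smooth_on_dir_deriv, THEN smooth_on_continuous_on])
    then have "\<exists>r>0. \<forall>y. dist y x < r \<longrightarrow> dist (dir_deriv e (dir_deriv d f) y) (dir_deriv e (dir_deriv d f) x) < \<epsilon> / 2"
      "\<exists>r>0. \<forall>y. dist y x < r \<longrightarrow> dist (dir_deriv d (dir_deriv e f) y) (dir_deriv d (dir_deriv e f) x) < \<epsilon> / 2"
      unfolding continuous_at_eps_delta using half_gt_zero[OF \<open>0 < \<epsilon>\<close>] by blast+
    then obtain r1 r2 where r: "r1 > 0" "r2 > 0"
      and r1: "\<And>y. dist y x < r1 \<Longrightarrow> \<bar>dir_deriv e (dir_deriv d f) y - dir_deriv e (dir_deriv d f) x\<bar> < \<epsilon> / 2"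
      and r2: "\<And>y. dist y x < r2 \<Longrightarrow> \<bar>dir_deriv d (dir_deriv e f) y - dir_deriv d (dir_deriv e f) x\<bar> < \<epsilon> / 2"
      unfolding dist_real_def by blast
    obtain r3 where r3: "r3 > 0" "ball x r3 \<subseteq> S" using assms open_contains_ball by blast
    define h where "h = min r1 (min r2 r3) / K"
    have h: "0 < h" "h * K \<le> r1" "h * K \<le> r2" "h * K \<le> r3" using r r3 K by (auto simp: h_def)
    have inS: "x + s *\<^sub>R d + t *\<^sub>R e \<in> S" if "0 \<le> s" "s \<le> h" "0 \<le> t" "t \<le> h" for s t
      using small[OF that h(1)] h r3 by (auto simp: dist_norm norm_minus_commute subset_iff add.assoc)
    obtain s t where st: "0 < s" "s < h" "0 < t" "t < h"
      "f (x + h *\<^sub>R d + h *\<^sub>R e) - f (x + h *\<^sub>R d) - f (x + h *\<^sub>R e) + f x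
      = h * (h * dir_deriv e (dir_deriv d f) (x + s *\<^sub>R d + t *\<^sub>R e))"
      using second_difference_mvt[OF assms(2) h(1) inS] .
    have inS': "x + s *\<^sub>R e + t *\<^sub>R d \<in> S" if "0 \<le> s" "s \<le> h" "0 \<le> t" "t \<le> h" for s t
      using inS[of t s] that by (simp add: ac_simps)
    obtain s' t' where st': "0 < s'" "s' < h" "0 < t'" "t' < h"
      "f (x + h *\<^sub>R e + h *\<^sub>R d) - f (x + h *\<^sub>R e) - f (x + h *\<^sub>R d) + f x
      = h * (h * dir_deriv d (dir_deriv e f) (x + s' *\<^sub>R e + t' *\<^sub>R d))"
      using second_difference_mvt[OF assms(2) h(1) inS'] .
    have sw: "x + h *\<^sub>R e + h *\<^sub>R d = x + h *\<^sub>R d + h *\<^sub>R e" by (simp add: ac_simps)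
    have cancel: "p = q" if "a - b - c + k = h * (h * p)" "a - c - b + k = h * (h * q)" for a b c k p q :: real
    proof -
      have "h * (h * p) = h * (h * q)" using that by linarith
      then show ?thesis using h(1) by simp
    qed
    have "dir_deriv e (dir_deriv d f) (x + s *\<^sub>R d + t *\<^sub>R e) =
        dir_deriv d (dir_deriv e f) (x + s' *\<^sub>R e + t' *\<^sub>R d)"
      by (rule cancel[OF st(5) st'(5)[unfolded sw]])
    moreover have "dist (x + s *\<^sub>R d + t *\<^sub>R e) x < r1"
      using small[of s h t] st(1-4) h(1,2) by (simp add: dist_norm add.assoc)
    moreover have "dist (x + s' *\<^sub>R e + t' *\<^sub>R d) x < r2"
      using small[of t' h s'] st'(1-4) h(1,3) by (simp add: dist_norm add.assoc add.commute)
    ultimately show ?thesis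
      using r1[of "x + s *\<^sub>R d + t *\<^sub>R e"] r2[of "x + s' *\<^sub>R e + t' *\<^sub>R d"] by linarith
  qed
  then have "\<bar>dir_deriv e (dir_deriv d f) x - dir_deriv d (dir_deriv e f) x\<bar> \<le> 0"
    by (rule field_le_epsilon) auto
  then show ?thesis by simp
qed

section \<open>Total linear systems in the plane\<close>

text \<open>The oriented integral of \<open>f\<close> from \<open>a\<close> to \<open>y\<close>; rescaling to the unit interval covers
  \<open>y < a\<close> as well.\<close>

definition seg_integral :: "real \<Rightarrow> real \<Rightarrow> (real \<Rightarrow> 'e::banach) \<Rightarrow> 'e" where
  "seg_integral a y f = (y - a) *\<^sub>R integral {0..1} (\<lambda>\<tau>. f (a + \<tau> * (y - a)))"

lemma seg_integral_self [simp]: "seg_integral a a f = 0"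
  by (simp add: seg_integral_def)

lemma seg_point_mem:
  fixes a y r \<tau> :: real
  assumes "y \<in> {a - r..a + r}" "\<tau> \<in> {0..1}"
  shows "a + \<tau> * (y - a) \<in> {a - r..a + r}"
proof -
  have "\<bar>\<tau> * (y - a)\<bar> \<le> 1 * r"
    unfolding abs_mult using assms by (intro mult_mono) (auto simp: abs_le_iff)
  then show ?thesis by (auto simp: abs_le_iff)
qed

lemma seg_integrand_continuous:
  fixes a r :: real
  assumes "continuous_on {a - r..a + r} f" "y \<in> {a - r..a + r}"
  shows "continuous_on {0..1} (\<lambda>\<tau>. f (a + \<tau> * (y - a)))"
  by (rule continuous_on_compose2[OF assms(1)])
    (use seg_point_mem[OF assms(2)] in \<open>auto intro!: continuous_intros\<close>)

lemma seg_integral_cong: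
  assumes "y \<in> {a - r..a + r}" "\<And>t. t \<in> {a - r..a + r} \<Longrightarrow> f t = g t"
  shows "seg_integral a y f = seg_integral a y g"
  unfolding seg_integral_def using seg_point_mem[OF assms(1)] assms(2)
  by (intro arg_cong2[where f = scaleR] refl integral_cong) auto

lemma seg_integral_diff:
  assumes "continuous_on {a - r..a + r} f" "continuous_on {a - r..a + r} g" "y \<in> {a - r..a + r}"
  shows "seg_integral a y (\<lambda>t. f t - g t) = seg_integral a y f - seg_integral a y g"
  unfolding seg_integral_def
  by (subst integral_diff)
    (auto intro!: integrable_continuous_interval seg_integrand_continuous assms simp: scaleR_diff_right)

lemma norm_seg_integral_le:
  assumes "continuous_on {a - r..a + r} f" "y \<in> {a - r..a + r}"
    and "\<And>t. t \<in> {a - r..a + r} \<Longrightarrow> norm (f t) \<le> M"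
  shows "norm (seg_integral a y f) \<le> r * M"
proof -
  have "norm (integral {0..1} (\<lambda>\<tau>. f (a + \<tau> * (y - a)))) \<le> M * (1 - 0)"
    by (rule integral_bound) (use assms seg_point_mem[OF assms(2)] seg_integrand_continuous[OF assms(1,2)] in auto)
  moreover have "norm (y - a) \<le> r" using assms(2) by (auto simp: abs_le_iff)
  ultimately show ?thesis
    unfolding seg_integral_def norm_scaleR by (intro mult_mono) (use assms(2) in auto)
qed

lemma seg_integral_ftc:
  assumes "\<And>t. t \<in> {a - r..a + r} \<Longrightarrow> (G has_vector_derivative f t) (at t within {a - r..a + r})"
    and "y \<in> {a - r..a + r}"
  shows "seg_integral a y f = G y - G a"
proof -
  have "((\<lambda>\<tau>. (y - a) *\<^sub>R f (a + \<tau> * (y - a))) has_integral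
      (G (a + 1 * (y - a)) - G (a + 0 * (y - a)))) {0..1}"
  proof (rule fundamental_theorem_of_calculus)
    fix \<tau> :: real assume \<tau>: "\<tau> \<in> {0..1}"
    have "((\<lambda>\<tau>. a + \<tau> * (y - a)) has_vector_derivative (y - a)) (at \<tau> within {0..1})"
      by (auto intro!: derivative_eq_intros simp: has_real_derivative_iff_has_vector_derivative[symmetric])
    moreover have "(G has_vector_derivative f (a + \<tau> * (y - a)))
        (at (a + \<tau> * (y - a)) within (\<lambda>\<tau>. a + \<tau> * (y - a)) ` {0..1})"
      by (rule has_vector_derivative_within_subset[OF assms(1)]) (use seg_point_mem[OF assms(2)] \<tau> in auto)
    ultimately show "((\<lambda>\<tau>. G (a + \<tau> * (y - a))) has_vector_derivative (y - a) *\<^sub>R f (a + \<tau> * (y - a)))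
        (at \<tau> within {0..1})"
      using vector_diff_chain_within[of "\<lambda>\<tau>. a + \<tau> * (y - a)" "y - a" \<tau> "{0..1}" G "f (a + \<tau> * (y - a))"]
      by (simp add: o_def)
  qed simp
  from integral_unique[OF this] show ?thesis by (simp add: seg_integral_def)
qed

lemma seg_integral_has_vector_derivative:
  assumes "continuous_on {a - r..a + r} f" "y \<in> {a - r..a + r}"
  shows "((\<lambda>y. seg_integral a y f) has_vector_derivative f y) (at y within {a - r..a + r})"
proof -
  obtain G where G: "\<And>t. t \<in> {a - r..a + r} \<Longrightarrow>
      (G has_vector_derivative f t) (at t within {a - r..a + r})"
    using antiderivative_continuous[OF assms(1)] by blast
  have "((\<lambda>y. G y - G a) has_vector_derivative f y) (at y within {a - r..a + r})"
    using has_vector_derivative_diff[OF G[OF assms(2)] has_vector_derivative_const] by simp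
  then show ?thesis
    by (rule has_vector_derivative_transform[OF assms(2), rotated]) (rule seg_integral_ftc[OF G])
qed

text \<open>After rescaling, the end point \<open>y\<close> is a parameter of the integrand over the
  fixed unit interval, so joint continuity is that of an ordinary parameter integral.\<close>

lemma continuous_on_seg_integral:
  assumes "continuous_on (U \<times> {a - r..a + r}) (\<lambda>(u, t). f u t)"
  shows "continuous_on (U \<times> {a - r..a + r}) (\<lambda>(u, y). seg_integral a y (f u))"
proof -
  have "continuous_on ((U \<times> {a - r..a + r}) \<times> cbox 0 1) (\<lambda>((u, y), \<tau>). f u (a + \<tau> * (y - a)))"
    unfolding case_prod_beta
    by (rule continuous_on_compose2[OF assms[unfolded case_prod_beta],
          of _ "\<lambda>x. (fst (fst x), a + snd x * (snd (fst x) - a))", simplified])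
      (use seg_point_mem[of _ a r] in \<open>auto intro!: continuous_intros\<close>)
  then have "continuous_on (U \<times> {a - r..a + r})
      (\<lambda>p. integral (cbox 0 1) (\<lambda>\<tau>. f (fst p) (a + \<tau> * (snd p - a))))"
    by (intro integral_continuous_on_param) (simp add: case_prod_beta)
  then show ?thesis
    unfolding seg_integral_def case_prod_beta by (intro continuous_intros) simp
qed

lemma continuous_on_slices:
  assumes "continuous_on (Iy \<times> Iz) f"
  shows "z \<in> Iz \<Longrightarrow> continuous_on Iy (\<lambda>y. f (y, z))" "y \<in> Iy \<Longrightarrow> continuous_on Iz (\<lambda>z. f (y, z))"
  by (rule continuous_on_compose2[OF assms]; auto intro!: continuous_intros)+

lemma continuous_on_seg_integral_fst:
  assumes "continuous_on ({a - r..a + r} \<times> U) f"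
  shows "continuous_on ({a - r..a + r} \<times> U) (\<lambda>p. seg_integral a (fst p) (\<lambda>s. f (s, snd p)))"
proof -
  have "continuous_on (U \<times> {a - r..a + r}) (\<lambda>(u, t). f (t, u))"
    unfolding case_prod_beta
    by (rule continuous_on_compose2[OF assms]) (auto intro!: continuous_intros)
  note cont = continuous_on_seg_integral[OF this]
  have "continuous_on ({a - r..a + r} \<times> U)
      (\<lambda>p. case (snd p, fst p) of (u, y) \<Rightarrow> seg_integral a y (\<lambda>t. f (t, u)))"
    by (rule continuous_on_compose2[OF cont]) (auto intro!: continuous_intros)
  then show ?thesis by simp
qed

lemma continuous_on_seg_integral_snd:
  assumes "continuous_on (U \<times> {a - r..a + r}) f"
  shows "continuous_on (U \<times> {a - r..a + r}) (\<lambda>p. seg_integral a (snd p) (\<lambda>s. f (fst p, s)))"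
  using continuous_on_seg_integral[of U a r "\<lambda>u t. f (u, t)"] assms by (simp add: case_prod_beta)

text \<open>Picard iteration along the broken line \<open>(a, b)\<close>, \<open>(y, b)\<close>, \<open>(y, z)\<close>.\<close>

lemma broken_line_fixed_point:
  fixes A B :: "real \<times> real \<Rightarrow> 'e::banach \<Rightarrow>\<^sub>L 'e" and c :: 'e
  defines "Iy \<equiv> \<lambda>a r. {a - r..a + r :: real}"
  assumes "continuous_on (Iy a r \<times> Iy b r) A" "continuous_on (Iy a r \<times> Iy b r) B"
    and bound: "\<And>p. p \<in> Iy a r \<times> Iy b r \<Longrightarrow> norm (A p) \<le> K \<and> norm (B p) \<le> K"
    and "0 < r" "2 * (r * K) < 1" "0 \<le> K"
  obtains \<theta> where "continuous_on (Iy a r \<times> Iy b r) \<theta>"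
    "\<And>y z. y \<in> Iy a r \<Longrightarrow> z \<in> Iy b r \<Longrightarrow> \<theta> (y, z) = c + seg_integral a y (\<lambda>s. A (s, b) (\<theta> (s, b))) +
        seg_integral b z (\<lambda>s. B (y, s) (\<theta> (y, s)))"
proof -
  let ?Q = "Iy a r \<times> Iy b r"
  have Q: "cbox (a - r, b - r) (a + r, b + r) = ?Q"
    by (auto simp: Iy_def cbox_Pair_eq)
  define T where "T = (\<lambda>\<theta>::real \<times> real \<Rightarrow> 'e. \<lambda>(y, z). c + seg_integral a y (\<lambda>s. A (s, b) (\<theta> (s, b))) +
        seg_integral b z (\<lambda>s. B (y, s) (\<theta> (y, s))))"
  have b: "b \<in> Iy b r" using \<open>0 < r\<close> by (auto simp: Iy_def)
  have cA: "continuous_on ?Q (\<lambda>p. A p (\<theta> p))" and cB: "continuous_on ?Q (\<lambda>p. B p (\<theta> p))"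
    if "continuous_on ?Q \<theta>" for \<theta>
    using that assms by (auto intro!: continuous_intros)
  have cA': "continuous_on (Iy a r) (\<lambda>s. A (s, b) (\<theta> (s, b)))" if "continuous_on ?Q \<theta>" for \<theta>
    using continuous_on_slices(1)[OF cA[OF that] b] .
  have cT: "continuous_on ?Q (T \<theta>)" if "continuous_on ?Q \<theta>" for \<theta>
  proof -
    have "continuous_on (Iy a r \<times> Iy b r) (\<lambda>p. seg_integral a (fst p) (\<lambda>s. A (s, b) (\<theta> (s, b))))"
      using continuous_on_seg_integral_fst[of a r "Iy b r" "\<lambda>p. A (fst p, b) (\<theta> (fst p, b))"]
        continuous_on_compose2[OF cA'[OF that] continuous_on_fst[OF continuous_on_id], of ?Q]
      by (auto simp: Iy_def)
    moreover have "continuous_on (Iy a r \<times> Iy b r) (\<lambda>p. seg_integral b (snd p) (\<lambda>s. B (fst p, s) (\<theta> (fst p, s))))"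
      using continuous_on_seg_integral_snd[OF cB[OF that, unfolded Iy_def]] by (simp add: Iy_def)
    ultimately show ?thesis unfolding T_def case_prod_beta by (intro continuous_intros)
  qed
  \<comment> \<open>The image of \<open>T\<close> is continuous only on the rectangle. Composing
    with \<open>clamp\<close> extends it to a bounded continuous function on the whole plane, which
    places the iteration in a complete space.\<close>
  have ex: "\<exists>g::(real \<times> real) \<Rightarrow>\<^sub>C 'e. \<forall>x. g x = T (apply_bcontfun \<theta>) (clamp (a - r, b - r) (a + r, b + r) x)"
    for \<theta> :: "(real \<times> real) \<Rightarrow>\<^sub>C 'e"
    using continuous_on_cbox_bcontfunE[OF cT[of \<theta>, folded Q]] by (metis continuous_on_apply_bcontfun)
  then obtain H :: "((real \<times> real) \<Rightarrow>\<^sub>C 'e) \<Rightarrow> ((real \<times> real) \<Rightarrow>\<^sub>C 'e)"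
    where H: "\<And>\<theta> x. H \<theta> x = T \<theta> (clamp (a - r, b - r) (a + r, b + r) x)" by metis
  have clampQ: "clamp (a - r, b - r) (a + r, b + r) x \<in> ?Q" for x
    unfolding Q[symmetric] using \<open>0 < r\<close> by (intro clamp_in_interval) (auto simp: Basis_prod_def)
  \<comment> \<open>Each of the two legs has length at most \<open>r\<close> and carries
    coefficients of norm at most \<open>K\<close>, whence the contraction factor
    \<open>2 * (r * K)\<close>.\<close>
  have lip: "dist (H \<theta>) (H \<eta>) \<le> 2 * (r * K) * dist \<theta> \<eta>" for \<theta> \<eta>
  proof (rule dist_bound)
    fix x
    obtain y z where yz: "clamp (a - r, b - r) (a + r, b + r) x = (y, z)" "y \<in> Iy a r" "z \<in> Iy b r"
      using clampQ[of x] by (metis SigmaE)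
    have K: "norm (A p (\<theta> p) - A p (\<eta> p)) \<le> K * dist \<theta> \<eta>" "norm (B p (\<theta> p) - B p (\<eta> p)) \<le> K * dist \<theta> \<eta>"
      if "p \<in> ?Q" for p
    proof -
      have "norm (A p (\<theta> p - \<eta> p)) \<le> norm (A p) * norm (\<theta> p - \<eta> p)" "norm (B p (\<theta> p - \<eta> p)) \<le> norm (B p) * norm (\<theta> p - \<eta> p)"
        by (rule norm_blinfun)+
      moreover have "norm (A p) * norm (\<theta> p - \<eta> p) \<le> K * dist \<theta> \<eta>" "norm (B p) * norm (\<theta> p - \<eta> p) \<le> K * dist \<theta> \<eta>"
        using bound[OF that] dist_bounded[of \<theta> p \<eta>] \<open>0 \<le> K\<close> by (auto intro!: mult_mono simp: dist_norm)
      ultimately show "norm (A p (\<theta> p) - A p (\<eta> p)) \<le> K * dist \<theta> \<eta>" "norm (B p (\<theta> p) - B p (\<eta> p)) \<le> K * dist \<theta> \<eta>"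
        by (auto simp: blinfun.diff_right)
    qed
    have cont: "continuous_on (Iy a r) (\<lambda>s. A (s, b) (\<theta> (s, b)))" "continuous_on (Iy a r) (\<lambda>s. A (s, b) (\<eta> (s, b)))"
      "continuous_on (Iy b r) (\<lambda>s. B (y, s) (\<theta> (y, s)))" "continuous_on (Iy b r) (\<lambda>s. B (y, s) (\<eta> (y, s)))"
      using cA' continuous_on_slices(2)[OF cB yz(2)] by auto
    have "norm (seg_integral a y (\<lambda>s. A (s, b) (\<theta> (s, b))) - seg_integral a y (\<lambda>s. A (s, b) (\<eta> (s, b)))) \<le> r * (K * dist \<theta> \<eta>)"
      using cont(1,2) yz b K(1) unfolding Iy_def
      by (subst seg_integral_diff[symmetric]) (auto intro!: norm_seg_integral_le continuous_intros)
    moreover have "norm (seg_integral b z (\<lambda>s. B (y, s) (\<theta> (y, s))) - seg_integral b z (\<lambda>s. B (y, s) (\<eta> (y, s)))) \<le> r * (K * dist \<theta> \<eta>)"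
      using cont(3,4) yz b K(2) unfolding Iy_def
      by (subst seg_integral_diff[symmetric]) (auto intro!: norm_seg_integral_le continuous_intros)
    ultimately have "norm ((seg_integral a y (\<lambda>s. A (s, b) (\<theta> (s, b))) - seg_integral a y (\<lambda>s. A (s, b) (\<eta> (s, b)))) +
       (seg_integral b z (\<lambda>s. B (y, s) (\<theta> (y, s))) - seg_integral b z (\<lambda>s. B (y, s) (\<eta> (y, s))))) \<le> 2 * (r * K) * dist \<theta> \<eta>"
      by (intro norm_triangle_le) simp
    then show "dist (H \<theta> x) (H \<eta> x) \<le> 2 * (r * K) * dist \<theta> \<eta>"
      unfolding H yz T_def by (simp add: dist_norm algebra_simps)
  qed
  have "\<exists>!\<theta>. H \<theta> = \<theta>"
    by (rule banach_fix_type[of "2 * (r * K)"]) (use lip assms in auto)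
  then obtain \<theta> where \<theta>: "H \<theta> = \<theta>" by blast
  show ?thesis
  proof (rule that[of \<theta>])
    fix y z assume "y \<in> Iy a r" "z \<in> Iy b r"
    then have "clamp (a - r, b - r) (a + r, b + r) (y, z) = (y, z)"
      using Q by (intro clamp_cancel_cbox) auto
    then show "\<theta> (y, z) = c + seg_integral a y (\<lambda>s. A (s, b) (\<theta> (s, b))) + seg_integral b z (\<lambda>s. B (y, s) (\<theta> (y, s)))"
      using H[of \<theta> "(y, z)"] unfolding \<theta> by (simp add: T_def)
  qed simp
qed


text \<open>Gronwall-type uniqueness: \<open>\<theta>\<close> and the transport of \<open>\<theta>(a, \<cdot>)\<close> in the \<open>y\<close>-direction differ by
  a solution of a homogeneous integro-differential equation, which vanishes on a small rectangle.\<close>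

lemma total_linear_system:
  fixes A B Az By :: "real \<times> real \<Rightarrow> 'e::banach \<Rightarrow>\<^sub>L 'e" and c :: 'e
  defines "I \<equiv> \<lambda>a r. {a - r..a + r :: real}"
  assumes cont: "continuous_on (I a r \<times> I b r) A" "continuous_on (I a r \<times> I b r) B"
      "continuous_on (I a r \<times> I b r) Az" "continuous_on (I a r \<times> I b r) By"
    and Az: "\<And>y z. y \<in> I a r \<Longrightarrow> z \<in> I b r \<Longrightarrow>
      ((\<lambda>z. A (y, z)) has_vector_derivative Az (y, z)) (at z within I b r)"
    and By: "\<And>y z. y \<in> I a r \<Longrightarrow> z \<in> I b r \<Longrightarrow>
      ((\<lambda>y. B (y, z)) has_vector_derivative By (y, z)) (at y within I a r)"
    and compat: "\<And>p x. p \<in> I a r \<times> I b r \<Longrightarrow> Az p x + A p (B p x) = By p x + B p (A p x)"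
    and K: "\<And>p. p \<in> I a r \<times> I b r \<Longrightarrow> norm (A p) \<le> K \<and> norm (B p) \<le> K \<and> norm (By p) \<le> K"
    and r: "0 < r" "r \<le> 1" "2 * (r * K) < 1" and "0 \<le> K"
  obtains \<theta> where "continuous_on (I a r \<times> I b r) \<theta>" "\<theta> (a, b) = c"
    "\<And>y z. y \<in> I a r \<Longrightarrow> z \<in> I b r \<Longrightarrow>
      ((\<lambda>y. \<theta> (y, z)) has_vector_derivative A (y, z) (\<theta> (y, z))) (at y within I a r)"
    "\<And>y z. y \<in> I a r \<Longrightarrow> z \<in> I b r \<Longrightarrow>
      ((\<lambda>z. \<theta> (y, z)) has_vector_derivative B (y, z) (\<theta> (y, z))) (at z within I b r)"
proof -
  let ?Q = "I a r \<times> I b r"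
  have ab: "a \<in> I a r" "b \<in> I b r" using r by (auto simp: I_def)
  obtain \<theta> where c\<theta>: "continuous_on ?Q \<theta>" and
    \<theta>: "\<And>y z. y \<in> I a r \<Longrightarrow> z \<in> I b r \<Longrightarrow> \<theta> (y, z) = c + seg_integral a y (\<lambda>s. A (s, b) (\<theta> (s, b))) +
        seg_integral b z (\<lambda>s. B (y, s) (\<theta> (y, s)))"
    using broken_line_fixed_point[OF cont(1,2)[unfolded I_def], of K c] K r \<open>0 \<le> K\<close>
    by (auto simp: I_def)
  note [continuous_intros] = cont c\<theta>
  have ivl [simp]: "{x - r..x + r} = I x r" for x r by (simp add: I_def)
  \<comment> \<open>The last leg of the broken line runs in the \<open>z\<close>-direction, so the
    \<open>z\<close>-equation is immediate on the whole rectangle. The fixed point equation gives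
    the \<open>y\<close>-equation only on \<open>z = b\<close>; the rest of the proof extends
    it.\<close>
  have \<theta>z: "((\<lambda>z. \<theta> (y, z)) has_vector_derivative B (y, z) (\<theta> (y, z))) (at z within I b r)"
    if yz: "y \<in> I a r" "z \<in> I b r" for y z
  proof -
    have "continuous_on (I b r) (\<lambda>s. B (y, s) (\<theta> (y, s)))"
      by (rule continuous_on_slices(2)[OF _ yz(1)]) (intro continuous_intros)
    then have "((\<lambda>z. c + seg_integral a y (\<lambda>s. A (s, b) (\<theta> (s, b))) +
        seg_integral b z (\<lambda>s. B (y, s) (\<theta> (y, s)))) has_vector_derivative 0 + B (y, z) (\<theta> (y, z))) (at z within I b r)"
      using seg_integral_has_vector_derivative[of b r "\<lambda>s. B (y, s) (\<theta> (y, s))" z] yz(2) unfolding I_def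
      by (intro has_vector_derivative_add has_vector_derivative_const) auto
    note der = this[unfolded add_0]
    show ?thesis
      by (rule has_vector_derivative_transform[OF yz(2) _ der]) (rule \<theta>[OF yz(1)])
  qed
  \<comment> \<open>This uses the other broken line, first along \<open>y = a\<close> and then in
    the \<open>y\<close>-direction. By construction its \<open>y\<close>-derivative is
    \<open>A \<theta>\<close>, so it remains to prove that \<open>\<theta>\<close> and
    \<open>\<eta>\<close> agree.\<close>
  define \<eta> where "\<eta> = (\<lambda>p. \<theta> (a, snd p) + seg_integral a (fst p) (\<lambda>s. A (s, snd p) (\<theta> (s, snd p))))"
  define D where "D = (\<lambda>p. \<theta> p - \<eta> p)"
  have c\<eta> [continuous_intros]: "continuous_on ?Q \<eta>"
    unfolding \<eta>_def
  proof (intro continuous_intros)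
    show "continuous_on ?Q (\<lambda>p. \<theta> (a, snd p))"
      by (rule continuous_on_compose2[OF c\<theta>]) (use ab in \<open>auto intro!: continuous_intros\<close>)
    have "continuous_on ?Q (\<lambda>p. A p (\<theta> p))" by (intro continuous_intros)
    from continuous_on_seg_integral_fst[OF this[unfolded I_def]]
    show "continuous_on ?Q (\<lambda>p. seg_integral a (fst p) (\<lambda>s. A (s, snd p) (\<theta> (s, snd p))))" by simp
  qed
  have cD: "continuous_on ?Q D" unfolding D_def by (intro continuous_intros)
  have \<eta>y: "((\<lambda>y. \<eta> (y, z)) has_vector_derivative A (y, z) (\<theta> (y, z))) (at y within I a r)"
    if yz: "y \<in> I a r" "z \<in> I b r" for y z
  proof -
    have "continuous_on (I a r) (\<lambda>s. A (s, z) (\<theta> (s, z)))"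
      by (rule continuous_on_slices(1)[OF _ yz(2)]) (intro continuous_intros)
    then have "((\<lambda>y. \<theta> (a, z) + seg_integral a y (\<lambda>s. A (s, z) (\<theta> (s, z)))) has_vector_derivative
        0 + A (y, z) (\<theta> (y, z))) (at y within I a r)"
      using seg_integral_has_vector_derivative[of a r "\<lambda>s. A (s, z) (\<theta> (s, z))" y] yz(1) unfolding I_def
      by (intro has_vector_derivative_add has_vector_derivative_const) auto
    then show ?thesis by (simp add: \<eta>_def)
  qed
  \<comment> \<open>Differentiating \<open>\<eta>\<close> in \<open>z\<close> under the integral
    gives the integrand \<open>Az \<theta> + A B \<theta>\<close>, which compatibility turns into
    \<open>By \<theta> + B A \<theta>\<close>. With \<open>By \<eta>\<close> in place of
    \<open>By \<theta>\<close> this is the \<open>y\<close>-derivative of \<open>B \<eta>\<close>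
    and integrates to boundary terms; what is left over involves \<open>D\<close> alone.\<close>
  have Dz: "((\<lambda>z. D (y, z)) has_vector_derivative
      B (y, z) (D (y, z)) - seg_integral a y (\<lambda>s. By (s, z) (D (s, z)))) (at z within I b r)"
    if yz: "y \<in> I a r" "z \<in> I b r" for y z
  proof -
    define g where "g = (\<lambda>p. Az p (\<theta> p) + A p (B p (\<theta> p)))"
    have g: "g p = By p (\<theta> p) + B p (A p (\<theta> p))" if "p \<in> ?Q" for p
      using compat[OF that] by (simp add: g_def)
    have cg: "continuous_on ?Q g" unfolding g_def by (intro continuous_intros)
    have seg: "a + \<tau> * (y - a) \<in> I a r" if "\<tau> \<in> {0..1}" for \<tau>
      using seg_point_mem[of y a r \<tau>] yz(1) that unfolding I_def by blast
    have "((\<lambda>z. integral (cbox 0 1) (\<lambda>\<tau>. A (a + \<tau> * (y - a), z) (\<theta> (a + \<tau> * (y - a), z)))) has_vector_derivative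
        integral (cbox 0 1) (\<lambda>\<tau>. g (a + \<tau> * (y - a), z))) (at z within I b r)"
    proof (rule leibniz_rule_vector_derivative)
      fix z' \<tau> :: real assume *: "z' \<in> I b r" "\<tau> \<in> cbox 0 1"
      show "((\<lambda>z. A (a + \<tau> * (y - a), z) (\<theta> (a + \<tau> * (y - a), z))) has_vector_derivative g (a + \<tau> * (y - a), z'))
          (at z' within I b r)"
        using bounded_bilinear.has_vector_derivative[OF bounded_bilinear_blinfun_apply
            Az[OF seg *(1)] \<theta>z[OF seg *(1)], of \<tau> \<tau>] *(2)
        by (simp add: g_def add.commute)
    next
      fix z' assume *: "z' \<in> I b r"
      have "continuous_on (I a r) (\<lambda>s. A (s, z') (\<theta> (s, z')))"
        by (rule continuous_on_slices(1)[OF _ *]) (intro continuous_intros)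
      from seg_integrand_continuous[OF this[unfolded I_def] yz(1)[unfolded I_def]]
      show "(\<lambda>\<tau>. A (a + \<tau> * (y - a), z') (\<theta> (a + \<tau> * (y - a), z'))) integrable_on cbox 0 1"
        by (simp add: integrable_continuous_interval)
    next
      show "continuous_on (I b r \<times> cbox 0 1) (\<lambda>(z, \<tau>). g (a + \<tau> * (y - a), z))"
        unfolding case_prod_beta
        by (rule continuous_on_compose2[OF cg]) (use seg in \<open>auto intro!: continuous_intros\<close>)
    qed (use yz in \<open>auto simp: I_def simp del: ivl\<close>)
    then have "((\<lambda>z. (y - a) *\<^sub>R integral {0..1} (\<lambda>\<tau>. A (a + \<tau> * (y - a), z) (\<theta> (a + \<tau> * (y - a), z)))) has_vector_derivative
        (y - a) *\<^sub>R integral {0..1} (\<lambda>\<tau>. g (a + \<tau> * (y - a), z))) (at z within I b r)"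
      by (intro bounded_linear.has_vector_derivative[OF bounded_linear_scaleR_right]) simp
    then have \<eta>z: "((\<lambda>z. \<eta> (y, z)) has_vector_derivative
        B (a, z) (\<theta> (a, z)) + seg_integral a y (\<lambda>s. g (s, z))) (at z within I b r)"
      unfolding \<eta>_def seg_integral_def by (intro has_vector_derivative_add) (simp_all add: \<theta>z ab yz)
    have "((\<lambda>y. B (y, z) (\<eta> (y, z))) has_vector_derivative By (s, z) (\<eta> (s, z)) + B (s, z) (A (s, z) (\<theta> (s, z)))) (at s within I a r)"
      if "s \<in> I a r" for s
      using bounded_bilinear.has_vector_derivative[OF bounded_bilinear_blinfun_apply
            By[OF that yz(2)] \<eta>y[OF that yz(2)]] by (simp add: add.commute)
    from seg_integral_ftc[OF this[unfolded I_def] yz(1)[unfolded I_def]]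
    have ftc: "seg_integral a y (\<lambda>s. By (s, z) (\<eta> (s, z)) + B (s, z) (A (s, z) (\<theta> (s, z)))) =
      B (y, z) (\<eta> (y, z)) - B (a, z) (\<theta> (a, z))"
      by (simp add: \<eta>_def)
    have "seg_integral a y (\<lambda>s. g (s, z)) - seg_integral a y (\<lambda>s. By (s, z) (\<eta> (s, z)) + B (s, z) (A (s, z) (\<theta> (s, z))))
      = seg_integral a y (\<lambda>s. g (s, z) - (By (s, z) (\<eta> (s, z)) + B (s, z) (A (s, z) (\<theta> (s, z)))))"
    proof (rule seg_integral_diff[symmetric])
      show "continuous_on {a - r..a + r} (\<lambda>s. g (s, z))"
        using continuous_on_slices(1)[OF cg yz(2)] by simp
      have "continuous_on ?Q (\<lambda>p. By p (\<eta> p) + B p (A p (\<theta> p)))" by (intro continuous_intros)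
      from continuous_on_slices(1)[OF this yz(2)]
      show "continuous_on {a - r..a + r} (\<lambda>s. By (s, z) (\<eta> (s, z)) + B (s, z) (A (s, z) (\<theta> (s, z))))" by simp
    qed (use yz in simp)
    also have "\<dots> = seg_integral a y (\<lambda>s. By (s, z) (D (s, z)))"
      by (rule seg_integral_cong[where r = r])
        (use yz g in \<open>auto simp: D_def blinfun.diff_right\<close>)
    finally have "seg_integral a y (\<lambda>s. g (s, z)) =
        seg_integral a y (\<lambda>s. By (s, z) (D (s, z))) + (B (y, z) (\<eta> (y, z)) - B (a, z) (\<theta> (a, z)))"
      unfolding ftc by (simp add: algebra_simps)
    then have eq: "B (y, z) (\<theta> (y, z)) - (B (a, z) (\<theta> (a, z)) + seg_integral a y (\<lambda>s. g (s, z))) =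
        B (y, z) (D (y, z)) - seg_integral a y (\<lambda>s. By (s, z) (D (s, z)))"
      by (simp add: D_def blinfun.diff_right algebra_simps)
    show ?thesis
      unfolding eq[symmetric] unfolding D_def by (intro has_vector_derivative_diff \<theta>z \<eta>z yz)
  qed
  have Db: "D (y, b) = 0" if "y \<in> I a r" for y
    using \<theta>[OF that ab(2)] \<theta>[OF ab] by (simp add: D_def \<eta>_def)
  have "compact ?Q" "?Q \<noteq> {}" using ab by (auto simp: I_def simp del: ivl intro!: compact_Times)
  then obtain p where p: "p \<in> ?Q" and max: "\<And>q. q \<in> ?Q \<Longrightarrow> norm (D q) \<le> norm (D p)"
    using continuous_attains_sup[OF _ _ continuous_on_norm[OF cD]] by blast
  define m where "m = norm (D p)"
  \<comment> \<open>With \<open>m\<close> the maximum of the norm of \<open>D\<close>, the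
    \<open>z\<close>-derivative of \<open>D\<close> is at most \<open>K * m + r * (K * m)\<close>,
    hence at most \<open>2 * K * m\<close> because \<open>r \<le> 1\<close>. As \<open>D\<close>
    vanishes on \<open>z = b\<close> and the height is at most \<open>r\<close>, the maximum is
    bounded by \<open>2 * (r * K)\<close> times itself, so it is 0.\<close>
  have small: "norm (D (y, z)) \<le> (2 * K * m) * r" if yz: "y \<in> I a r" "z \<in> I b r" for y z
  proof -
    have "norm (D (y, z) - D (y, b)) \<le> (2 * K * m) * norm (z - b)"
    proof (rule differentiable_bound)
      fix z' assume z': "z' \<in> I b r"
      have le: "norm (L x) \<le> K * m" if "norm L \<le> K" "norm x \<le> m" for L :: "'e \<Rightarrow>\<^sub>L 'e" and x
        using norm_blinfun[of L x] mult_mono[OF that] \<open>0 \<le> K\<close> by simp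
      have "norm (seg_integral a y (\<lambda>s. By (s, z') (D (s, z')))) \<le> r * (K * m)"
      proof (rule norm_seg_integral_le)
        have "continuous_on ?Q (\<lambda>p. By p (D p))" by (intro continuous_intros cD)
        from continuous_on_slices(1)[OF this z']
        show "continuous_on {a - r..a + r} (\<lambda>s. By (s, z') (D (s, z')))" by simp
      qed (use yz z' K max le in \<open>auto simp: m_def\<close>)
      also have "\<dots> \<le> 1 * (K * m)" using r \<open>0 \<le> K\<close> by (intro mult_right_mono) (auto simp: m_def)
      finally have "norm (B (y, z') (D (y, z')) - seg_integral a y (\<lambda>s. By (s, z') (D (s, z')))) \<le> 2 * K * m"
        using le[of "B (y, z')" "D (y, z')"] K[of "(y, z')"] max[of "(y, z')"] yz z'
        by (intro norm_triangle_le_diff) (auto simp: m_def)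
      then show "onorm (\<lambda>x. x *\<^sub>R (B (y, z') (D (y, z')) - seg_integral a y (\<lambda>s. By (s, z') (D (s, z'))))) \<le> 2 * K * m"
        by (intro onorm_le) (auto simp: mult.commute intro: mult_left_mono)
      show "((\<lambda>z. D (y, z)) has_derivative (\<lambda>x. x *\<^sub>R (B (y, z') (D (y, z')) -
          seg_integral a y (\<lambda>s. By (s, z') (D (s, z')))))) (at z' within I b r)"
        using Dz[OF yz(1) z'] by (simp add: has_vector_derivative_def)
    qed (use yz ab in \<open>auto simp: I_def simp del: ivl\<close>)
    also have "\<dots> \<le> (2 * K * m) * r"
      using yz \<open>0 \<le> K\<close> by (intro mult_left_mono) (auto simp: I_def m_def abs_le_iff simp del: ivl)
    finally show ?thesis using Db[OF yz(1)] by simp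
  qed
  have "m \<le> (2 * (r * K)) * m" using small[of "fst p" "snd p"] p by (auto simp: m_def ac_simps)
  then have "m = 0"
    using r(3) mult_right_mono[of "2 * (r * K)" 1 m] by (cases "m = 0") (auto simp: m_def)
  then have D0: "D q = 0" if "q \<in> ?Q" for q using max[OF that] by (simp add: m_def)
  show ?thesis
  proof (rule that[of \<theta>])
    show "\<theta> (a, b) = c" using \<theta>[OF ab] by simp
    show "((\<lambda>y. \<theta> (y, z)) has_vector_derivative A (y, z) (\<theta> (y, z))) (at y within I a r)"
      if yz: "y \<in> I a r" "z \<in> I b r" for y z
      by (rule has_vector_derivative_transform[OF yz(1) _ \<eta>y[OF yz]]) (use D0 yz in \<open>auto simp: D_def\<close>)
  qed (use c\<theta> \<theta>z in auto)
qed

section \<open>Affine functions of a flat connection\<close>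

lemma smooth_on_vector_derivative_fst:
  assumes "smooth_on D f" "(y, z) \<in> D"
  shows "((\<lambda>y. f (y, z)) has_vector_derivative dir_deriv (1, 0) f (y, z)) (at y)"
  using smooth_on_line_has_derivative[OF assms(1), of "(0, z)" y "(1, 0)"] assms(2) by simp

lemma smooth_on_vector_derivative_snd:
  assumes "smooth_on D f" "(y, z) \<in> D"
  shows "((\<lambda>z. f (y, z)) has_vector_derivative dir_deriv (0, 1) f (y, z)) (at z)"
  using smooth_on_line_has_derivative[OF assms(1), of "(y, 0)" z "(0, 1)"] assms(2) by simp

lemma dir_deriv_real2:
  fixes f :: "real \<times> real \<Rightarrow> 'b::real_normed_vector"
  assumes "smooth_on S f" "p \<in> S"
  shows "dir_deriv d f p = fst d *\<^sub>R dir_deriv (1, 0) f p + snd d *\<^sub>R dir_deriv (0, 1) f p"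
proof -
  have "d = fst d *\<^sub>R (1, 0) + snd d *\<^sub>R (0, 1)" by (cases d) simp
  then have "dir_deriv d f p = dir_deriv (fst d *\<^sub>R (1, 0) + snd d *\<^sub>R (0, 1)) f p" by simp
  then show ?thesis by (simp only: smooth_on_dir_deriv_lincomb[OF assms])
qed

text \<open>The hypothesis \<open>compat\<close> is the equality of the mixed second derivatives of
  a solution, demanded for every possible value \<open>x\<close> of it. What remains is to shrink to
  a rectangle on which the contraction estimate holds, and to pass from partial derivatives to
  smoothness.\<close>

lemma parallel_section_exists:
  fixes A B :: "real \<times> real \<Rightarrow> 'e::euclidean_space \<Rightarrow>\<^sub>L 'e" and c :: 'e
  assumes "open D" "smooth_on D A" "smooth_on D B" "(a, b) \<in> D"
    and compat: "\<And>p x. p \<in> D \<Longrightarrow> dir_deriv (0, 1) A p x + A p (B p x) = dir_deriv (1, 0) B p x + B p (A p x)"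
  obtains W \<theta> where "open W" "(a, b) \<in> W" "W \<subseteq> D" "smooth_on W \<theta>" "\<theta> (a, b) = c"
    "\<And>p. p \<in> W \<Longrightarrow> dir_deriv (1, 0) \<theta> p = A p (\<theta> p)"
    "\<And>p. p \<in> W \<Longrightarrow> dir_deriv (0, 1) \<theta> p = B p (\<theta> p)"
proof -
  define I where "I = (\<lambda>a r. {a - r..a + r :: real})"
  have ivl: "{x - r..x + r} = I x r" for x r by (simp add: I_def)
  obtain S T where "open S" "open T" "(a, b) \<in> S \<times> T" "S \<times> T \<subseteq> D"
    by (rule open_prod_elim[OF assms(1,4)])
  then have ST: "open S" "open T" "a \<in> S" "b \<in> T" "S \<times> T \<subseteq> D" by auto
  obtain r1 where r1: "r1 > 0" "cball a r1 \<subseteq> S" using ST open_contains_cball by blast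
  obtain r2 where r2: "r2 > 0" "cball b r2 \<subseteq> T" using ST open_contains_cball by blast
  define r0 where "r0 = min r1 r2"
  have r0: "r0 > 0" "I a r0 \<times> I b r0 \<subseteq> D"
  proof -
    have "I a r0 \<subseteq> cball a r1" "I b r0 \<subseteq> cball b r2" by (auto simp: I_def r0_def cball_eq_atLeastAtMost)
    then show "I a r0 \<times> I b r0 \<subseteq> D" using ST(5) r1(2) r2(2) by fast
  qed (use r1 r2 in \<open>simp add: r0_def\<close>)
  have cont: "continuous_on (I a r0 \<times> I b r0) A" "continuous_on (I a r0 \<times> I b r0) B"
    "continuous_on (I a r0 \<times> I b r0) (dir_deriv (0, 1) A)" "continuous_on (I a r0 \<times> I b r0) (dir_deriv (1, 0) B)"
    by (rule continuous_on_subset[OF smooth_on_continuous_on r0(2)], intro smooth_on_dir_deriv assms)+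
  have "compact (I a r0 \<times> I b r0)" unfolding I_def by (intro compact_Times) auto
  then have "bounded (A ` (I a r0 \<times> I b r0))" "bounded (B ` (I a r0 \<times> I b r0))"
    "bounded (dir_deriv (1, 0) B ` (I a r0 \<times> I b r0))"
    using cont by (auto intro!: compact_imp_bounded compact_continuous_image)
  then obtain K1 K2 K3 where K: "\<And>p. p \<in> I a r0 \<times> I b r0 \<Longrightarrow> norm (A p) \<le> K1"
    "\<And>p. p \<in> I a r0 \<times> I b r0 \<Longrightarrow> norm (B p) \<le> K2"
    "\<And>p. p \<in> I a r0 \<times> I b r0 \<Longrightarrow> norm (dir_deriv (1, 0) B p) \<le> K3"
    unfolding bounded_iff by (metis imageI)
  define K where "K = max 1 (max K1 (max K2 K3))"
  \<comment> \<open>The bound \<open>1 / (4 * K)\<close> gives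
    \<open>2 * (r * K) \<le> 1 / 2\<close>; taking \<open>K\<close> at least 1 keeps the quotient
    positive.\<close>
  define r where "r = min r0 (min 1 (1 / (4 * K)))"
  have "K \<ge> 1" by (simp add: K_def)
  have r: "0 < r" "r \<le> 1" "r \<le> r0" "r \<le> 1 / (4 * K)" 
    unfolding r_def using r0(1) \<open>K \<ge> 1\<close> by (simp, linarith+)
  have "2 * (r * K) < 1"
  proof -
    have "r * K \<le> 1 / (4 * K) * K" using r(4) \<open>K \<ge> 1\<close> by (intro mult_right_mono) auto
    then show ?thesis using \<open>K \<ge> 1\<close> by (simp add: field_simps)
  qed
  have sub: "I a r \<times> I b r \<subseteq> I a r0 \<times> I b r0" using r(3) by (auto simp: I_def)
  have derA: "((\<lambda>z. A (y, z)) has_vector_derivative dir_deriv (0, 1) A (y, z)) (at z within I b r)"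
    and derB: "((\<lambda>y. B (y, z)) has_vector_derivative dir_deriv (1, 0) B (y, z)) (at y within I a r)"
    if "y \<in> I a r" "z \<in> I b r" for y z
  proof -
    have "(y, z) \<in> D" using that sub r0 by blast
    then show "((\<lambda>z. A (y, z)) has_vector_derivative dir_deriv (0, 1) A (y, z)) (at z within I b r)"
      "((\<lambda>y. B (y, z)) has_vector_derivative dir_deriv (1, 0) B (y, z)) (at y within I a r)"
      by (auto intro: has_vector_derivative_at_within smooth_on_vector_derivative_fst[OF assms(3)]
          smooth_on_vector_derivative_snd[OF assms(2)])
  qed
  obtain \<theta> where c\<theta>: "continuous_on (I a r \<times> I b r) \<theta>" and "\<theta> (a, b) = c" and
    \<theta>y: "\<And>y z. y \<in> I a r \<Longrightarrow> z \<in> I b r \<Longrightarrow>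
      ((\<lambda>y. \<theta> (y, z)) has_vector_derivative A (y, z) (\<theta> (y, z))) (at y within I a r)" and
    \<theta>z: "\<And>y z. y \<in> I a r \<Longrightarrow> z \<in> I b r \<Longrightarrow>
      ((\<lambda>z. \<theta> (y, z)) has_vector_derivative B (y, z) (\<theta> (y, z))) (at z within I b r)"
  proof (rule total_linear_system[of a r b A B "dir_deriv (0, 1) A" "dir_deriv (1, 0) B" K c, unfolded ivl])
    show "norm (A p) \<le> K \<and> norm (B p) \<le> K \<and> norm (dir_deriv (1, 0) B p) \<le> K" if "p \<in> I a r \<times> I b r" for p
      using K[of p] that sub unfolding K_def by (auto simp: le_max_iff_disj)
    show "dir_deriv (0, 1) A p x + A p (B p x) = dir_deriv (1, 0) B p x + B p (A p x)" if "p \<in> I a r \<times> I b r" for p x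
      using that sub r0 by (intro compat) blast
  qed (use cont derA derB r \<open>2 * (r * K) < 1\<close> \<open>K \<ge> 1\<close> continuous_on_subset[OF _ sub] in auto)
  define W where "W = {a - r<..<a + r} \<times> {b - r<..<b + r}"
  have W: "open W" "(a, b) \<in> W" "W \<subseteq> I a r \<times> I b r"
    using r by (auto simp: W_def I_def intro!: open_Times)
  then have "W \<subseteq> D" using sub r0(2) by blast
  have der: "(\<theta> has_derivative (\<lambda>d. fst d *\<^sub>R A p (\<theta> p) + snd d *\<^sub>R B p (\<theta> p))) (at p)" if "p \<in> W" for p
  proof -
    obtain y z where p: "p = (y, z)" "y \<in> I a r" "z \<in> I b r" using \<open>p \<in> W\<close> W(3) by (cases p) blast
    \<comment> \<open>Two partial derivatives combine to a total one if one of them is jointly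
      continuous; here this is the \<open>z\<close>-derivative.\<close>
    have cont: "continuous_on (I a r \<times> I b r) (\<lambda>p. blinfun_scaleR_left (B p (\<theta> p)))"
      by (intro bounded_linear.continuous_on[OF bounded_linear_blinfun_scaleR_left] continuous_intros c\<theta>
          continuous_on_subset[OF \<open>continuous_on (I a r0 \<times> I b r0) B\<close> sub])
    have "((\<lambda>(y, z). \<theta> (y, z)) has_derivative (\<lambda>(s, t). s *\<^sub>R A (y, z) (\<theta> (y, z)) +
        blinfun_scaleR_left (B (y, z) (\<theta> (y, z))) t)) (at (y, z) within I a r \<times> I b r)"
    proof (rule has_derivative_partialsI)
      show "((\<lambda>y. \<theta> (y, z)) has_derivative (\<lambda>s. s *\<^sub>R A (y, z) (\<theta> (y, z)))) (at y within I a r)"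
        using \<theta>y[OF p(2,3)] by (simp add: has_vector_derivative_def)
      show "((\<lambda>z. \<theta> (x, z)) has_derivative (blinfun_scaleR_left (B (x, z) (\<theta> (x, z))))) (at z within I b r)"
        if "x \<in> I a r" "z \<in> I b r" for x z
        using \<theta>z[OF that] by (simp add: has_vector_derivative_def)
      show "continuous (at (y, z) within I a r \<times> I b r) (\<lambda>(y, z). blinfun_scaleR_left (B (y, z) (\<theta> (y, z))))"
        unfolding case_prod_beta prod.collapse
        using cont p by (auto simp: continuous_on_eq_continuous_within)
    qed (use p in \<open>auto simp: I_def\<close>)
    then have "(\<theta> has_derivative (\<lambda>d. fst d *\<^sub>R A p (\<theta> p) + snd d *\<^sub>R B p (\<theta> p))) (at p within I a r \<times> I b r)"
      by (simp add: p case_prod_beta')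
    then have "(\<theta> has_derivative (\<lambda>d. fst d *\<^sub>R A p (\<theta> p) + snd d *\<^sub>R B p (\<theta> p))) (at p within W)"
      by (rule has_derivative_subset[OF _ W(3)])
    then show ?thesis using at_within_open[OF \<open>p \<in> W\<close> W(1)] by simp
  qed
  show ?thesis
  proof (rule that[of W \<theta>])
    have "C_on n W \<theta>" for n
    proof (rule C_on_bootstrap[OF W(1) der])
      fix m d assume "C_on m W \<theta>"
      moreover have "C_on m W A" "C_on m W B"
        using assms(2,3) C_on_subset[OF _ \<open>W \<subseteq> D\<close>] by (auto simp: smooth_on_def)
      ultimately show "C_on m W (\<lambda>p. fst d *\<^sub>R A p (\<theta> p) + snd d *\<^sub>R B p (\<theta> p))"
        using W(1) by (auto intro!: C_on_add C_on_bounded_linear[OF _ bounded_linear_scaleR_right]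
            C_on_bilinear[OF _ bounded_bilinear_blinfun_apply])
    qed
    then show "smooth_on W \<theta>" by (simp add: smooth_on_def)
  qed (use W \<open>W \<subseteq> D\<close> \<open>\<theta> (a, b) = c\<close> in \<open>simp_all add: dir_deriv_eq[OF der]\<close>)
qed

lemma dir_deriv_Pair:
  assumes "smooth_on S f" "smooth_on S g" "x \<in> S"
  shows "dir_deriv d (\<lambda>x. (f x, g x)) x = (dir_deriv d f x, dir_deriv d g x)"
  using has_derivative_Pair[OF smooth_on_has_derivative[OF assms(1,3)] smooth_on_has_derivative[OF assms(2,3)]]
  by (simp add: dir_deriv_eq)

lemma dir_deriv_bounded_linear:
  assumes "bounded_linear h" "smooth_on S f" "x \<in> S"
  shows "dir_deriv d (\<lambda>x. h (f x)) x = h (dir_deriv d f x)"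
  using bounded_linear.has_derivative[OF assms(1) smooth_on_has_derivative[OF assms(2,3)]]
  by (simp add: dir_deriv_eq)

lemma dir_deriv_add:
  assumes "smooth_on S f" "smooth_on S g" "x \<in> S"
  shows "dir_deriv d (\<lambda>x. f x + g x) x = dir_deriv d f x + dir_deriv d g x"
  using has_derivative_add[OF smooth_on_has_derivative[OF assms(1,3)] smooth_on_has_derivative[OF assms(2,3)]]
  by (simp add: dir_deriv_eq)

lemma dir_deriv_const: "dir_deriv d (\<lambda>x. c) x = 0"
  by (simp add: dir_deriv_eq[OF has_derivative_const])

section \<open>Plane connections, their curvature and their affine functions\<close>

locale plane_connection =
  fixes D :: "(real \<times> real) set" and b222 b223 b233 b322 b323 b333 :: "real \<times> real \<Rightarrow> real"
  assumes open_D: "open D"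
    and smooth_coeffs [smooth_intros]: "smooth_on D b222" "smooth_on D b223" "smooth_on D b233"
      "smooth_on D b322" "smooth_on D b323" "smooth_on D b333"
begin

text \<open>With Christoffel symbols \<open>bijk\<close>, these are the entries
  \<open>(i, j)\<close> of the curvature endomorphism of the pair of coordinate fields
  \<open>y\<close>, \<open>z\<close>, in the order \<open>(3, 2)\<close>, \<open>(2, 3)\<close>,
  \<open>(2, 2)\<close>, \<open>(3, 3)\<close>; in the diagonal entries two of the four products
  have cancelled.\<close>

definition flat_at :: "real \<times> real \<Rightarrow> bool" where
  "flat_at p \<longleftrightarrow>
    dir_deriv (1, 0) b323 p - dir_deriv (0, 1) b322 p + b322 p * b223 p + b323 p * b323 p
      - b323 p * b222 p - b333 p * b322 p = 0 \<and>
    dir_deriv (1, 0) b233 p - dir_deriv (0, 1) b223 p + b222 p * b233 p + b223 p * b333 p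
      - b223 p * b223 p - b233 p * b323 p = 0 \<and>
    dir_deriv (1, 0) b223 p - dir_deriv (0, 1) b222 p + b223 p * b323 p - b233 p * b322 p = 0 \<and>
    dir_deriv (1, 0) b333 p - dir_deriv (0, 1) b323 p + b322 p * b233 p - b323 p * b223 p = 0"

text \<open>The three equations say that the covariant Hessian of \<open>v\<close> vanishes, so that
  \<open>v\<close> is an affine function of the parameter along every geodesic.\<close>

definition affine_function_on :: "(real \<times> real) set \<Rightarrow> (real \<times> real \<Rightarrow> real) \<Rightarrow> bool" where
  "affine_function_on W v \<longleftrightarrow> smooth_on W v \<and> (\<forall>p\<in>W.
    dir_deriv (1, 0) (dir_deriv (1, 0) v) p
      = b222 p * dir_deriv (1, 0) v p + b322 p * dir_deriv (0, 1) v p \<and>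
    dir_deriv (0, 1) (dir_deriv (1, 0) v) p
      = b223 p * dir_deriv (1, 0) v p + b323 p * dir_deriv (0, 1) v p \<and>
    dir_deriv (0, 1) (dir_deriv (0, 1) v) p
      = b233 p * dir_deriv (1, 0) v p + b333 p * dir_deriv (0, 1) v p)"

text \<open>The affine functions \<open>v\<close> of a flat connection solve a closed linear system for
  \<open>(v, v\<^sub>y, v\<^sub>z)\<close>, whose integrability condition is flatness.\<close>

lemma affine_function_exists:
  assumes flat: "\<And>p. p \<in> D \<Longrightarrow> flat_at p" and "(a, b) \<in> D"
  obtains W v where "open W" "(a, b) \<in> W" "W \<subseteq> D" "affine_function_on W v"
    "dir_deriv (1, 0) v (a, b) = c" "dir_deriv (0, 1) v (a, b) = c'"
proof -
  \<comment> \<open>A rank one operator with covector \<open>\<alpha>\<close> and column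
    \<open>u\<close>. Since it is linear in \<open>u\<close>, smoothness and derivatives of the
    operators \<open>A\<close> and \<open>B\<close> reduce to those of their columns. The covectors
    \<open>\<alpha>\<close> and \<open>\<beta>\<close> select \<open>v_y\<close> and
    \<open>v_z\<close>; there is no column for \<open>v\<close>, which does not enter the right-hand
    sides.\<close>
  define col :: "((real \<times> real \<times> real) \<Rightarrow>\<^sub>L real) \<Rightarrow> real \<times> real \<times> real \<Rightarrow> (real \<times> real \<times> real) \<Rightarrow>\<^sub>L (real \<times> real \<times> real)"
    where "col = (\<lambda>\<alpha> u. blinfun_scaleR_left u o\<^sub>L \<alpha>)"
  have col_apply [simp]: "col \<alpha> u x = \<alpha> x *\<^sub>R u" for \<alpha> u x by (simp add: col_def)
  have bl: "bounded_linear (col \<alpha>)" for \<alpha>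
    unfolding col_def by (rule bounded_linear_compose[OF
        bounded_bilinear.bounded_linear_left[OF bounded_bilinear_blinfun_compose] bounded_linear_blinfun_scaleR_left])
  define \<alpha> :: "(real \<times> real \<times> real) \<Rightarrow>\<^sub>L real" where "\<alpha> = fst_blinfun o\<^sub>L snd_blinfun"
  define \<beta> :: "(real \<times> real \<times> real) \<Rightarrow>\<^sub>L real" where "\<beta> = snd_blinfun o\<^sub>L snd_blinfun"
  have [simp]: "\<alpha> x = fst (snd x)" "\<beta> x = snd (snd x)" for x
    by (simp_all add: \<alpha>_def \<beta>_def fst_blinfun.rep_eq snd_blinfun.rep_eq)
  define A where "A = (\<lambda>p. col \<alpha> (1 :: real, b222 p, b223 p) + col \<beta> (0 :: real, b322 p, b323 p))"
  define B where "B = (\<lambda>p. col \<alpha> (0 :: real, b223 p, b233 p) + col \<beta> (1 :: real, b323 p, b333 p))"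
  note sm = smooth_on_add smooth_on_bounded_linear[OF _ bl] smooth_on_Pair smooth_on_const open_D smooth_coeffs
  have A: "A p x = (fst (snd x), fst (snd x) * b222 p + snd (snd x) * b322 p, fst (snd x) * b223 p + snd (snd x) * b323 p)"
    and B: "B p x = (snd (snd x), fst (snd x) * b223 p + snd (snd x) * b323 p, fst (snd x) * b233 p + snd (snd x) * b333 p)" for p x
    by (simp_all add: A_def B_def plus_blinfun.rep_eq)
  have dA: "dir_deriv d A p x = (0, fst (snd x) * dir_deriv d b222 p + snd (snd x) * dir_deriv d b322 p,
      fst (snd x) * dir_deriv d b223 p + snd (snd x) * dir_deriv d b323 p)"
    and dB: "dir_deriv d B p x = (0, fst (snd x) * dir_deriv d b223 p + snd (snd x) * dir_deriv d b323 p,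
      fst (snd x) * dir_deriv d b233 p + snd (snd x) * dir_deriv d b333 p)" if "p \<in> D" for d p x
    unfolding A_def B_def
    by ((subst dir_deriv_add[where S = D], (intro sm that)+, (subst dir_deriv_bounded_linear[OF bl, where S = D], (intro sm that)+)+,
        (subst dir_deriv_Pair[where S = D], (intro sm that)+)+, simp add: dir_deriv_const plus_blinfun.rep_eq)+)
  obtain W \<theta> where W: "open W" "(a, b) \<in> W" "W \<subseteq> D" and \<theta>: "smooth_on W \<theta>" "\<theta> (a, b) = (0, c, c')"
    "\<And>p. p \<in> W \<Longrightarrow> dir_deriv (1, 0) \<theta> p = A p (\<theta> p)"
    "\<And>p. p \<in> W \<Longrightarrow> dir_deriv (0, 1) \<theta> p = B p (\<theta> p)"
  proof (rule parallel_section_exists[OF open_D _ _ assms(2), of A B "(0, c, c')"])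
    show "smooth_on D A" "smooth_on D B" unfolding A_def B_def by (intro sm)+
    show "dir_deriv (0, 1) A p x + A p (B p x) = dir_deriv (1, 0) B p x + B p (A p x)" if "p \<in> D" for p x
      using flat[OF that] unfolding flat_at_def dA[OF that] dB[OF that] A B by (simp, algebra)
  qed blast
  define v where "v = (\<lambda>p. fst (\<theta> p))"
  have v: "dir_deriv (1, 0) v p = fst (snd (\<theta> p))" "dir_deriv (0, 1) v p = snd (snd (\<theta> p))" if "p \<in> W" for p
    unfolding v_def using \<theta> that by (auto simp: dir_deriv_bounded_linear[OF bounded_linear_fst \<theta>(1)] A B)
  have sm2: "smooth_on W (\<lambda>p. fst (snd (\<theta> p)))" "smooth_on W (\<lambda>p. snd (snd (\<theta> p)))"
    by (intro smooth_intros W \<theta>)+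
  have vv: "dir_deriv d (dir_deriv (1, 0) v) p = fst (snd (dir_deriv d \<theta> p))"
    "dir_deriv d (dir_deriv (0, 1) v) p = snd (snd (dir_deriv d \<theta> p))" if "p \<in> W" for d p
    using dir_deriv_cong[OF W(1) that v(1)[symmetric] sm2(1)] dir_deriv_cong[OF W(1) that v(2)[symmetric] sm2(2)]
      dir_deriv_bounded_linear[OF bounded_linear_compose[OF bounded_linear_fst bounded_linear_snd] \<theta>(1) that]
      dir_deriv_bounded_linear[OF bounded_linear_compose[OF bounded_linear_snd bounded_linear_snd] \<theta>(1) that]
    by auto
  show ?thesis
  proof (rule that[OF W])
    have "smooth_on W v" unfolding v_def by (intro smooth_intros W \<theta>)
    then show "affine_function_on W v"
      unfolding affine_function_on_def by (simp add: v vv \<theta> A B mult.commute)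
  qed (use W(2) in \<open>simp_all add: v \<theta>\<close>)
qed

end

section \<open>Flat connections are linearizable\<close>

text \<open>The inverse function theorem leaves open the smoothness of the inverse. An explicit
  smooth right inverse \<open>H\<close> of the derivative supplies it: the derivative of the inverse
  map \<open>g\<close> in the direction \<open>d\<close> is \<open>H d\<close> evaluated at
  \<open>g\<close>. The normalisation at \<open>x0\<close> lets the identity serve as the inverse of
  the derivative there.\<close>

lemma local_point_transformation:
  assumes "open S" "smooth_on S f" "x0 \<in> S" "\<And>d. dir_deriv d f x0 = d"
    and H: "\<And>d. smooth_on S (H d)" "\<And>x d. x \<in> S \<Longrightarrow> dir_deriv (H d x) f x = d"
  obtains U where "x0 \<in> U" "U \<subseteq> S" "point_transformation U f"
proof -
  \<comment> \<open>The derivative as a bounded operator, assembled from its basis columns so that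
    its continuity follows from that of the directional derivatives.\<close>
  define F where "F = (\<lambda>x. \<Sum>b\<in>Basis. blinfun_scaleR_left (dir_deriv b f x) o\<^sub>L blinfun_inner_left b)"
  have F: "blinfun_apply (F x) = (\<lambda>d. dir_deriv d f x)" if "x \<in> S" for x
    by (rule ext) (simp add: F_def blinfun.sum_left
        linear_eq_sum_Basis[OF has_derivative_linear[OF smooth_on_has_derivative[OF assms(2) that]], symmetric])
  have "continuous_on S F"
    unfolding F_def
    by (intro continuous_on_sum bounded_bilinear.continuous_on[OF bounded_bilinear_blinfun_compose]
        bounded_linear.continuous_on[OF bounded_linear_blinfun_scaleR_left] continuous_on_const
        smooth_on_continuous_on smooth_on_dir_deriv assms)
  moreover have "id_blinfun o\<^sub>L F x0 = id_blinfun"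
    by (rule blinfun_eqI) (simp add: F[OF assms(3)] assms(4))
  moreover have "\<And>x. x \<in> S \<Longrightarrow> (f has_derivative blinfun_apply (F x)) (at x)"
    using smooth_on_has_derivative[OF assms(2)] by (simp add: F)
  ultimately obtain U V g g' where U: "open U" "U \<subseteq> S" "x0 \<in> U" "open V" "homeomorphism U V f g"
    and g: "\<And>y. y \<in> V \<Longrightarrow> (g has_derivative (g' y)) (at y)"
      "\<And>y. y \<in> V \<Longrightarrow> g' y = inv (blinfun_apply (F (g y)))"
      "\<And>y. y \<in> V \<Longrightarrow> bij (blinfun_apply (F (g y)))"
    using inverse_function_theorem[OF assms(1), of f F x0 id_blinfun] assms(3) by metis
  have gU: "g y \<in> U" if "y \<in> V" for y using homeomorphism_image2[OF U(5)] that by blast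
  have fU: "f ` U = V" using homeomorphism_image1[OF U(5)] .
  have inj: "inj_on f U" using homeomorphism_apply1[OF U(5)] by (metis inj_onI)
  have "smooth_on V g"
  proof (rule smooth_on_inverse_map[where H = H and S = S])
    fix y assume y: "y \<in> V"
    show "g y \<in> S" using gU[OF y] U(2) by blast
    have "g' y d = H d (g y)" for d
      unfolding g(2)[OF y]
      using inv_f_eq[OF bij_is_inj[OF g(3)[OF y]], of "H d (g y)" d] H(2)[OF \<open>g y \<in> S\<close>] F[OF \<open>g y \<in> S\<close>]
      by simp
    then have "g' y = (\<lambda>d. H d (g y))" by blast
    then show "(g has_derivative (\<lambda>d. H d (g y))) (at y)" using g(1)[OF y] by simp
  qed (use U H in auto)
  moreover have "g y = inv_into U f y" if "y \<in> V" for y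
    using inv_into_f_f[OF inj gU[OF that]] homeomorphism_apply2[OF U(5) that] by simp
  ultimately have "smooth_on V (inv_into U f)" using smooth_on_cong[OF U(4)] by blast
  then have "point_transformation U f"
    unfolding point_transformation_def fU using U inj smooth_on_subset[OF assms(2)] by blast
  then show ?thesis using that U by blast
qed

section \<open>Derivatives of functions along plane curves\<close>

lemma smooth_on_DERIV:
  fixes f :: "real \<Rightarrow> real"
  assumes "smooth_on I f" "x \<in> I"
  shows "(f has_real_derivative deriv f x) (at x)"
  using smooth_on_has_derivative[OF assms] by (metis DERIV_deriv_iff_real_differentiable differentiable_def)

lemma smooth_on_deriv [smooth_intros]:
  fixes f :: "real \<Rightarrow> real"
  assumes "open I" "smooth_on I f"
  shows "smooth_on I (deriv f)"
proof (rule smooth_on_cong[OF assms(1) _ smooth_on_dir_deriv[OF assms(2)]])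
  show "dir_deriv 1 f x = deriv f x" if "x \<in> I" for x
    using smooth_on_DERIV[OF assms(2) that] by (simp add: has_field_derivative_def dir_deriv_eq)
qed

lemma deriv_cong_open:
  fixes f g :: "real \<Rightarrow> real"
  assumes "open I" "\<And>x. x \<in> I \<Longrightarrow> f x = g x" "x \<in> I"
  shows "deriv f x = deriv g x"
  using assms by (intro deriv_cong_ev) (auto simp: eventually_nhds)

lemma DERIV_along_curve:
  fixes v :: "real \<times> real \<Rightarrow> real"
  assumes "smooth_on W v" "(y x, z x) \<in> W"
    and "(y has_real_derivative p) (at x)" "(z has_real_derivative q) (at x)"
  shows "((\<lambda>x. v (y x, z x)) has_real_derivative
    dir_deriv (1, 0) v (y x, z x) * p + dir_deriv (0, 1) v (y x, z x) * q) (at x)"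
proof -
  have "((\<lambda>x. (y x, z x)) has_derivative (\<lambda>h. (p * h, q * h))) (at x)"
    using assms(3,4) by (intro has_derivative_Pair) (simp_all add: has_field_derivative_def)
  from has_derivative_compose[OF this smooth_on_has_derivative[OF assms(1,2)]]
  show ?thesis
    unfolding has_field_derivative_def dir_deriv_real2[OF assms(1,2), of "(p * h, q * h)" for h]
    by (rule has_derivative_eq_rhs) (auto simp: algebra_simps)
qed

lemma deriv2_along_curve:
  fixes v :: "real \<times> real \<Rightarrow> real"
  assumes "smooth_on W v" "open I" "smooth_on I y" "smooth_on I z"
    and W: "\<And>x. x \<in> I \<Longrightarrow> (y x, z x) \<in> W" and "x \<in> I"
  shows "deriv (deriv (\<lambda>x. v (y x, z x))) x =
    dir_deriv (1, 0) v (y x, z x) * deriv (deriv y) x + dir_deriv (0, 1) v (y x, z x) * deriv (deriv z) x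
    + dir_deriv (1, 0) (dir_deriv (1, 0) v) (y x, z x) * (deriv y x)\<^sup>2
    + (dir_deriv (0, 1) (dir_deriv (1, 0) v) (y x, z x)
      + dir_deriv (1, 0) (dir_deriv (0, 1) v) (y x, z x)) * deriv y x * deriv z x
    + dir_deriv (0, 1) (dir_deriv (0, 1) v) (y x, z x) * (deriv z x)\<^sup>2"
proof -
  note yz = smooth_on_DERIV[OF assms(3)] smooth_on_DERIV[OF assms(4)]
  have "deriv (deriv (\<lambda>x. v (y x, z x))) x =
      deriv (\<lambda>x. dir_deriv (1, 0) v (y x, z x) * deriv y x + dir_deriv (0, 1) v (y x, z x) * deriv z x) x"
    by (rule deriv_cong_open[OF assms(2) _ \<open>x \<in> I\<close>])
      (intro DERIV_imp_deriv DERIV_along_curve[where y = y and z = z, OF assms(1) W] yz)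
  also have "\<dots> = (dir_deriv (1, 0) (dir_deriv (1, 0) v) (y x, z x) * deriv y x
        + dir_deriv (0, 1) (dir_deriv (1, 0) v) (y x, z x) * deriv z x) * deriv y x
      + deriv (deriv y) x * dir_deriv (1, 0) v (y x, z x)
      + ((dir_deriv (1, 0) (dir_deriv (0, 1) v) (y x, z x) * deriv y x
        + dir_deriv (0, 1) (dir_deriv (0, 1) v) (y x, z x) * deriv z x) * deriv z x
      + deriv (deriv z) x * dir_deriv (0, 1) v (y x, z x))"
    by (intro DERIV_imp_deriv DERIV_add DERIV_mult yz[OF \<open>x \<in> I\<close>]
        DERIV_along_curve[where y = y and z = z, OF smooth_on_dir_deriv[OF assms(1)] W[OF \<open>x \<in> I\<close>]]
        smooth_on_DERIV[OF smooth_on_deriv[OF assms(2,3)] \<open>x \<in> I\<close>]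
        smooth_on_DERIV[OF smooth_on_deriv[OF assms(2,4)] \<open>x \<in> I\<close>])
  finally show ?thesis by (simp add: algebra_simps power2_eq_square)
qed

context plane_connection
begin

abbreviation "geodesic_system \<equiv> quadratic_system (\<lambda>y z. b222 (y, z)) (\<lambda>y z. b223 (y, z))
  (\<lambda>y z. b233 (y, z)) (\<lambda>y z. b322 (y, z)) (\<lambda>y z. b323 (y, z)) (\<lambda>y z. b333 (y, z))"

text \<open>For an affine function \<open>v\<close> the Hessian terms of the chain rule are exactly
  the quadratic terms of the system, so along any curve \<open>v'' = v_y Ey + v_z Ez\<close>, where
  \<open>Ey\<close> and \<open>Ez\<close> are the left-hand sides of the two equations. Two such
  functions with independent differentials make both systems vanish together, point by
  point.\<close>

lemma flat_imp_linearizable: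
  assumes flat: "\<And>p. p \<in> D \<Longrightarrow> flat_at p"
  shows "linearizable_on (UNIV \<times> D) geodesic_system"
  unfolding linearizable_on_def
proof
  fix P assume "P \<in> (UNIV :: real set) \<times> D"
  then obtain x0 a b where P: "P = (x0, a, b)" "(a, b) \<in> D" by auto
  obtain W1 v where W1: "open W1" "(a, b) \<in> W1" "W1 \<subseteq> D" and v': "affine_function_on W1 v"
    "dir_deriv (1, 0) v (a, b) = 1" "dir_deriv (0, 1) v (a, b) = 0"
    using affine_function_exists[OF flat P(2), where c = 1 and c' = 0] by blast
  obtain W2 w where W2: "open W2" "(a, b) \<in> W2" "W2 \<subseteq> D" and w': "affine_function_on W2 w"
    "dir_deriv (1, 0) w (a, b) = 0" "dir_deriv (0, 1) w (a, b) = 1"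
    using affine_function_exists[OF flat P(2), where c = 0 and c' = 1] by blast
  note v = v'(1)[unfolded affine_function_on_def, THEN conjunct1] v'(2,3)
  note w = w'(1)[unfolded affine_function_on_def, THEN conjunct1] w'(2,3)
  \<comment> \<open>The Jacobian determinant of \<open>(v, w)\<close>. It equals 1 at
    \<open>(a, b)\<close>, so \<open>W\<close> is a neighbourhood on which it has no zero.\<close>
  define J where "J = (\<lambda>p. dir_deriv (1, 0) v p * dir_deriv (0, 1) w p - dir_deriv (0, 1) v p * dir_deriv (1, 0) w p)"
  have W12: "smooth_on (W1 \<inter> W2) v" "smooth_on (W1 \<inter> W2) w" "open (W1 \<inter> W2)"
    using v w W1 W2 by (auto intro: smooth_on_subset)
  then have "smooth_on (W1 \<inter> W2) J" unfolding J_def by (intro smooth_intros) auto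
  then have "open ((W1 \<inter> W2) \<inter> J -` (- {0}))"
    by (intro continuous_open_preimage smooth_on_continuous_on W12) auto
  moreover define W where "W = (W1 \<inter> W2) \<inter> J -` (- {0})"
  ultimately have W: "open W" "(a, b) \<in> W" "W \<subseteq> D" and J0: "\<And>p. p \<in> W \<Longrightarrow> J p \<noteq> 0"
    using W1 W2 v w by (auto simp: J_def)
  have vw: "smooth_on W v" "smooth_on W w" and W': "W \<subseteq> W1" "W \<subseteq> W2"
    using W12 by (auto simp: W_def intro: smooth_on_subset)
  define S where "S = (UNIV :: real set) \<times> W"
  have S: "open S" "P \<in> S" "S \<subseteq> UNIV \<times> D" using W by (auto simp: S_def P intro: open_Times)
  define \<phi> where "\<phi> = (\<lambda>q :: real \<times> real \<times> real. (fst q, v (snd q), w (snd q)))"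
  have snd: "smooth_on S (\<lambda>q. f (snd q))" if "smooth_on W f" for f :: "real \<times> real \<Rightarrow> real"
    by (rule smooth_on_compose[OF S(1) _ that]) (auto simp: S_def intro!: smooth_intros S(1)[unfolded S_def])
  have sm: "smooth_on S \<phi>" unfolding \<phi>_def by (intro smooth_on_Pair snd vw S(1) smooth_on_fst smooth_on_id)
  have d\<phi>: "dir_deriv d \<phi> q = (fst d, dir_deriv (snd d) v (snd q), dir_deriv (snd d) w (snd q))" if "q \<in> S" for d q
  proof -
    have "snd q \<in> W" using that by (auto simp: S_def)
    have "(\<phi> has_derivative (\<lambda>d. (fst d, dir_deriv (snd d) v (snd q), dir_deriv (snd d) w (snd q)))) (at q)"
      unfolding \<phi>_def
      by (intro has_derivative_Pair has_derivative_compose[OF has_derivative_snd[OF has_derivative_ident]]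
         smooth_on_has_derivative[OF vw(1) \<open>snd q \<in> W\<close>] smooth_on_has_derivative[OF vw(2) \<open>snd q \<in> W\<close>]
         has_derivative_fst has_derivative_ident)
    then show ?thesis by (simp add: dir_deriv_eq)
  qed
  note partials = dir_deriv_real2[OF vw(1)] dir_deriv_real2[OF vw(2)]
  obtain U where U: "P \<in> U" "U \<subseteq> S" "point_transformation U \<phi>"
  proof (rule local_point_transformation[OF S(1) sm S(2)])
    show "dir_deriv d \<phi> P = d" for d
      using W(2) unfolding d\<phi>[OF S(2)] by (simp add: partials[of "(a, b)" "snd d"] P v w)
    \<comment> \<open>Cramer's rule for the block of \<open>y\<close> and \<open>z\<close>; the
      first coordinate is left unchanged.\<close>
    define H where "H = (\<lambda>(d :: real \<times> real \<times> real) (q :: real \<times> real \<times> real). (fst d,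
      (dir_deriv (0, 1) w (snd q) * fst (snd d) - dir_deriv (0, 1) v (snd q) * snd (snd d)) / J (snd q),
      (dir_deriv (1, 0) v (snd q) * snd (snd d) - dir_deriv (1, 0) w (snd q) * fst (snd d)) / J (snd q)))"
    have "smooth_on W J" unfolding J_def by (intro smooth_intros W vw)
    then show "smooth_on S (H d)" for d
      unfolding H_def
      by (intro smooth_on_Pair smooth_on_divide smooth_on_diff smooth_on_mult snd smooth_on_dir_deriv vw
          smooth_on_const S(1)) (use J0 in \<open>auto simp: S_def\<close>)
    show "dir_deriv (H d q) \<phi> q = d" if q: "q \<in> S" for q d
    proof -
      have "snd q \<in> W" using q by (auto simp: S_def)
      then show ?thesis
        unfolding d\<phi>[OF q] partials[OF \<open>snd q \<in> W\<close>, of "snd (H d q)"] using J0[of "snd q"]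
        by (cases d) (simp add: H_def divide_simps, simp add: J_def algebra_simps)
    qed
  qed
  have "transforms_system U \<phi> geodesic_system free_particle"
    unfolding transforms_system_def
  proof (intro allI impI, elim conjE)
    fix I y z I' v' w'
    assume curves: "curve_on I y z" "curve_on I' v' w'" and sub: "graph_on I y z \<subseteq> U"
      and im: "\<phi> ` graph_on I y z = graph_on I' v' w'"
    have I: "open I" "smooth_on I y" "smooth_on I z" using curves by (auto simp: curve_on_def)
    have im': "(\<lambda>x. (x, v (y x, z x), w (y x, z x))) ` I = (\<lambda>x. (x, v' x, w' x)) ` I'"
      using im by (simp add: graph_on_def \<phi>_def image_image)
    then have "fst ` (\<lambda>x. (x, v (y x, z x), w (y x, z x))) ` I = fst ` (\<lambda>x. (x, v' x, w' x)) ` I'" by simp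
    then have "I' = I" by (simp add: image_image)
    have v'w': "v' x = v (y x, z x)" "w' x = w (y x, z x)" if "x \<in> I" for x
    proof -
      have "(x, v (y x, z x), w (y x, z x)) \<in> (\<lambda>x. (x, v' x, w' x)) ` I'"
        unfolding im'[symmetric] using that by blast
      then show "v' x = v (y x, z x)" "w' x = w (y x, z x)" by auto
    qed
    have inW: "(y x, z x) \<in> W" if "x \<in> I" for x
      using sub U(2) that by (auto simp: graph_on_def S_def)
    have eq: "solves geodesic_system {x} y z \<longleftrightarrow> solves free_particle {x} v' w'" if x: "x \<in> I" for x
    proof -
      define p where "p = (y x, z x)"
      have p: "p \<in> W" "p \<in> W1" "p \<in> W2" using inW[OF x] W' by (auto simp: p_def)
      define Ey where "Ey = deriv (deriv y) x + b222 p * (deriv y x)\<^sup>2 + 2 * b223 p * deriv y x * deriv z x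
        + b233 p * (deriv z x)\<^sup>2"
      define Ez where "Ez = deriv (deriv z) x + b322 p * (deriv y x)\<^sup>2 + 2 * b323 p * deriv y x * deriv z x
        + b333 p * (deriv z x)\<^sup>2"
      have cong: "deriv (deriv v') x = deriv (deriv (\<lambda>x. v (y x, z x))) x"
        "deriv (deriv w') x = deriv (deriv (\<lambda>x. w (y x, z x))) x"
        using v'w' by (auto intro!: deriv_cong_open[OF I(1) deriv_cong_open[OF I(1)] x])
      have "deriv (deriv v') x = dir_deriv (1, 0) v p * Ey + dir_deriv (0, 1) v p * Ez"
        using deriv2_along_curve[of W v I y z x, OF vw(1) I inW x, folded p_def] v'(1) p(2)
        unfolding cong affine_function_on_def dir_deriv_commute[OF W(1) vw(1) p(1), of "(1, 0)" "(0, 1)"]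
        by (simp add: Ey_def Ez_def algebra_simps)
      moreover have "deriv (deriv w') x = dir_deriv (1, 0) w p * Ey + dir_deriv (0, 1) w p * Ez"
        using deriv2_along_curve[of W w I y z x, OF vw(2) I inW x, folded p_def] w'(1) p(3)
        unfolding cong affine_function_on_def dir_deriv_commute[OF W(1) vw(2) p(1), of "(1, 0)" "(0, 1)"]
        by (simp add: Ey_def Ez_def algebra_simps)
      moreover have "c * Ey + d * Ez = 0 \<and> c' * Ey + d' * Ez = 0 \<longleftrightarrow> Ey = 0 \<and> Ez = 0"
        if "c * d' - d * c' \<noteq> 0" for c d c' d' :: real
      proof (rule iffI)
        assume *: "c * Ey + d * Ez = 0 \<and> c' * Ey + d' * Ez = 0"
        then have "(c * d' - d * c') * Ey = 0" "(c * d' - d * c') * Ez = 0" by algebra+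
        then show "Ey = 0 \<and> Ez = 0" using that by simp
      qed simp
      ultimately show ?thesis
        using J0[OF p(1)] unfolding J_def
        by (simp add: solves_def quadratic_system_def free_particle_def Ey_def[symmetric] Ez_def[symmetric] p_def[symmetric])
    qed
    have "solves T I f g \<longleftrightarrow> (\<forall>x\<in>I. solves T {x} f g)" for T f g by (simp add: solves_def)
    then show "solves geodesic_system I y z \<longleftrightarrow> solves free_particle I' v' w'"
      using eq unfolding \<open>I' = I\<close> by metis
  qed
  then show "\<exists>V \<phi>. P \<in> V \<and> V \<subseteq> UNIV \<times> D \<and> point_transformation V \<phi> \<and>
      transforms_system V \<phi> geodesic_system free_particle"
    using U S(3) by blast
qed

end

section \<open>Images of straight lines\<close>

text \<open>The exceptional set is a line or empty, so its complement is dense and the cubic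
  vanishes everywhere by continuity. Its ten coefficients are then determined by ten values.\<close>

lemma cubic_eq_0_off_line:
  fixes c00 :: real
  assumes "\<eta>1 \<noteq> 0 \<or> \<eta>2 \<noteq> 0 \<or> \<eta>3 \<noteq> (0 :: real)"
    and "\<And>s t. \<eta>1 + s * \<eta>2 + t * \<eta>3 \<noteq> 0 \<Longrightarrow>
      c00 + c10 * s + c01 * t + c20 * s^2 + c11 * s * t + c02 * t^2
        + c30 * s^3 + c21 * s^2 * t + c12 * s * t^2 + c03 * t^3 = 0"
  shows "c00 = 0" "c10 = 0" "c01 = 0" "c20 = 0" "c11 = 0" "c02 = 0" "c30 = 0" "c21 = 0" "c12 = 0" "c03 = 0"
proof -
  define f where "f = (\<lambda>s t. c00 + c10 * s + c01 * t + c20 * s^2 + c11 * s * t + c02 * t^2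
        + c30 * s^3 + c21 * s^2 * t + c12 * s * t^2 + c03 * t^3)"
  have f0: "f s t = 0" for s t
  proof (cases "\<eta>1 + s * \<eta>2 + t * \<eta>3 = 0")
    case True
    have pos: "\<eta>2\<^sup>2 + \<eta>3\<^sup>2 \<noteq> 0"
    proof
      assume "\<eta>2\<^sup>2 + \<eta>3\<^sup>2 = 0"
      then have "\<eta>2 = 0" "\<eta>3 = 0" by (simp_all add: sum_power2_eq_zero_iff)
      then show False using True assms(1) by simp
    qed
    \<comment> \<open>A point of the line is approached along the normal
      \<open>(\<eta>2, \<eta>3)\<close>, on which the linear form is a nonzero multiple of
      \<open>h\<close>.\<close>
    have "f (s + h * \<eta>2) (t + h * \<eta>3) = 0" if "h \<noteq> 0" for h
    proof -
      have "\<eta>1 + (s + h * \<eta>2) * \<eta>2 + (t + h * \<eta>3) * \<eta>3 = h * (\<eta>2\<^sup>2 + \<eta>3\<^sup>2)"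
        using True by (simp add: algebra_simps power2_eq_square)
      then show ?thesis using assms(2)[of "s + h * \<eta>2" "t + h * \<eta>3"] that pos by (simp add: f_def)
    qed
    then have "((\<lambda>h. f (s + h * \<eta>2) (t + h * \<eta>3)) \<longlongrightarrow> 0) (at 0)"
      by (auto intro!: tendsto_eventually simp: eventually_at_filter)
    moreover have "((\<lambda>h. f (s + h * \<eta>2) (t + h * \<eta>3)) \<longlongrightarrow> f (s + 0 * \<eta>2) (t + 0 * \<eta>3)) (at 0)"
      unfolding f_def by (intro tendsto_intros)
    ultimately show ?thesis using tendsto_unique[OF trivial_limit_at] by fastforce
  qed (use assms(2) in \<open>simp add: f_def\<close>)
  \<comment> \<open>Four points on each axis fix the pure coefficients; the three points off the
    axes fix those of \<open>s * t\<close>, \<open>s^2 * t\<close> and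
    \<open>s * t^2\<close>.\<close>
  have "f 0 0 = 0" "f 1 0 = 0" "f (-1) 0 = 0" "f 2 0 = 0" "f 0 1 = 0" "f 0 (-1) = 0" "f 0 2 = 0"
    "f 1 1 = 0" "f 1 (-1) = 0" "f (-1) 1 = 0"
    using f0 by blast+
  then show "c00 = 0" "c10 = 0" "c01 = 0" "c20 = 0" "c11 = 0" "c02 = 0" "c30 = 0" "c21 = 0" "c12 = 0" "c03 = 0"
    by (simp_all add: f_def)
qed

text \<open>The straight line identity for \<open>Y\<close>, differentiated once in a direction
  \<open>k\<close>, as a polynomial in \<open>s\<close> and \<open>t\<close>. Here
  \<open>xi\<close>, \<open>pi\<close>, \<open>ri\<close> are the derivatives of \<open>X_k\<close>,
  \<open>Y_k\<close>, \<open>Z_k\<close> in the three basis directions, \<open>A1j\<close> the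
  second derivatives of \<open>X\<close>, \<open>yij\<close> and \<open>wij\<close> those of
  \<open>Y_k\<close> and \<open>X_k\<close>, and \<open>d222\<close>, \<open>d223\<close>,
  \<open>d233\<close> the derivatives of the coefficients. The conclusions are the coefficients of
  \<open>s^2\<close>, \<open>s t\<close>, \<open>t^2\<close>, \<open>s^3\<close>,
  \<open>s^2 t\<close>, \<open>s t^2\<close>; every cubic term carries a factor \<open>s\<close>.
  Exchanging \<open>s\<close> and \<open>t\<close> covers the equation for \<open>Z\<close>.\<close>

lemma geodesic_jet:
  fixes A11 :: real
  assumes "\<eta>1 \<noteq> 0 \<or> \<eta>2 \<noteq> 0 \<or> \<eta>3 \<noteq> (0 :: real)"
    and eq: "\<And>s t. \<eta>1 + s * \<eta>2 + t * \<eta>3 \<noteq> 0 \<Longrightarrow>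
      (x1 + s * x2 + t * x3) * (s * (A11 + 2 * s * A12 + 2 * t * A13))
      + ((y11 + 2 * s * y12 + 2 * t * y13 + s^2 * y22 + 2 * s * t * y23 + t^2 * y33)
        + (d222 * s^2 + 2 * d223 * s * t + d233 * t^2)
        + 2 * b222 * s * (p1 + s * p2 + t * p3)
        + 2 * b223 * (t * (p1 + s * p2 + t * p3) + s * (r1 + s * r2 + t * r3))
        + 2 * b233 * t * (r1 + s * r2 + t * r3))
      - (p1 + s * p2 + t * p3) * (A11 + 2 * s * A12 + 2 * t * A13)
      - s * (w11 + 2 * s * w12 + 2 * t * w13 + s^2 * w22 + 2 * s * t * w23 + t^2 * w33) = 0"
  shows "2*x1*A12 + x2*A11 + y22 + d222 + 2*b222*p2 + 2*b223*r2 - 2*p2*A12 - 2*w12 = 0"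
    "2*x1*A13 + x3*A11 + 2*y23 + 2*d223 + 2*b222*p3 + 2*b223*(p2 + r3) + 2*b233*r2 - 2*p2*A13 - 2*p3*A12 - 2*w13 = 0"
    "y33 + d233 + 2*b223*p3 + 2*b233*r3 - 2*p3*A13 = 0"
    "2*x2*A12 - w22 = 0" "2*x2*A13 + 2*x3*A12 - 2*w23 = 0" "2*x3*A13 - w33 = 0"
proof -
  note cubic = cubic_eq_0_off_line[OF assms(1), of
    "y11 - p1*A11"
    "x1*A11 + 2*y12 + 2*b222*p1 + 2*b223*r1 - p2*A11 - 2*p1*A12 - w11"
    "2*y13 + 2*b223*p1 + 2*b233*r1 - p3*A11 - 2*p1*A13"
    "2*x1*A12 + x2*A11 + y22 + d222 + 2*b222*p2 + 2*b223*r2 - 2*p2*A12 - 2*w12"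
    "2*x1*A13 + x3*A11 + 2*y23 + 2*d223 + 2*b222*p3 + 2*b223*(p2 + r3) + 2*b233*r2 - 2*p2*A13 - 2*p3*A12 - 2*w13"
    "y33 + d233 + 2*b223*p3 + 2*b233*r3 - 2*p3*A13"
    "2*x2*A12 - w22" "2*x2*A13 + 2*x3*A12 - 2*w23" "2*x3*A13 - w33" 0]
  show "2*x1*A12 + x2*A11 + y22 + d222 + 2*b222*p2 + 2*b223*r2 - 2*p2*A12 - 2*w12 = 0"
    "2*x1*A13 + x3*A11 + 2*y23 + 2*d223 + 2*b222*p3 + 2*b223*(p2 + r3) + 2*b233*r2 - 2*p2*A13 - 2*p3*A12 - 2*w13 = 0"
    "y33 + d233 + 2*b223*p3 + 2*b233*r3 - 2*p3*A13 = 0"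
    "2*x2*A12 - w22 = 0" "2*x2*A13 + 2*x3*A12 - 2*w23 = 0" "2*x3*A13 - w33 = 0"
    by (rule cubic(4) cubic(5) cubic(6) cubic(7) cubic(8) cubic(9),
      (drule eq, simp only: mult_zero_left, algebra))+
qed

text \<open>This serves to take the first coordinate of a curve as its parameter. Injectivity comes
  from the mean value theorem, openness of the image from invariance of domain, and smoothness of
  the inverse from its derivative \<open>1 / deriv f\<close>.\<close>

lemma smooth_inverse_real:
  fixes f :: "real \<Rightarrow> real"
  assumes "open T" "connected T" "smooth_on T f" "\<And>t. t \<in> T \<Longrightarrow> deriv f t \<noteq> 0"
  obtains g where "open (f ` T)" "connected (f ` T)" "smooth_on (f ` T) g" "\<And>t. t \<in> T \<Longrightarrow> g (f t) = t"
proof -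
  have cont: "continuous_on T f" by (rule smooth_on_continuous_on[OF assms(3)])
  have "f s \<noteq> f t" if "s \<in> T" "t \<in> T" "s < t" for s t
  proof
    assume "f s = f t"
    have sub: "{s..t} \<subseteq> T" using connected_contains_Icc[OF assms(2) that(1,2)] .
    have "\<exists>u. s < u \<and> u < t \<and> f t - f s = (t - s) * deriv f u"
      by (rule MVT2[OF that(3)]) (use sub smooth_on_DERIV[OF assms(3)] in auto)
    then obtain u where "s < u" "u < t" "f t - f s = (t - s) * deriv f u" by blast
    then show False using assms(4)[of u] sub \<open>f s = f t\<close> that(3) by (auto simp: subset_iff)
  qed
  then have inj: "inj_on f T" by (metis inj_onI linorder_neqE)
  obtain g where g: "homeomorphism T (f ` T) f g"
    by (rule invariance_of_domain_homeomorphism[OF assms(1) cont _ inj]) auto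
  have o: "open (f ` T)" by (rule invariance_of_domain[OF cont assms(1) inj])
  have gT: "g y \<in> T" "f (g y) = y" if "y \<in> f ` T" for y
    using g that by (auto simp: homeomorphism_def)
  have "smooth_on (f ` T) g"
  proof (rule smooth_on_inverse_map[OF o gT(1), where H = "\<lambda>d t. d / deriv f t"])
    fix y assume y: "y \<in> f ` T"
    have "isCont g y" using g o y by (auto simp: homeomorphism_def continuous_on_eq_continuous_at)
    have "(g has_real_derivative inverse (deriv f (g y))) (at y)"
      by (rule has_field_derivative_inverse_basic[OF smooth_on_DERIV[OF assms(3) gT(1)[OF y]]
          assms(4)[OF gT(1)[OF y]] \<open>isCont g y\<close> o y gT(2)])
    then show "(g has_derivative (\<lambda>d. d / deriv f (g y))) (at y)"
      unfolding has_field_derivative_def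
      by (rule has_derivative_eq_rhs) (simp add: divide_inverse mult.commute fun_eq_iff)
  next
    show "smooth_on T (\<lambda>t. d / deriv f t)" for d
      by (intro smooth_intros assms)
  qed auto
  then show ?thesis
    using that o connected_continuous_image[OF cont assms(2)] homeomorphism_apply1[OF g] by blast
qed

lemma DERIV_line:
  fixes f :: "'a::real_normed_vector \<Rightarrow> real"
  assumes "smooth_on S f" "x + t *\<^sub>R d \<in> S"
  shows "((\<lambda>t. f (x + t *\<^sub>R d)) has_real_derivative dir_deriv d f (x + t *\<^sub>R d)) (at t)"
  using smooth_on_line_has_derivative[OF assms] by (simp add: has_real_derivative_iff_has_vector_derivative)

text \<open>For a curve \<open>(\<xi> t, Y t)\<close> that is the graph of \<open>y\<close>, the
  relations are kept free of quotients, so that \<open>y'\<close> and \<open>y''\<close> can be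
  eliminated by polynomial algebra.\<close>

lemma deriv_reparam:
  fixes \<xi> y Y :: "real \<Rightarrow> real"
  assumes "open T" "open I" "smooth_on I y" "\<And>t. t \<in> T \<Longrightarrow> \<xi> t \<in> I" "\<And>t. t \<in> T \<Longrightarrow> y (\<xi> t) = Y t"
    and "\<And>t. t \<in> T \<Longrightarrow> (\<xi> has_real_derivative \<xi>' t) (at t)" "\<And>t. t \<in> T \<Longrightarrow> (Y has_real_derivative Y' t) (at t)"
    and "(\<xi>' has_real_derivative \<xi>'') (at t)" "(Y' has_real_derivative Y'') (at t)" "t \<in> T"
  shows "Y' t = deriv y (\<xi> t) * \<xi>' t" "Y'' = deriv (deriv y) (\<xi> t) * (\<xi>' t)\<^sup>2 + deriv y (\<xi> t) * \<xi>''"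
proof -
  have Y': "Y' t = deriv y (\<xi> t) * \<xi>' t" if t: "t \<in> T" for t
  proof -
    have "((\<lambda>t. y (\<xi> t)) has_real_derivative deriv y (\<xi> t) * \<xi>' t) (at t)"
      by (rule DERIV_chain2[OF smooth_on_DERIV[OF assms(3) assms(4)[OF t]] assms(6)[OF t]])
    then have "(Y has_real_derivative deriv y (\<xi> t) * \<xi>' t) (at t)"
      by (rule has_field_derivative_transform_within_open[OF _ assms(1) t assms(5)])
    then show ?thesis using DERIV_unique assms(7)[OF t] by blast
  qed
  then show "Y' t = deriv y (\<xi> t) * \<xi>' t" using assms by blast
  have "((\<lambda>t. deriv y (\<xi> t) * \<xi>' t) has_real_derivative
      deriv (deriv y) (\<xi> t) * \<xi>' t * \<xi>' t + \<xi>'' * deriv y (\<xi> t)) (at t)"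
    by (intro DERIV_mult assms(8) DERIV_chain2[OF smooth_on_DERIV[OF smooth_on_deriv[OF assms(2,3)] assms(4)[OF assms(10)]]
          assms(6)[OF assms(10)]])
  then have "(Y' has_real_derivative deriv (deriv y) (\<xi> t) * \<xi>' t * \<xi>' t + \<xi>'' * deriv y (\<xi> t)) (at t)"
    by (rule has_field_derivative_transform_within_open[OF _ assms(1,10)]) (simp add: Y')
  from DERIV_unique[OF assms(9) this]
  show "Y'' = deriv (deriv y) (\<xi> t) * (\<xi>' t)\<^sup>2 + deriv y (\<xi> t) * \<xi>''"
    by (simp add: power2_eq_square algebra_simps)
qed


lemma DERIV_line2:
  fixes f :: "'a::real_normed_vector \<Rightarrow> real"
  assumes "smooth_on S f" "x + t *\<^sub>R d \<in> S"
  shows "((\<lambda>t. dir_deriv d f (x + t *\<^sub>R d)) has_real_derivative dir_deriv d (dir_deriv d f) (x + t *\<^sub>R d)) (at t)"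
  by (rule DERIV_line[OF smooth_on_dir_deriv[OF assms(1)] assms(2)])

text \<open>A straight line solves the free particle system, so its image under the inverse
  transformation, reparametrised by its first coordinate, solves the given one.\<close>

lemma (in plane_connection) straight_line_identity:
  fixes L :: "real \<times> real \<times> real \<Rightarrow> real \<times> real \<times> real" and \<phi> \<Psi> X Y Z
  assumes "V \<subseteq> UNIV \<times> D" "transforms_system V \<phi> geodesic_system free_particle"
    and L: "bounded_linear L"
    and U: "open U" "\<And>e. e \<in> U \<Longrightarrow> \<Psi> e \<in> V \<and> \<phi> (\<Psi> e) = Q + L e"
    and XYZ: "smooth_on U X" "smooth_on U Y" "smooth_on U Z" "\<And>e. e \<in> U \<Longrightarrow> \<Psi> e = (X e, Y e, Z e)"
    and "q \<in> U" "dir_deriv d X q \<noteq> 0" "fst (L d) \<noteq> 0"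
  shows "dir_deriv d X q * (dir_deriv d (dir_deriv d Y) q + b222 (Y q, Z q) * (dir_deriv d Y q)\<^sup>2
        + 2 * b223 (Y q, Z q) * dir_deriv d Y q * dir_deriv d Z q + b233 (Y q, Z q) * (dir_deriv d Z q)\<^sup>2)
      = dir_deriv d Y q * dir_deriv d (dir_deriv d X) q"
    "dir_deriv d X q * (dir_deriv d (dir_deriv d Z) q + b322 (Y q, Z q) * (dir_deriv d Y q)\<^sup>2
        + 2 * b323 (Y q, Z q) * dir_deriv d Y q * dir_deriv d Z q + b333 (Y q, Z q) * (dir_deriv d Z q)\<^sup>2)
      = dir_deriv d Z q * dir_deriv d (dir_deriv d X) q"
proof -
  interpret L: bounded_linear L by (rule L)
  let ?l = "\<lambda>t. q + t *\<^sub>R d"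
  \<comment> \<open>On a short segment through \<open>q\<close> the derivative of \<open>X\<close>
    in the direction \<open>d\<close> stays nonzero, so the image curve is a graph over the
    \<open>x\<close>-axis.\<close>
  define N where "N = U \<inter> dir_deriv d X -` (- {0})"
  have "open N"
    unfolding N_def by (intro continuous_open_preimage smooth_on_continuous_on smooth_on_dir_deriv XYZ U) auto
  then have "open (?l -` N)" by (intro open_vimage continuous_intros)
  moreover have "0 \<in> ?l -` N" using assms by (simp add: N_def)
  ultimately obtain \<epsilon> where \<epsilon>: "\<epsilon> > 0" "ball 0 \<epsilon> \<subseteq> ?l -` N" using open_contains_ball by blast
  define T where "T = ball (0 :: real) \<epsilon>"
  have T: "open T" "connected T" "0 \<in> T" using \<epsilon> by (auto simp: T_def)
  have lU: "?l t \<in> U" and X0: "dir_deriv d X (?l t) \<noteq> 0" if "t \<in> T" for t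
    using \<epsilon>(2) that by (auto simp: T_def N_def)
  have sml: "smooth_on T (\<lambda>t. f (?l t))" if "smooth_on U f" for f :: "real \<times> real \<times> real \<Rightarrow> real"
    by (rule smooth_on_compose[OF T(1) _ that lU]) (intro smooth_intros T)
  note der = DERIV_line[OF XYZ(1) lU] DERIV_line[OF XYZ(2) lU] DERIV_line[OF XYZ(3) lU]
  note der2 = DERIV_line2[OF XYZ(1) lU] DERIV_line2[OF XYZ(2) lU] DERIV_line2[OF XYZ(3) lU]
  define \<xi> where "\<xi> = (\<lambda>t. X (?l t))"
  have "smooth_on T \<xi>" unfolding \<xi>_def by (rule sml[OF XYZ(1)])
  moreover have "deriv \<xi> t \<noteq> 0" if "t \<in> T" for t
    using DERIV_imp_deriv[OF der(1)[OF that]] X0[OF that] by (simp add: \<xi>_def)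
  ultimately obtain \<sigma> where I: "open (\<xi> ` T)" "connected (\<xi> ` T)" "smooth_on (\<xi> ` T) \<sigma>"
    and \<sigma>: "\<And>t. t \<in> T \<Longrightarrow> \<sigma> (\<xi> t) = t"
    using smooth_inverse_real[OF T(1,2)] by blast
  define I where "I = \<xi> ` T"
  define y where "y = (\<lambda>x. Y (?l (\<sigma> x)))"
  define z where "z = (\<lambda>x. Z (?l (\<sigma> x)))"
  have \<sigma>T: "\<sigma> x \<in> T" if "x \<in> I" for x using that \<sigma> by (auto simp: I_def)
  have "smooth_on I y" "smooth_on I z"
    unfolding y_def z_def I_def
    using smooth_on_compose[OF I(1,3) sml[OF XYZ(2)] \<sigma>T[unfolded I_def]]
      smooth_on_compose[OF I(1,3) sml[OF XYZ(3)] \<sigma>T[unfolded I_def]] by auto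
  then have yz: "curve_on I y z" unfolding curve_on_def using I by (simp add: I_def)
  have graph_yz: "graph_on I y z = (\<lambda>t. \<Psi> (?l t)) ` T"
    unfolding graph_on_def I_def image_image
    by (intro image_cong refl) (simp add: y_def z_def \<sigma> XYZ(4)[OF lU], simp add: \<xi>_def)
  \<comment> \<open>The straight line through \<open>Q + L q\<close> with direction
    \<open>L d\<close>, written as a graph over its first coordinate; this is where
    \<open>fst (L d) \<noteq> 0\<close> enters.\<close>
  define u where "u = (\<lambda>t. fst (Q + L q) + t * fst (L d))"
  define v where "v = (\<lambda>x. fst (snd (Q + L q)) + (x - fst (Q + L q)) / fst (L d) * fst (snd (L d)))"
  define w where "w = (\<lambda>x. snd (snd (Q + L q)) + (x - fst (Q + L q)) / fst (L d) * snd (snd (L d)))"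
  have du: "(u has_real_derivative fst (L d)) (at t)" for t
    unfolding u_def by (auto intro!: derivative_eq_intros)
  have "smooth_on T u" unfolding u_def by (intro smooth_intros T)
  then obtain J: "open (u ` T)" "connected (u ` T)"
    using smooth_inverse_real[OF T(1,2), of u] DERIV_imp_deriv[OF du] assms(12) by metis
  have vw: "curve_on (u ` T) v w"
    unfolding curve_on_def v_def w_def using J assms(12) by (auto intro!: smooth_intros)
  have dv: "deriv v = (\<lambda>x. fst (snd (L d)) / fst (L d))" "deriv w = (\<lambda>x. snd (snd (L d)) / fst (L d))"
    unfolding v_def w_def using assms(12) by (auto intro!: DERIV_imp_deriv derivative_eq_intros simp: fun_eq_iff)
  have free: "solves free_particle (u ` T) v w"
    by (simp add: solves_def free_particle_def dv)
  have "graph_on I y z \<subseteq> V" unfolding graph_yz using U(2) lU by blast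
  moreover have "\<phi> ` graph_on I y z = graph_on (u ` T) v w"
    unfolding graph_yz unfolding graph_on_def image_image
    by (intro image_cong refl) (use U(2)[OF lU] assms(12) in
      \<open>simp add: u_def v_def w_def L.add L.scaleR prod_eq_iff\<close>)
  ultimately have "solves geodesic_system I y z"
    using assms(2) yz vw free unfolding transforms_system_def by blast
  moreover have mem: "\<xi> t \<in> I" if "t \<in> T" for t using that by (simp add: I_def)
  ultimately have geo: "geodesic_system (\<xi> 0) (y (\<xi> 0)) (z (\<xi> 0)) (deriv y (\<xi> 0)) (deriv z (\<xi> 0))
      (deriv (deriv y) (\<xi> 0)) (deriv (deriv z) (\<xi> 0)) = (0, 0)"
    using T(3) unfolding solves_def by blast
  have yY: "y (\<xi> t) = Y (?l t)" "z (\<xi> t) = Z (?l t)" if "t \<in> T" for t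
    using \<sigma>[OF that] by (simp_all add: y_def z_def)
  have D\<xi>: "(\<xi> has_real_derivative dir_deriv d X (?l t)) (at t)" if "t \<in> T" for t
    unfolding \<xi>_def by (rule der(1)[OF that])
  have "open I" "smooth_on I y" "smooth_on I z" using yz by (auto simp: curve_on_def)
  note Yr = deriv_reparam[OF T(1) \<open>open I\<close> \<open>smooth_on I y\<close> mem yY(1) D\<xi> der(2) der2(1)[OF T(3)] der2(2)[OF T(3)] T(3)]
  note Zr = deriv_reparam[OF T(1) \<open>open I\<close> \<open>smooth_on I z\<close> mem yY(2) D\<xi> der(3) der2(1)[OF T(3)] der2(3)[OF T(3)] T(3)]
  have yz0: "y (\<xi> 0) = Y q" "z (\<xi> 0) = Z q" using yY[OF T(3)] by auto
  \<comment> \<open>Insert \<open>Y_d = y' X_d\<close>, \<open>Z_d = z' X_d\<close> and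
    \<open>Y_dd = y'' X_d^2 + y' X_dd\<close> on the left: the equation of the system, multiplied by
    \<open>X_d^3\<close>, drops out and \<open>y' X_d X_dd = Y_d X_dd\<close> remains. The case of
    \<open>Z\<close> is the same.\<close>
  show "dir_deriv d X q * (dir_deriv d (dir_deriv d Y) q + b222 (Y q, Z q) * (dir_deriv d Y q)\<^sup>2
        + 2 * b223 (Y q, Z q) * dir_deriv d Y q * dir_deriv d Z q + b233 (Y q, Z q) * (dir_deriv d Z q)\<^sup>2)
      = dir_deriv d Y q * dir_deriv d (dir_deriv d X) q"
    "dir_deriv d X q * (dir_deriv d (dir_deriv d Z) q + b322 (Y q, Z q) * (dir_deriv d Y q)\<^sup>2
        + 2 * b323 (Y q, Z q) * dir_deriv d Y q * dir_deriv d Z q + b333 (Y q, Z q) * (dir_deriv d Z q)\<^sup>2)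
      = dir_deriv d Z q * dir_deriv d (dir_deriv d X) q"
    using geo Yr Zr unfolding quadratic_system_def yz0 prod.inject
    by (simp_all del: mult_eq_0_iff) algebra+
qed

section \<open>Flatness from the jets of the transformation\<close>

abbreviation ex :: "real \<times> real \<times> real" where "ex \<equiv> (1, 0, 0)"
abbreviation ey :: "real \<times> real \<times> real" where "ey \<equiv> (0, 1, 0)"
abbreviation ez :: "real \<times> real \<times> real" where "ez \<equiv> (0, 0, 1)"

lemma dir_deriv_real3:
  fixes f :: "real \<times> real \<times> real \<Rightarrow> real"
  assumes "smooth_on U f" "q \<in> U"
  shows "dir_deriv (1, s, t) f q = dir_deriv ex f q + s * dir_deriv ey f q + t * dir_deriv ez f q"
proof -
  have "dir_deriv (ex + s *\<^sub>R ey + t *\<^sub>R ez) f q = dir_deriv ex f q + s * dir_deriv ey f q + t * dir_deriv ez f q"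
    by (simp only: smooth_on_dir_deriv_lincomb[OF assms] real_scaleR_def)
  then show ?thesis by simp
qed

lemma dir_deriv2_real3:
  fixes f :: "real \<times> real \<times> real \<Rightarrow> real"
  assumes "open U" "smooth_on U f" "q \<in> U"
  shows "dir_deriv (1, s, t) (dir_deriv (1, s, t) f) q =
    dir_deriv ex (dir_deriv ex f) q + 2 * s * dir_deriv ey (dir_deriv ex f) q
    + 2 * t * dir_deriv ez (dir_deriv ex f) q + s\<^sup>2 * dir_deriv ey (dir_deriv ey f) q
    + 2 * s * t * dir_deriv ez (dir_deriv ey f) q + t\<^sup>2 * dir_deriv ez (dir_deriv ez f) q"
proof -
  note c = dir_deriv_commute[OF assms]
  note r = dir_deriv_real3[OF smooth_on_dir_deriv[OF assms(2)] assms(3), of s t]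
  have "dir_deriv (1, s, t) (dir_deriv (1, s, t) f) q = dir_deriv (1, s, t) (dir_deriv ex f) q
    + s * dir_deriv (1, s, t) (dir_deriv ey f) q + t * dir_deriv (1, s, t) (dir_deriv ez f) q"
    using r[of "(1, s, t)"] c[of ex "(1, s, t)"] c[of ey "(1, s, t)"] c[of ez "(1, s, t)"] by simp
  then show ?thesis
    unfolding r[of ex] r[of ey] r[of ez] c[of ex ey] c[of ex ez] c[of ey ez]
    by (simp add: algebra_simps power2_eq_square)
qed

lemma dir_deriv3_commute:
  fixes f :: "'a::real_normed_vector \<Rightarrow> real"
  assumes "open U" "smooth_on U f" "q \<in> U"
  shows "dir_deriv a (dir_deriv b (dir_deriv c f)) q = dir_deriv b (dir_deriv a (dir_deriv c f)) q"
    "dir_deriv a (dir_deriv b (dir_deriv c f)) q = dir_deriv a (dir_deriv c (dir_deriv b f)) q"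
  by (rule dir_deriv_commute[OF assms(1) smooth_on_dir_deriv[OF assms(2)] assms(3)])
    (rule dir_deriv_cong[OF assms(1,3) dir_deriv_commute[OF assms(1,2)]
      smooth_on_dir_deriv[OF smooth_on_dir_deriv[OF assms(2)]]])

text \<open>Here \<open>A\<close> stands for \<open>Y\<close> or \<open>Z\<close>, and
  \<open>m\<close> for its derivative in the direction \<open>e\<close>. The second conclusion
  differentiates the identity in the base point along \<open>k\<close>, with \<open>e\<close> fixed;
  this is legitimate because \<open>X_e\<close> is 1 at 0 and hence nonzero nearby. The
  undifferentiated bracket has been replaced by \<open>m X_ee\<close>, using the first
  conclusion.\<close>

lemma smooth_line_identity_jet:
  fixes X Y Z A :: "real \<times> real \<times> real \<Rightarrow> real"
  assumes U: "open U" "0 \<in> U" and XYZ: "smooth_on U X" "smooth_on U Y" "smooth_on U Z" "smooth_on U A"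
    and D: "(Y 0, Z 0) \<in> D"
    and g: "smooth_on D g1" "smooth_on D g2" "smooth_on D g3"
    and e: "dir_deriv e X 0 = 1" "dir_deriv e Y 0 = s" "dir_deriv e Z 0 = t" "dir_deriv e A 0 = m"
    and k: "dir_deriv k Y 0 = ky" "dir_deriv k Z 0 = kz"
    and eq: "\<forall>q\<in>U. dir_deriv e X q \<noteq> 0 \<longrightarrow> dir_deriv e X q * (dir_deriv e (dir_deriv e A) q
        + g1 (Y q, Z q) * (dir_deriv e Y q)\<^sup>2 + 2 * g2 (Y q, Z q) * dir_deriv e Y q * dir_deriv e Z q
        + g3 (Y q, Z q) * (dir_deriv e Z q)\<^sup>2) = dir_deriv e A q * dir_deriv e (dir_deriv e X) q"
  shows "dir_deriv e (dir_deriv e A) 0 + g1 (Y 0, Z 0) * s\<^sup>2 + 2 * g2 (Y 0, Z 0) * s * t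
      + g3 (Y 0, Z 0) * t\<^sup>2 = m * dir_deriv e (dir_deriv e X) 0"
    and "dir_deriv e (dir_deriv k X) 0 * (m * dir_deriv e (dir_deriv e X) 0)
      + (dir_deriv e (dir_deriv e (dir_deriv k A)) 0
        + ((dir_deriv (1, 0) g1 (Y 0, Z 0) * ky + dir_deriv (0, 1) g1 (Y 0, Z 0) * kz) * s\<^sup>2
          + 2 * (dir_deriv (1, 0) g2 (Y 0, Z 0) * ky + dir_deriv (0, 1) g2 (Y 0, Z 0) * kz) * s * t
          + (dir_deriv (1, 0) g3 (Y 0, Z 0) * ky + dir_deriv (0, 1) g3 (Y 0, Z 0) * kz) * t\<^sup>2)
        + 2 * g1 (Y 0, Z 0) * s * dir_deriv e (dir_deriv k Y) 0
        + 2 * g2 (Y 0, Z 0) * (t * dir_deriv e (dir_deriv k Y) 0 + s * dir_deriv e (dir_deriv k Z) 0)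
        + 2 * g3 (Y 0, Z 0) * t * dir_deriv e (dir_deriv k Z) 0)
      - dir_deriv e (dir_deriv k A) 0 * dir_deriv e (dir_deriv e X) 0
      - m * dir_deriv e (dir_deriv e (dir_deriv k X)) 0 = 0"
proof -
  show E: "dir_deriv e (dir_deriv e A) 0 + g1 (Y 0, Z 0) * s\<^sup>2 + 2 * g2 (Y 0, Z 0) * s * t
      + g3 (Y 0, Z 0) * t\<^sup>2 = m * dir_deriv e (dir_deriv e X) 0"
    using eq[rule_format, OF U(2)] e by simp
  have line: "((\<lambda>\<tau>. f (\<tau> *\<^sub>R k)) has_real_derivative dir_deriv k f 0) (at 0)" if "smooth_on U f" for f :: "real \<times> real \<times> real \<Rightarrow> real"
    using DERIV_line[OF that, of 0 0 k] U(2) by simp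
  have along: "((\<lambda>\<tau>. g (Y (\<tau> *\<^sub>R k), Z (\<tau> *\<^sub>R k))) has_real_derivative
      dir_deriv (1, 0) g (Y 0, Z 0) * ky + dir_deriv (0, 1) g (Y 0, Z 0) * kz) (at 0)" if "smooth_on D g" for g
    using DERIV_along_curve[OF that, of "\<lambda>\<tau>. Y (\<tau> *\<^sub>R k)" 0 "\<lambda>\<tau>. Z (\<tau> *\<^sub>R k)"] line[OF XYZ(2)] line[OF XYZ(3)] D k
    by simp
  define h where "h = (\<lambda>\<tau>. dir_deriv e X (\<tau> *\<^sub>R k) * (dir_deriv e (dir_deriv e A) (\<tau> *\<^sub>R k)
        + g1 (Y (\<tau> *\<^sub>R k), Z (\<tau> *\<^sub>R k)) * (dir_deriv e Y (\<tau> *\<^sub>R k) * dir_deriv e Y (\<tau> *\<^sub>R k))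
        + 2 * (g2 (Y (\<tau> *\<^sub>R k), Z (\<tau> *\<^sub>R k)) * (dir_deriv e Y (\<tau> *\<^sub>R k) * dir_deriv e Z (\<tau> *\<^sub>R k)))
        + g3 (Y (\<tau> *\<^sub>R k), Z (\<tau> *\<^sub>R k)) * (dir_deriv e Z (\<tau> *\<^sub>R k) * dir_deriv e Z (\<tau> *\<^sub>R k)))
      - dir_deriv e A (\<tau> *\<^sub>R k) * dir_deriv e (dir_deriv e X) (\<tau> *\<^sub>R k))"
  define N where "N = U \<inter> dir_deriv e X -` (- {0})"
  have "open N"
    unfolding N_def by (intro continuous_open_preimage smooth_on_continuous_on smooth_on_dir_deriv XYZ U) auto
  then have "open ((\<lambda>\<tau>::real. \<tau> *\<^sub>R k) -` N)" by (intro open_vimage continuous_intros)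
  moreover have "0 \<in> (\<lambda>\<tau>::real. \<tau> *\<^sub>R k) -` N" using U e by (simp add: N_def)
  moreover have "0 = h \<tau>" if "\<tau> \<in> (\<lambda>\<tau>. \<tau> *\<^sub>R k) -` N" for \<tau>
    using eq[rule_format, of "\<tau> *\<^sub>R k"] that by (simp add: N_def h_def power2_eq_square algebra_simps)
  ultimately have "(h has_real_derivative 0) (at 0)"
    by (rule has_field_derivative_transform_within_open[OF DERIV_const[of 0]])
  moreover have "(h has_real_derivative (
      dir_deriv e X (0 *\<^sub>R k) * (dir_deriv k (dir_deriv e (dir_deriv e A)) 0
        + (g1 (Y (0 *\<^sub>R k), Z (0 *\<^sub>R k)) * (dir_deriv e Y (0 *\<^sub>R k) * dir_deriv k (dir_deriv e Y) 0 + dir_deriv k (dir_deriv e Y) 0 * dir_deriv e Y (0 *\<^sub>R k))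
          + (dir_deriv (1, 0) g1 (Y 0, Z 0) * ky + dir_deriv (0, 1) g1 (Y 0, Z 0) * kz) * (dir_deriv e Y (0 *\<^sub>R k) * dir_deriv e Y (0 *\<^sub>R k)))
        + 2 * (g2 (Y (0 *\<^sub>R k), Z (0 *\<^sub>R k)) * (dir_deriv e Y (0 *\<^sub>R k) * dir_deriv k (dir_deriv e Z) 0 + dir_deriv k (dir_deriv e Y) 0 * dir_deriv e Z (0 *\<^sub>R k))
          + (dir_deriv (1, 0) g2 (Y 0, Z 0) * ky + dir_deriv (0, 1) g2 (Y 0, Z 0) * kz) * (dir_deriv e Y (0 *\<^sub>R k) * dir_deriv e Z (0 *\<^sub>R k)))
        + (g3 (Y (0 *\<^sub>R k), Z (0 *\<^sub>R k)) * (dir_deriv e Z (0 *\<^sub>R k) * dir_deriv k (dir_deriv e Z) 0 + dir_deriv k (dir_deriv e Z) 0 * dir_deriv e Z (0 *\<^sub>R k))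
          + (dir_deriv (1, 0) g3 (Y 0, Z 0) * ky + dir_deriv (0, 1) g3 (Y 0, Z 0) * kz) * (dir_deriv e Z (0 *\<^sub>R k) * dir_deriv e Z (0 *\<^sub>R k))))
      + dir_deriv k (dir_deriv e X) 0 * (dir_deriv e (dir_deriv e A) (0 *\<^sub>R k)
        + g1 (Y (0 *\<^sub>R k), Z (0 *\<^sub>R k)) * (dir_deriv e Y (0 *\<^sub>R k) * dir_deriv e Y (0 *\<^sub>R k))
        + 2 * (g2 (Y (0 *\<^sub>R k), Z (0 *\<^sub>R k)) * (dir_deriv e Y (0 *\<^sub>R k) * dir_deriv e Z (0 *\<^sub>R k)))
        + g3 (Y (0 *\<^sub>R k), Z (0 *\<^sub>R k)) * (dir_deriv e Z (0 *\<^sub>R k) * dir_deriv e Z (0 *\<^sub>R k)))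
      - (dir_deriv e A (0 *\<^sub>R k) * dir_deriv k (dir_deriv e (dir_deriv e X)) 0
        + dir_deriv k (dir_deriv e A) 0 * dir_deriv e (dir_deriv e X) (0 *\<^sub>R k)))) (at 0)"
    unfolding h_def
    by (intro DERIV_diff DERIV_mult' DERIV_add DERIV_cmult line along g smooth_on_dir_deriv XYZ)
  ultimately have "0 = dir_deriv k (dir_deriv e (dir_deriv e A)) 0
        + g1 (Y 0, Z 0) * (2 * s * dir_deriv k (dir_deriv e Y) 0)
        + (dir_deriv (1, 0) g1 (Y 0, Z 0) * ky + dir_deriv (0, 1) g1 (Y 0, Z 0) * kz) * s\<^sup>2
        + 2 * (g2 (Y 0, Z 0) * (s * dir_deriv k (dir_deriv e Z) 0 + dir_deriv k (dir_deriv e Y) 0 * t))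
        + 2 * (dir_deriv (1, 0) g2 (Y 0, Z 0) * ky + dir_deriv (0, 1) g2 (Y 0, Z 0) * kz) * s * t
        + g3 (Y 0, Z 0) * (2 * t * dir_deriv k (dir_deriv e Z) 0)
        + (dir_deriv (1, 0) g3 (Y 0, Z 0) * ky + dir_deriv (0, 1) g3 (Y 0, Z 0) * kz) * t\<^sup>2
      + dir_deriv k (dir_deriv e X) 0 * (m * dir_deriv e (dir_deriv e X) 0)
      - m * dir_deriv k (dir_deriv e (dir_deriv e X)) 0
      - dir_deriv k (dir_deriv e A) 0 * dir_deriv e (dir_deriv e X) 0"
    using DERIV_unique E by (fastforce simp: e algebra_simps power2_eq_square)
  \<comment> \<open>Moving \<open>k\<close> to the innermost place leaves quadratic and linear forms
    in \<open>e\<close> applied to \<open>dir_deriv k f\<close>, ready for expansion in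
    \<open>s\<close> and \<open>t\<close>.\<close>
  moreover have "dir_deriv k (dir_deriv e (dir_deriv e f)) 0 = dir_deriv e (dir_deriv e (dir_deriv k f)) 0"
    "dir_deriv k (dir_deriv e f) 0 = dir_deriv e (dir_deriv k f) 0" if "smooth_on U f" for f :: "real \<times> real \<times> real \<Rightarrow> real"
    using dir_deriv3_commute[OF U(1) that U(2)] dir_deriv_commute[OF U(1) that U(2)] by metis+
  ultimately show "dir_deriv e (dir_deriv k X) 0 * (m * dir_deriv e (dir_deriv e X) 0)
      + (dir_deriv e (dir_deriv e (dir_deriv k A)) 0
        + ((dir_deriv (1, 0) g1 (Y 0, Z 0) * ky + dir_deriv (0, 1) g1 (Y 0, Z 0) * kz) * s\<^sup>2
          + 2 * (dir_deriv (1, 0) g2 (Y 0, Z 0) * ky + dir_deriv (0, 1) g2 (Y 0, Z 0) * kz) * s * t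
          + (dir_deriv (1, 0) g3 (Y 0, Z 0) * ky + dir_deriv (0, 1) g3 (Y 0, Z 0) * kz) * t\<^sup>2)
        + 2 * g1 (Y 0, Z 0) * s * dir_deriv e (dir_deriv k Y) 0
        + 2 * g2 (Y 0, Z 0) * (t * dir_deriv e (dir_deriv k Y) 0 + s * dir_deriv e (dir_deriv k Z) 0)
        + 2 * g3 (Y 0, Z 0) * t * dir_deriv e (dir_deriv k Z) 0)
      - dir_deriv e (dir_deriv k A) 0 * dir_deriv e (dir_deriv e X) 0
      - m * dir_deriv e (dir_deriv e (dir_deriv k X)) 0 = 0"
    using XYZ by (simp add: algebra_simps)
qed

text \<open>Here \<open>a\<close> and \<open>b\<close> stand for \<open>X_xy\<close> and
  \<open>X_xz\<close> at the point, \<open>y223\<close> and its like for third derivatives of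
  \<open>Y\<close> and \<open>Z\<close>, \<open>w212\<close> and its like for those of
  \<open>X\<close>, and the prefixes \<open>d2_\<close>, \<open>d3_\<close> for \<open>y\<close>-
  and \<open>z\<close>-derivatives of the coefficients. Twice each curvature entry is a combination
  of two equations whose third derivatives agree by \<open>sym\<close>, for instance the second of
  \<open>z2\<close> minus twice the first of \<open>z3\<close>; after inserting \<open>w\<close>,
  all terms in \<open>a\<close> and \<open>b\<close> cancel.\<close>

lemma flatness_from_jet_coefficients:
  fixes a b l :: real
  assumes y2: "2*a*a + y222 + d2_222 + 2*b222*(2*a - b222) + 2*b223*(- b322) - 2*(2*a - b222)*a - 2*w212 = 0"
      "2*a*b + 2*y223 + 2*d2_223 + 2*b222*(b - b223) + 2*b223*((2*a - b222) + (a - b323)) + 2*b233*(- b322)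
        - 2*(2*a - b222)*b - 2*(b - b223)*a - 2*w213 = 0"
      "y233 + d2_233 + 2*b223*(b - b223) + 2*b233*(a - b323) - 2*(b - b223)*b = 0"
    and y3: "2*b*a + y322 + d3_222 + 2*b222*(b - b223) + 2*b223*(a - b323) - 2*(b - b223)*a - 2*w312 = 0"
      "2*b*b + 2*y323 + 2*d3_223 + 2*b222*(- b233) + 2*b223*((b - b223) + (2*b - b333)) + 2*b233*(a - b323)
        - 2*(b - b223)*b - 2*(- b233)*a - 2*w313 = 0"
    and z2: "z222 + d2_322 + 2*b323*(- b322) + 2*b322*(2*a - b222) - 2*(- b322)*a = 0"
      "2*a*a + 2*z223 + 2*d2_323 + 2*b333*(- b322) + 2*b323*((a - b323) + (2*a - b222)) + 2*b322*(b - b223)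
        - 2*(a - b323)*a - 2*(- b322)*b - 2*w212 = 0"
      "2*a*b + z233 + d2_333 + 2*b333*(a - b323) + 2*b323*(b - b223) - 2*(a - b323)*b - 2*w213 = 0"
    and z3: "z322 + d3_322 + 2*b323*(a - b323) + 2*b322*(b - b223) - 2*(a - b323)*a = 0"
      "2*b*a + 2*z323 + 2*d3_323 + 2*b333*(a - b323) + 2*b323*((2*b - b333) + (b - b223)) + 2*b322*(- b233)
        - 2*(2*b - b333)*a - 2*(a - b323)*b - 2*w312 = 0"
    and w: "w212 = 2*a*a" "w213 = 2*a*b" "w312 = 2*a*b" "w313 = 2*b*b"
    and sym: "y223 = y322" "y233 = y323" "z223 = z322" "z233 = z323"
  shows "d2_323 - d3_322 + b322 * b223 + b323 * b323 - b323 * b222 - b333 * b322 = 0"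
    "d2_233 - d3_223 + b222 * b233 + b223 * b333 - b223 * b223 - b233 * b323 = 0"
    "d2_223 - d3_222 + b223 * b323 - b233 * b322 = 0"
    "d2_333 - d3_323 + b322 * b233 - b323 * b223 = 0"
  using assms by algebra+

text \<open>Along the directions \<open>(1, s, t)\<close> with \<open>\<eta>1 + s * \<eta>2 + t * \<eta>3 = 0\<close> the new independent variable
  is constant on the straight line, so these lines are not graphs and yield no identity.\<close>

lemma (in plane_connection) flat_at_of_line_identities:
  fixes X Y Z :: "real \<times> real \<times> real \<Rightarrow> real"
  assumes U: "open U" "0 \<in> U" and XYZ: "smooth_on U X" "smooth_on U Y" "smooth_on U Z"
    and D: "(Y 0, Z 0) \<in> D"
    and frame: "\<And>d. dir_deriv d X 0 = fst d" "\<And>d. dir_deriv d Y 0 = fst (snd d)" "\<And>d. dir_deriv d Z 0 = snd (snd d)"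
    and \<eta>: "\<eta>1 \<noteq> 0 \<or> \<eta>2 \<noteq> 0 \<or> \<eta>3 \<noteq> (0 :: real)"
    and eqY: "\<And>s t. \<eta>1 + s * \<eta>2 + t * \<eta>3 \<noteq> 0 \<Longrightarrow> \<forall>q\<in>U. dir_deriv (1, s, t) X q \<noteq> 0 \<longrightarrow>
      dir_deriv (1, s, t) X q * (dir_deriv (1, s, t) (dir_deriv (1, s, t) Y) q + b222 (Y q, Z q) * (dir_deriv (1, s, t) Y q)\<^sup>2
        + 2 * b223 (Y q, Z q) * dir_deriv (1, s, t) Y q * dir_deriv (1, s, t) Z q + b233 (Y q, Z q) * (dir_deriv (1, s, t) Z q)\<^sup>2)
      = dir_deriv (1, s, t) Y q * dir_deriv (1, s, t) (dir_deriv (1, s, t) X) q"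
    and eqZ: "\<And>s t. \<eta>1 + s * \<eta>2 + t * \<eta>3 \<noteq> 0 \<Longrightarrow> \<forall>q\<in>U. dir_deriv (1, s, t) X q \<noteq> 0 \<longrightarrow>
      dir_deriv (1, s, t) X q * (dir_deriv (1, s, t) (dir_deriv (1, s, t) Z) q + b322 (Y q, Z q) * (dir_deriv (1, s, t) Y q)\<^sup>2
        + 2 * b323 (Y q, Z q) * dir_deriv (1, s, t) Y q * dir_deriv (1, s, t) Z q + b333 (Y q, Z q) * (dir_deriv (1, s, t) Z q)\<^sup>2)
      = dir_deriv (1, s, t) Z q * dir_deriv (1, s, t) (dir_deriv (1, s, t) X) q"
  shows "flat_at (Y 0, Z 0)"
proof -
  define p where "p = (Y 0, Z 0)"
  have \<eta>': "\<eta>1 \<noteq> 0 \<or> \<eta>3 \<noteq> 0 \<or> \<eta>2 \<noteq> 0" using \<eta> by blast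
  define H where "H = (\<lambda>f :: real \<times> real \<times> real \<Rightarrow> real. \<lambda>d e. dir_deriv e (dir_deriv d f) 0)"
  define T where "T = (\<lambda>f :: real \<times> real \<times> real \<Rightarrow> real. \<lambda>k d e. dir_deriv e (dir_deriv d (dir_deriv k f)) 0)"
  have HT: "dir_deriv (1, s, t) (dir_deriv k f) 0 = H f k ex + s * H f k ey + t * H f k ez"
    "dir_deriv (1, s, t) (dir_deriv (1, s, t) f) 0 = H f ex ex + 2 * s * H f ex ey + 2 * t * H f ex ez
      + s\<^sup>2 * H f ey ey + 2 * s * t * H f ey ez + t\<^sup>2 * H f ez ez"
    "dir_deriv (1, s, t) (dir_deriv (1, s, t) (dir_deriv k f)) 0 = T f k ex ex + 2 * s * T f k ex ey + 2 * t * T f k ex ez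
      + s\<^sup>2 * T f k ey ey + 2 * s * t * T f k ey ez + t\<^sup>2 * T f k ez ez"
    if "smooth_on U f" for f s t k
    unfolding H_def T_def
    by (rule dir_deriv_real3[OF smooth_on_dir_deriv[OF that] U(2)] dir_deriv2_real3[OF U(1) that U(2)]
        dir_deriv2_real3[OF U(1) smooth_on_dir_deriv[OF that] U(2)])+
  have Hs: "H f d e = H f e d" and Ts: "T f k d e = T f k e d" "T f k d e = T f d k e"
    if "smooth_on U f" for f k d e
    unfolding H_def T_def
    by (rule dir_deriv_commute[OF U(1) that U(2)] dir_deriv3_commute[OF U(1) that U(2)])+
  \<comment> \<open>The expansions are unfolded from the third order downwards, since
    \<open>HT(1)\<close> with \<open>k = (1, s, t)\<close> would also match the pure second
    derivatives.\<close>
  note jetY = smooth_line_identity_jet[OF U XYZ XYZ(2) D smooth_coeffs(1,2,3) frame(1)[of "(1, s, t)" for s t, simplified]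
      frame(2)[of "(1, s, t)" for s t, simplified] frame(3)[of "(1, s, t)" for s t, simplified]
      frame(2)[of "(1, s, t)" for s t, simplified] frame(2,3) eqY, folded p_def,
      unfolded HT(3)[OF XYZ(1)] HT(3)[OF XYZ(2)] HT(3)[OF XYZ(3)], unfolded HT(2)[OF XYZ(1)] HT(2)[OF XYZ(2)] HT(2)[OF XYZ(3)],
      unfolded HT(1)[OF XYZ(1)] HT(1)[OF XYZ(2)] HT(1)[OF XYZ(3)]]
  note jetZ = smooth_line_identity_jet[OF U XYZ XYZ(3) D smooth_coeffs(4,5,6) frame(1)[of "(1, s, t)" for s t, simplified]
      frame(2)[of "(1, s, t)" for s t, simplified] frame(3)[of "(1, s, t)" for s t, simplified]
      frame(3)[of "(1, s, t)" for s t, simplified] frame(2,3) eqZ, folded p_def,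
      unfolded HT(3)[OF XYZ(1)] HT(3)[OF XYZ(2)] HT(3)[OF XYZ(3)], unfolded HT(2)[OF XYZ(1)] HT(2)[OF XYZ(2)] HT(2)[OF XYZ(3)],
      unfolded HT(1)[OF XYZ(1)] HT(1)[OF XYZ(2)] HT(1)[OF XYZ(3)]]
  note EY = cubic_eq_0_off_line[OF \<eta>, of "H Y ex ex" "2 * H Y ex ey - H X ex ex" "2 * H Y ex ez"
      "H Y ey ey + b222 p - 2 * H X ex ey" "2 * H Y ey ez + 2 * b223 p - 2 * H X ex ez" "H Y ez ez + b233 p"
      "- H X ey ey" "- 2 * H X ey ez" "- H X ez ez" 0]
  note EZ = cubic_eq_0_off_line[OF \<eta>, of "H Z ex ex" "2 * H Z ex ey" "2 * H Z ex ez - H X ex ex"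
      "H Z ey ey + b322 p" "2 * H Z ey ez + 2 * b323 p - 2 * H X ex ey" "H Z ez ez + b333 p - 2 * H X ex ez"
      0 "- H X ey ey" "- 2 * H X ey ez" "- H X ez ez"]
  \<comment> \<open>The identity at 0 equates a quadratic in \<open>s\<close>, \<open>t\<close> with
    \<open>s\<close> times the quadratic \<open>X_ee\<close>. Its cubic part kills the second
    derivatives of \<open>X\<close> in \<open>y\<close> and \<open>z\<close>; its quadratic part
    expresses those of \<open>Y\<close> through \<open>X_xy\<close>, \<open>X_xz\<close> and the
    connection.\<close>
  have X0: "H X ey ey = 0" "H X ey ez = 0" "H X ez ez = 0"
    and Y2: "H Y ey ey = 2 * H X ex ey - b222 p" "H Y ey ez = H X ex ez - b223 p" "H Y ez ez = - b233 p"
  proof -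
    have "H Y ex ex + (2 * H Y ex ey - H X ex ex) * s + 2 * H Y ex ez * t + (H Y ey ey + b222 p - 2 * H X ex ey) * s^2
      + (2 * H Y ey ez + 2 * b223 p - 2 * H X ex ez) * s * t + (H Y ez ez + b233 p) * t^2 + (- H X ey ey) * s^3
      + (- 2 * H X ey ez) * s^2 * t + (- H X ez ez) * s * t^2 + 0 * t^3 = 0" if "\<eta>1 + s * \<eta>2 + t * \<eta>3 \<noteq> 0" for s t
      using jetY(1)[OF that] by (simp, algebra)
    note EY[OF this]
    then show "H X ey ey = 0" "H X ey ez = 0" "H X ez ez = 0" "H Y ey ey = 2 * H X ex ey - b222 p"
      "H Y ey ez = H X ex ez - b223 p" "H Y ez ez = - b233 p" by simp_all
  qed
  have Z2: "H Z ey ey = - b322 p" "H Z ey ez = H X ex ey - b323 p" "H Z ez ez = 2 * H X ex ez - b333 p"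
  proof -
    have "H Z ex ex + 2 * H Z ex ey * s + (2 * H Z ex ez - H X ex ex) * t + (H Z ey ey + b322 p) * s^2
      + (2 * H Z ey ez + 2 * b323 p - 2 * H X ex ey) * s * t + (H Z ez ez + b333 p - 2 * H X ex ez) * t^2 + 0 * s^3
      + (- H X ey ey) * s^2 * t + (- 2 * H X ey ez) * s * t^2 + (- H X ez ez) * t^3 = 0" if "\<eta>1 + s * \<eta>2 + t * \<eta>3 \<noteq> 0" for s t
      using jetZ(1)[OF that] by (simp, algebra)
    note EZ[OF this]
    then show "H Z ey ey = - b322 p" "H Z ey ez = H X ex ey - b323 p" "H Z ez ez = 2 * H X ex ez - b333 p" by simp_all
  qed
  have JY: "\<And>k s t. \<eta>1 + s * \<eta>2 + t * \<eta>3 \<noteq> 0 \<Longrightarrow>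
      (H X k ex + s * H X k ey + t * H X k ez) * (s * (H X ex ex + 2 * s * H X ex ey + 2 * t * H X ex ez))
      + ((T Y k ex ex + 2 * s * T Y k ex ey + 2 * t * T Y k ex ez + s^2 * T Y k ey ey + 2 * s * t * T Y k ey ez + t^2 * T Y k ez ez)
        + ((dir_deriv (1, 0) b222 p * fst (snd k) + dir_deriv (0, 1) b222 p * snd (snd k)) * s^2
          + 2 * (dir_deriv (1, 0) b223 p * fst (snd k) + dir_deriv (0, 1) b223 p * snd (snd k)) * s * t
          + (dir_deriv (1, 0) b233 p * fst (snd k) + dir_deriv (0, 1) b233 p * snd (snd k)) * t^2)
        + 2 * b222 p * s * (H Y k ex + s * H Y k ey + t * H Y k ez)
        + 2 * b223 p * (t * (H Y k ex + s * H Y k ey + t * H Y k ez) + s * (H Z k ex + s * H Z k ey + t * H Z k ez))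
        + 2 * b233 p * t * (H Z k ex + s * H Z k ey + t * H Z k ez))
      - (H Y k ex + s * H Y k ey + t * H Y k ez) * (H X ex ex + 2 * s * H X ex ey + 2 * t * H X ex ez)
      - s * (T X k ex ex + 2 * s * T X k ex ey + 2 * t * T X k ex ez + s^2 * T X k ey ey + 2 * s * t * T X k ey ez + t^2 * T X k ez ez) = 0"
    using jetY(2) by (simp add: X0)
  \<comment> \<open>Written with \<open>s\<close> and \<open>t\<close>, and with them
    \<open>y\<close> and \<open>z\<close>, exchanged, so as to have the shape required by
    \<open>geodesic_jet\<close>.\<close>
  have JZ: "\<And>k t s. \<eta>1 + t * \<eta>3 + s * \<eta>2 \<noteq> 0 \<Longrightarrow>
      (H X k ex + t * H X k ez + s * H X k ey) * (t * (H X ex ex + 2 * t * H X ex ez + 2 * s * H X ex ey))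
      + ((T Z k ex ex + 2 * t * T Z k ex ez + 2 * s * T Z k ex ey + t^2 * T Z k ez ez + 2 * t * s * T Z k ey ez + s^2 * T Z k ey ey)
        + ((dir_deriv (1, 0) b333 p * fst (snd k) + dir_deriv (0, 1) b333 p * snd (snd k)) * t^2
          + 2 * (dir_deriv (1, 0) b323 p * fst (snd k) + dir_deriv (0, 1) b323 p * snd (snd k)) * t * s
          + (dir_deriv (1, 0) b322 p * fst (snd k) + dir_deriv (0, 1) b322 p * snd (snd k)) * s^2)
        + 2 * b333 p * t * (H Z k ex + t * H Z k ez + s * H Z k ey)
        + 2 * b323 p * (s * (H Z k ex + t * H Z k ez + s * H Z k ey) + t * (H Y k ex + t * H Y k ez + s * H Y k ey))
        + 2 * b322 p * s * (H Y k ex + t * H Y k ez + s * H Y k ey))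
      - (H Z k ex + t * H Z k ez + s * H Z k ey) * (H X ex ex + 2 * t * H X ex ez + 2 * s * H X ex ey)
      - t * (T X k ex ex + 2 * t * T X k ex ez + 2 * s * T X k ex ey + t^2 * T X k ez ez + 2 * t * s * T X k ey ez + s^2 * T X k ey ey) = 0"
  proof -
    fix k t s assume "\<eta>1 + t * \<eta>3 + s * \<eta>2 \<noteq> 0"
    then have "\<eta>1 + s * \<eta>2 + t * \<eta>3 \<noteq> 0" by (simp add: algebra_simps)
    from jetZ(2)[OF this, of k] show "?thesis k t s" by (simp add: X0) algebra
  qed
  note cY = geodesic_jet[OF \<eta> JY] and cZ = geodesic_jet[OF \<eta>' JZ]
  have sw: "H X ey ex = H X ex ey" "H X ez ex = H X ex ez" "H X ez ey = H X ey ez"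
    "H Y ez ey = H Y ey ez" "H Z ez ey = H Z ey ez"
    by (rule Hs; rule XYZ)+
  \<comment> \<open>For \<open>k = ex\<close> the cubic coefficients determine the third derivatives
    of \<open>X\<close> with exactly one \<open>x\<close>.\<close>
  have w: "T X ey ex ey = 2 * H X ex ey * H X ex ey" "T X ey ex ez = 2 * H X ex ey * H X ex ez"
    "T X ez ex ey = 2 * H X ex ey * H X ex ez" "T X ez ex ez = 2 * H X ex ez * H X ex ez"
    using cY(4-6)[of ex] Ts[OF XYZ(1)] by simp_all
  \<comment> \<open>The remaining equations are quadratic coefficients for \<open>k = ey\<close> and
    \<open>k = ez\<close>. In \<open>cZ\<close> the roles are exchanged: its first conclusion
    belongs to \<open>t^2\<close>, its third to \<open>s^2\<close>.\<close>
  have j1: "2*H X ex ey*H X ex ey + T Y ey ey ey + dir_deriv (1, 0) b222 p + 2*b222 p*(2*H X ex ey - b222 p) + 2*b223 p*(- b322 p) - 2*(2*H X ex ey - b222 p)*H X ex ey - 2*T X ey ex ey = 0"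
    using cY(1)[of ey] by (simp add: sw X0 Y2 Z2 algebra_simps)
  have j2: "2*H X ex ey*H X ex ez + 2*T Y ey ey ez + 2*dir_deriv (1, 0) b223 p + 2*b222 p*(H X ex ez - b223 p) + 2*b223 p*((2*H X ex ey - b222 p) + (H X ex ey - b323 p)) + 2*b233 p*(- b322 p) - 2*(2*H X ex ey - b222 p)*H X ex ez - 2*(H X ex ez - b223 p)*H X ex ey - 2*T X ey ex ez = 0"
    using cY(2)[of ey] by (simp add: sw X0 Y2 Z2 algebra_simps)
  have j3: "T Y ey ez ez + dir_deriv (1, 0) b233 p + 2*b223 p*(H X ex ez - b223 p) + 2*b233 p*(H X ex ey - b323 p) - 2*(H X ex ez - b223 p)*H X ex ez = 0"
    using cY(3)[of ey] by (simp add: sw X0 Y2 Z2 algebra_simps)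
  have j4: "2*H X ex ez*H X ex ey + T Y ez ey ey + dir_deriv (0, 1) b222 p + 2*b222 p*(H X ex ez - b223 p) + 2*b223 p*(H X ex ey - b323 p) - 2*(H X ex ez - b223 p)*H X ex ey - 2*T X ez ex ey = 0"
    using cY(1)[of ez] by (simp add: sw X0 Y2 Z2 algebra_simps)
  have j5: "2*H X ex ez*H X ex ez + 2*T Y ez ey ez + 2*dir_deriv (0, 1) b223 p + 2*b222 p*(- b233 p) + 2*b223 p*((H X ex ez - b223 p) + (2*H X ex ez - b333 p)) + 2*b233 p*(H X ex ey - b323 p) - 2*(H X ex ez - b223 p)*H X ex ez - 2*(- b233 p)*H X ex ey - 2*T X ez ex ez = 0"
    using cY(2)[of ez] by (simp add: sw X0 Y2 Z2 algebra_simps)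
  have j6: "T Z ey ey ey + dir_deriv (1, 0) b322 p + 2*b323 p*(- b322 p) + 2*b322 p*(2*H X ex ey - b222 p) - 2*(- b322 p)*H X ex ey = 0"
    using cZ(3)[of ey] by (simp add: sw X0 Y2 Z2 algebra_simps)
  have j7: "2*H X ex ey*H X ex ey + 2*T Z ey ey ez + 2*dir_deriv (1, 0) b323 p + 2*b333 p*(- b322 p) + 2*b323 p*((H X ex ey - b323 p) + (2*H X ex ey - b222 p)) + 2*b322 p*(H X ex ez - b223 p) - 2*(H X ex ey - b323 p)*H X ex ey - 2*(- b322 p)*H X ex ez - 2*T X ey ex ey = 0"
    using cZ(2)[of ey] by (simp add: sw X0 Y2 Z2 algebra_simps)
  have j8: "2*H X ex ey*H X ex ez + T Z ey ez ez + dir_deriv (1, 0) b333 p + 2*b333 p*(H X ex ey - b323 p) + 2*b323 p*(H X ex ez - b223 p) - 2*(H X ex ey - b323 p)*H X ex ez - 2*T X ey ex ez = 0"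
    using cZ(1)[of ey] by (simp add: sw X0 Y2 Z2 algebra_simps)
  have j9: "T Z ez ey ey + dir_deriv (0, 1) b322 p + 2*b323 p*(H X ex ey - b323 p) + 2*b322 p*(H X ex ez - b223 p) - 2*(H X ex ey - b323 p)*H X ex ey = 0"
    using cZ(3)[of ez] by (simp add: sw X0 Y2 Z2 algebra_simps)
  have j10: "2*H X ex ez*H X ex ey + 2*T Z ez ey ez + 2*dir_deriv (0, 1) b323 p + 2*b333 p*(H X ex ey - b323 p) + 2*b323 p*((2*H X ex ez - b333 p) + (H X ex ez - b223 p)) + 2*b322 p*(- b233 p) - 2*(2*H X ex ez - b333 p)*H X ex ey - 2*(H X ex ey - b323 p)*H X ex ez - 2*T X ez ex ey = 0"
    using cZ(2)[of ez] by (simp add: sw X0 Y2 Z2 algebra_simps)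
  have sym: "T Y ey ey ez = T Y ez ey ey" "T Y ey ez ez = T Y ez ey ez"
    "T Z ey ey ez = T Z ez ey ey" "T Z ey ez ez = T Z ez ey ez"
    using Ts[OF XYZ(2)] Ts[OF XYZ(3)] by simp_all
  show ?thesis
    unfolding p_def[symmetric] flat_at_def
    using flatness_from_jet_coefficients[OF j1 j2 j3 j4 j5 j6 j7 j8 j9 j10 w sym] by blast
qed

section \<open>The linearization criterion\<close>

lemma dir_deriv_left_inverse:
  assumes "open V" "x \<in> V" "smooth_on V f" "smooth_on W g" "f x \<in> W" "\<And>y. y \<in> V \<Longrightarrow> g (f y) = y"
  shows "dir_deriv (dir_deriv d f x) g (f x) = d"
proof -
  have "((\<lambda>y. g (f y)) has_derivative (\<lambda>d. dir_deriv (dir_deriv d f x) g (f x))) (at x)"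
    by (rule has_derivative_compose[OF smooth_on_has_derivative[OF assms(3,2)] smooth_on_has_derivative[OF assms(4,5)]])
  then have "((\<lambda>y. y) has_derivative (\<lambda>d. dir_deriv (dir_deriv d f x) g (f x))) (at x)"
    by (rule has_derivative_transform_within_open[OF _ assms(1,2,6)])
  from has_derivative_unique[OF this has_derivative_ident] show ?thesis by metis
qed

lemma (in plane_connection) linearizable_imp_flat:
  assumes "linearizable_on (UNIV \<times> D) geodesic_system" "p \<in> D"
  shows "flat_at p"
proof -
  \<comment> \<open>The coefficients do not depend on \<open>x\<close> and the domain contains every
    \<open>x\<close>, so any first coordinate would do.\<close>
  define P where "P = (0 :: real, p)"
  obtain V \<phi> where V: "P \<in> V" "V \<subseteq> UNIV \<times> D" and pt: "point_transformation V \<phi>"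
    and trans: "transforms_system V \<phi> geodesic_system free_particle"
    using assms unfolding linearizable_on_def P_def by blast
  define W where "W = \<phi> ` V"
  define \<psi> where "\<psi> = inv_into V \<phi>"
  have V': "open V" "smooth_on V \<phi>" "inj_on \<phi> V" "open W" "smooth_on W \<psi>"
    using pt by (auto simp: point_transformation_def W_def \<psi>_def)
  have \<psi>\<phi>: "\<psi> (\<phi> x) = x" if "x \<in> V" for x using V'(3) that by (simp add: \<psi>_def)
  have \<phi>\<psi>: "\<phi> (\<psi> y) = y" "\<psi> y \<in> V" if "y \<in> W" for y
    using that by (auto simp: W_def \<psi>\<phi>)
  define Q where "Q = \<phi> P"
  define L where "L = (\<lambda>d. dir_deriv d \<phi> P)"
  have QW: "Q \<in> W" using V by (simp add: Q_def W_def)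
  have inv1: "dir_deriv (L d) \<psi> Q = d" for d
    unfolding L_def Q_def by (rule dir_deriv_left_inverse[OF V'(1) V(1) V'(2,5)]) (use QW \<psi>\<phi> in \<open>auto simp: Q_def\<close>)
  have "\<psi> Q = P" using \<psi>\<phi>[OF V(1)] by (simp add: Q_def)
  have inv2: "L (dir_deriv d \<psi> Q) = d" for d
    using dir_deriv_left_inverse[OF V'(4) QW V'(5,2), of d] \<phi>\<psi> QW V(1) \<open>\<psi> Q = P\<close> by (simp add: L_def)
  have bl: "bounded_linear L"
    unfolding L_def using has_derivative_bounded_linear[OF smooth_on_has_derivative[OF V'(2) V(1)]] .
  interpret L: bounded_linear L by (rule bl)
  \<comment> \<open>The normalising linear map is the derivative \<open>L\<close> of
    \<open>\<phi>\<close> at \<open>P\<close>, inverse to that of \<open>\<psi>\<close> at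
    \<open>Q\<close>. An affine substitution in the target keeps straight lines straight, so nothing
    is lost.\<close>
  define U where "U = (\<lambda>e. Q + L e) -` W"
  have U: "open U" "0 \<in> U"
    using QW V'(4) by (auto simp: U_def L.zero intro!: open_vimage continuous_intros L.continuous_on)
  define \<Psi> where "\<Psi> = (\<lambda>e. \<psi> (Q + L e))"
  have sm: "smooth_on U \<Psi>"
    unfolding \<Psi>_def
    by (rule smooth_on_compose[OF U(1) _ V'(5)])
      (auto simp: U_def[symmetric] intro!: smooth_intros U smooth_on_bounded_linear[OF _ bl], simp add: U_def)
  have d\<Psi>: "dir_deriv d \<Psi> 0 = d" for d
  proof -
    have "((\<lambda>e. Q + L e) has_derivative L) (at 0)"
      using L.has_derivative[OF has_derivative_ident] by (auto intro!: derivative_eq_intros)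
    moreover have "(\<psi> has_derivative (\<lambda>d. dir_deriv d \<psi> Q)) (at (Q + L 0))"
      using smooth_on_has_derivative[OF V'(5) QW] by (simp add: L.zero)
    ultimately have "(\<Psi> has_derivative (\<lambda>d. dir_deriv (L d) \<psi> Q)) (at 0)"
      unfolding \<Psi>_def by (rule has_derivative_compose)
    then show ?thesis by (simp add: dir_deriv_eq inv1)
  qed
  define X where "X = (\<lambda>e. fst (\<Psi> e))"
  define Y where "Y = (\<lambda>e. fst (snd (\<Psi> e)))"
  define Z where "Z = (\<lambda>e. snd (snd (\<Psi> e)))"
  have XYZ: "smooth_on U X" "smooth_on U Y" "smooth_on U Z"
    unfolding X_def Y_def Z_def by (intro smooth_on_fst smooth_on_snd U sm)+
  have frame: "dir_deriv d X 0 = fst d" "dir_deriv d Y 0 = fst (snd d)" "dir_deriv d Z 0 = snd (snd d)" for d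
    unfolding X_def Y_def Z_def
    using dir_deriv_bounded_linear[OF bounded_linear_fst sm U(2)]
      dir_deriv_bounded_linear[OF bounded_linear_compose[OF bounded_linear_fst bounded_linear_snd] sm U(2)]
      dir_deriv_bounded_linear[OF bounded_linear_compose[OF bounded_linear_snd bounded_linear_snd] sm U(2)]
    by (simp_all add: d\<Psi>)
  have Y0: "(Y 0, Z 0) = p"
    by (simp add: Y_def Z_def \<Psi>_def L.zero \<open>\<psi> Q = P\<close> P_def)
  have lin: "fst (L (r, s, t)) = r * fst (L ex) + s * fst (L ey) + t * fst (L ez)" for r s t
  proof -
    have "L (r *\<^sub>R ex + s *\<^sub>R ey + t *\<^sub>R ez) = r *\<^sub>R L ex + s *\<^sub>R L ey + t *\<^sub>R L ez"
      by (simp only: L.add L.scaleR)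
    then show ?thesis by (simp add: prod_eq_iff)
  qed
  \<comment> \<open>By \<open>inv2\<close> the map \<open>L\<close> is onto, so its first component
    is not the zero functional.\<close>
  have "fst (L (dir_deriv (1, 0, 0) \<psi> Q)) \<noteq> 0" by (simp add: inv2)
  then have \<eta>: "fst (L ex) \<noteq> 0 \<or> fst (L ey) \<noteq> 0 \<or> fst (L ez) \<noteq> 0"
    using lin by (metis mult_zero_right add_0 prod.collapse)
  have \<Psi>V: "\<Psi> e \<in> V \<and> \<phi> (\<Psi> e) = Q + L e" if "e \<in> U" for e
    using that \<phi>\<psi> by (simp add: U_def \<Psi>_def)
  have "flat_at (Y 0, Z 0)"
  proof (rule flat_at_of_line_identities[OF U XYZ _ frame \<eta>])
    show "(Y 0, Z 0) \<in> D" using Y0 assms(2) by simp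
    fix s t assume "fst (L ex) + s * fst (L ey) + t * fst (L ez) \<noteq> 0"
    then have "fst (L (1, s, t)) \<noteq> 0" by (metis lin[of 1 s t] mult_1)
    note id = straight_line_identity[OF V(2) trans bl U(1) \<Psi>V XYZ _ _ _ this]
    show "\<forall>q\<in>U. dir_deriv (1, s, t) X q \<noteq> 0 \<longrightarrow> dir_deriv (1, s, t) X q * (dir_deriv (1, s, t) (dir_deriv (1, s, t) Y) q + b222 (Y q, Z q) * (dir_deriv (1, s, t) Y q)\<^sup>2
        + 2 * b223 (Y q, Z q) * dir_deriv (1, s, t) Y q * dir_deriv (1, s, t) Z q + b233 (Y q, Z q) * (dir_deriv (1, s, t) Z q)\<^sup>2)
      = dir_deriv (1, s, t) Y q * dir_deriv (1, s, t) (dir_deriv (1, s, t) X) q"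
      using id(1) by (simp add: X_def Y_def Z_def)
    show "\<forall>q\<in>U. dir_deriv (1, s, t) X q \<noteq> 0 \<longrightarrow> dir_deriv (1, s, t) X q * (dir_deriv (1, s, t) (dir_deriv (1, s, t) Z) q + b322 (Y q, Z q) * (dir_deriv (1, s, t) Y q)\<^sup>2
        + 2 * b323 (Y q, Z q) * dir_deriv (1, s, t) Y q * dir_deriv (1, s, t) Z q + b333 (Y q, Z q) * (dir_deriv (1, s, t) Z q)\<^sup>2)
      = dir_deriv (1, s, t) Z q * dir_deriv (1, s, t) (dir_deriv (1, s, t) X) q"
      using id(2) by (simp add: X_def Y_def Z_def)
  qed
  then show ?thesis using Y0 by simp
qed

lemma partials_eq_dir_deriv:
  assumes "smooth_on D (\<lambda>(y, z). f y z)" "(y, z) \<in> D"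
  shows "partial1 f y z = dir_deriv (1, 0) (\<lambda>(y, z). f y z) (y, z)"
    "partial2 f y z = dir_deriv (0, 1) (\<lambda>(y, z). f y z) (y, z)"
  using smooth_on_vector_derivative_fst[OF assms] smooth_on_vector_derivative_snd[OF assms]
  by (auto simp: partial1_def partial2_def has_real_derivative_iff_has_vector_derivative[symmetric]
      intro!: DERIV_imp_deriv)

theorem corollary1:
  fixes D :: "(real \<times> real) set"
    and B222 B223 B233 B322 B323 B333 :: "real \<Rightarrow> real \<Rightarrow> real"
  assumes "open D"
    and "smooth_on D (\<lambda>(y, z). B222 y z)"
    and "smooth_on D (\<lambda>(y, z). B223 y z)"
    and "smooth_on D (\<lambda>(y, z). B233 y z)"
    and "smooth_on D (\<lambda>(y, z). B322 y z)"
    and "smooth_on D (\<lambda>(y, z). B323 y z)"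
    and "smooth_on D (\<lambda>(y, z). B333 y z)"
  shows "linearizable_on (UNIV \<times> D) (quadratic_system B222 B223 B233 B322 B323 B333) \<longleftrightarrow>
    (\<forall>(y, z)\<in>D.
      - B322 y z * B333 y z + partial1 B323 y z - partial2 B322 y z + B322 y z * B223 y z
        + B323 y z * B323 y z - B323 y z * B222 y z = 0 \<and>
      4/3 * partial1 B333 y z - 4/3 * partial2 B323 y z + 2 * B322 y z * B233 y z
        - 2 * B323 y z * B223 y z - 2/3 * partial1 B223 y z + 2/3 * partial2 B222 y z = 0 \<and>
      - (1/3) * partial2 B323 y z + B233 y z * B322 y z - B223 y z * B323 y z
        - 2/3 * partial1 B223 y z + 1/3 * partial1 B333 y z + 2/3 * partial2 B222 y z = 0 \<and>
      - partial1 B233 y z + partial2 B223 y z - B222 y z * B233 y z + B223 y z * B223 y z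
        - B223 y z * B333 y z + B233 y z * B323 y z = 0)"
proof -
  interpret plane_connection D "\<lambda>(y, z). B222 y z" "\<lambda>(y, z). B223 y z" "\<lambda>(y, z). B233 y z"
      "\<lambda>(y, z). B322 y z" "\<lambda>(y, z). B323 y z" "\<lambda>(y, z). B333 y z"
    using assms by unfold_locales
  note part = partials_eq_dir_deriv[OF assms(2)] partials_eq_dir_deriv[OF assms(3)] partials_eq_dir_deriv[OF assms(4)]
    partials_eq_dir_deriv[OF assms(5)] partials_eq_dir_deriv[OF assms(6)] partials_eq_dir_deriv[OF assms(7)]
  have "linearizable_on (UNIV \<times> D) (quadratic_system B222 B223 B233 B322 B323 B333) \<longleftrightarrow> (\<forall>p\<in>D. flat_at p)"
    using flat_imp_linearizable linearizable_imp_flat by auto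
  also have "\<dots> \<longleftrightarrow> (\<forall>(y, z)\<in>D.
      - B322 y z * B333 y z + partial1 B323 y z - partial2 B322 y z + B322 y z * B223 y z
        + B323 y z * B323 y z - B323 y z * B222 y z = 0 \<and>
      4/3 * partial1 B333 y z - 4/3 * partial2 B323 y z + 2 * B322 y z * B233 y z
        - 2 * B323 y z * B223 y z - 2/3 * partial1 B223 y z + 2/3 * partial2 B222 y z = 0 \<and>
      - (1/3) * partial2 B323 y z + B233 y z * B322 y z - B223 y z * B323 y z
        - 2/3 * partial1 B223 y z + 1/3 * partial1 B333 y z + 2/3 * partial2 B222 y z = 0 \<and>
      - partial1 B233 y z + partial2 B223 y z - B222 y z * B233 y z + B223 y z * B223 y z
        - B223 y z * B333 y z + B233 y z * B323 y z = 0)" (is "_ \<longleftrightarrow> (\<forall>(y, z)\<in>D. ?C y z)")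
  proof -
    \<comment> \<open>With \<open>R2\<close> and \<open>R3\<close> the entries \<open>(2, 2)\<close>
      and \<open>(3, 3)\<close> of the curvature, the second condition is
      \<open>4/3 R3 - 2/3 R2\<close> and the third \<open>1/3 R3 - 2/3 R2\<close>; their difference
      is \<open>R3\<close>. The first condition is the entry \<open>(3, 2)\<close>, the fourth the
      negative of \<open>(2, 3)\<close>.\<close>
    have "flat_at (y, z) \<longleftrightarrow> ?C y z" if "(y, z) \<in> D" for y z
      unfolding flat_at_def part[OF that, symmetric] prod.case by (auto simp: field_simps)
    then show ?thesis by (intro ball_cong) auto
  qed
  finally show ?thesis .
qed

end
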